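(* Let $\mathbb K$ be an algebraically closed field of characteristic zero and let $q\geq 2$ be an integer. (a) Let $B$ be a nondegenerate bilinear form on $\mathbb K^q$ with components $B_{\mu\nu}=B(e_\mu,e_\nu)$ in the canonical basis $(e_\lambda)_{\lambda\in\{1,\dots,q\}}$ of $\mathbb K^q$. Then the quadratic algebra $\mathcal A$ generated by the elements $x^\lambda$ ($\lambda\in\{1,\dots,q\}$) with the single relation $\sum_{\mu,\nu=1}^q B_{\mu\nu}x^\mu x^\nu=0$ is Koszul of global dimension $2$ and Gorenstein. (b) Conversely, any quadratic algebra generated by $q$ elements $x^\lambda$ ($\lambda\in\{1,\dots,q\}$) which is Koszul of global dimension $2$ and Gorenstein is the quadratic algebra generated by the $x^\lambda$ with the single relation $\sum_{\mu,\nu=1}^q B_{\mu\nu}x^\mu x^\nu=0$, where $B_{\mu\nu}=B(e_\mu,e_\nu)$, for some nondegenerate bilinear form $B$ on $\mathbb K^q$. (c) Two nondegenerate bilinear forms on $\mathbb K^q$ which are in the same $GL(q,\mathbb K)$-orbit correspond to isomorphic algebras, where the algebra corresponding to a nondegenerate bilinear form $B$ is the quadratic algebra generated by the $x^\lambda$ ($\lambda\in\{1,\dots,q\}$) with the single relation $\sum_{\mu,\nu=1}^q B_{\mu\nu}x^\mu x^\nu=0$.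
   Context: All algebras are associative unital algebras over $\mathbb K$. A quadratic algebra generated by $q$ elements $x^\lambda$ is a graded algebra $\mathcal A=T(E)/(R)$, where $E=\bigoplus_{\lambda=1}^q\mathbb K x^\lambda$ is a vector space with basis $(x^\lambda)$ placed in degree $1$, $T(E)$ is its tensor algebra, and $(R)$ is the two-sided ideal generated by a subspace $R\subset E\otimes E$ (the space of relations). It is connected, $\mathcal A_0=\mathbb K$, and $\mathbb K=\mathcal A/\bigoplus_{n\ge1}\mathcal A_n$ is the trivial $\mathcal A$-module. Set $K_0=\mathbb K$, $K_1=E$ and, for $n\ge 2$, $K_n=\bigcap_{r+s=n-2}E^{\otimes r}\otimes R\otimes E^{\otimes s}\subset E^{\otimes n}$. The Koszul complex of $\mathcal A$ is the complex of free left $\mathcal A$-modules $\cdots\to\mathcal A\otimes K_n\stackrel{d}{\to}\mathcal A\otimes K_{n-1}\to\cdots\to\mathcal A\otimes K_1\stackrel{d}{\to}\mathcal A\to 0$, with $d$ induced by $a\otimes(v_1\otimes v_2\otimes\cdots\otimes v_n)\mapsto av_1\otimes(v_2\otimes\cdots\otimes v_n)$. $\mathcal A$ is Koszul if this complex is acyclic in degrees $\ge1$ (so that it is a free resolution of the trivial left module $\mathbb K$). The global dimension of the connected graded algebra $\mathcal A$ is the projective dimension of the trivial module $\mathbb K$. An algebra $\mathcal A$ of finite global dimension $D$ is Gorenstein if $\mathrm{Ext}^n_{\mathcal A}(\mathbb K,\mathcal A)=0$ for $n\ne D$ and $\mathrm{Ext}^D_{\mathcal A}(\mathbb K,\mathcal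 A)\simeq\mathbb K$ (one-dimensional). The group $GL(q,\mathbb K)$ acts on bilinear forms by $B\mapsto B^L$, $B^L(X,Y)=B(L^{-1}X,L^{-1}Y)$. *)

theory Defs
  imports
    "HOL-Analysis.Analysis"
    "HOL-Algebra.Algebra"
    "HOL-Library.Poly_Mapping"
    "HOL-Library.Extended_Nat"
    "HOL-Computational_Algebra.Polynomial"
begin

section \<open>Left modules over a ring that need not be commutative\<close>

text \<open>The locale \<^locale>\<open>module\<close> of HOL-Algebra requires a commutative base ring. Its record type
  is reused here; the multiplication and unit fields of a record that is only used as a module
  carry no information.\<close>

locale left_module = R?: ring R + M?: abelian_group M
  for R :: "('a, 'r) ring_scheme" (structure) and M :: "('a, 'b, 's) module_scheme" (structure) +
  assumes smult_closed: "\<lbrakk>a \<in> carrier R; x \<in> carrier M\<rbrakk> \<Longrightarrow> a \<odot>\<^bsub>M\<^esub> x \<in> carrier M"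
    and smult_l_distr: "\<lbrakk>a \<in> carrier R; b \<in> carrier R; x \<in> carrier M\<rbrakk> \<Longrightarrow>
      (a \<oplus>\<^bsub>R\<^esub> b) \<odot>\<^bsub>M\<^esub> x = (a \<odot>\<^bsub>M\<^esub> x) \<oplus>\<^bsub>M\<^esub> (b \<odot>\<^bsub>M\<^esub> x)"
    and smult_r_distr: "\<lbrakk>a \<in> carrier R; x \<in> carrier M; y \<in> carrier M\<rbrakk> \<Longrightarrow>
      a \<odot>\<^bsub>M\<^esub> (x \<oplus>\<^bsub>M\<^esub> y) = (a \<odot>\<^bsub>M\<^esub> x) \<oplus>\<^bsub>M\<^esub> (a \<odot>\<^bsub>M\<^esub> y)"
    and smult_assoc: "\<lbrakk>a \<in> carrier R; b \<in> carrier R; x \<in> carrier M\<rbrakk> \<Longrightarrow>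
      (a \<otimes>\<^bsub>R\<^esub> b) \<odot>\<^bsub>M\<^esub> x = a \<odot>\<^bsub>M\<^esub> (b \<odot>\<^bsub>M\<^esub> x)"
    and smult_one: "x \<in> carrier M \<Longrightarrow> \<one>\<^bsub>R\<^esub> \<odot>\<^bsub>M\<^esub> x = x"

definition lhom :: "('a, 'r) ring_scheme \<Rightarrow> ('a, 'b, 's) module_scheme
    \<Rightarrow> ('a, 'c, 't) module_scheme \<Rightarrow> ('b \<Rightarrow> 'c) set"
  where "lhom R M N = {f \<in> carrier M \<rightarrow>\<^sub>E carrier N.
    (\<forall>x\<in>carrier M. \<forall>y\<in>carrier M. f (x \<oplus>\<^bsub>M\<^esub> y) = f x \<oplus>\<^bsub>N\<^esub> f y) \<and>
    (\<forall>a\<in>carrier R. \<forall>x\<in>carrier M. f (a \<odot>\<^bsub>M\<^esub> x) = a \<odot>\<^bsub>N\<^esub> f x)}"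

definition isomorphic_modules :: "('a, 'r) ring_scheme \<Rightarrow> ('a, 'b, 's) module_scheme
    \<Rightarrow> ('a, 'c, 't) module_scheme \<Rightarrow> bool"
  where "isomorphic_modules R M N \<longleftrightarrow> (\<exists>f\<in>lhom R M N. bij_betw f (carrier M) (carrier N))"

definition regular_module :: "('a, 'r) ring_scheme \<Rightarrow> ('a, 'a) module"
  where "regular_module R = \<lparr>carrier = carrier R, monoid.mult = (\<otimes>\<^bsub>R\<^esub>), one = \<one>\<^bsub>R\<^esub>,
    ring.zero = \<zero>\<^bsub>R\<^esub>, add = (\<oplus>\<^bsub>R\<^esub>), smult = (\<otimes>\<^bsub>R\<^esub>)\<rparr>"

definition quot_module :: "('a, 'b, 's) module_scheme \<Rightarrow> 'b set \<Rightarrow> ('a, 'b set) module"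
  where "quot_module M N = \<lparr>carrier = a_rcosets\<^bsub>M\<^esub> N, monoid.mult = undefined, one = undefined,
    ring.zero = N, add = set_add M, smult = (\<lambda>c Y. \<Union>x\<in>Y. N +>\<^bsub>M\<^esub> (c \<odot>\<^bsub>M\<^esub> x))\<rparr>"

text \<open>The free left module with basis indexed by \<open>I\<close>: finitely supported functions on \<open>I\<close>,
  extended by zero.\<close>

definition free_module :: "('a, 'r) ring_scheme \<Rightarrow> 'i set \<Rightarrow> ('a, 'i \<Rightarrow> 'a) module"
  where "free_module R I =
    \<lparr>carrier = {f. (\<forall>i. f i \<in> carrier R) \<and> (\<forall>i. i \<notin> I \<longrightarrow> f i = \<zero>\<^bsub>R\<^esub>) \<and> finite {i. f i \<noteq> \<zero>\<^bsub>R\<^esub>}},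
     monoid.mult = undefined, one = undefined,
     ring.zero = (\<lambda>_. \<zero>\<^bsub>R\<^esub>), add = (\<lambda>f g i. f i \<oplus>\<^bsub>R\<^esub> g i), smult = (\<lambda>a f i. a \<otimes>\<^bsub>R\<^esub> f i)\<rparr>"

text \<open>Projective: a direct summand of a free module. It is no restriction to index the basis by
  elements of the type of \<open>P\<close>, since \<open>P\<close> is a quotient of the free module on its own carrier.\<close>

definition projective_module :: "('a, 'r) ring_scheme \<Rightarrow> ('a, 'p) module \<Rightarrow> bool"
  where "projective_module R P \<longleftrightarrow> left_module R P \<and>
    (\<exists>I :: 'p set. \<exists>s \<in> lhom R P (free_module R I). \<exists>p \<in> lhom R (free_module R I) P.
      \<forall>x\<in>carrier P. p (s x) = x)"

text \<open>\<open>\<dots> \<rightarrow> P 2 \<rightarrow> P 1 \<rightarrow> P 0 \<rightarrow> M \<rightarrow> 0\<close> with \<open>d n : P (Suc n) \<rightarrow> P n\<close> and augmentation \<open>e\<close>.\<close>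

definition projective_resolution :: "('a, 'r) ring_scheme \<Rightarrow> ('a, 'm) module
    \<Rightarrow> (nat \<Rightarrow> ('a, 'p) module) \<Rightarrow> (nat \<Rightarrow> 'p \<Rightarrow> 'p) \<Rightarrow> ('p \<Rightarrow> 'm) \<Rightarrow> bool"
  where "projective_resolution R M P d e \<longleftrightarrow>
    (\<forall>n. projective_module R (P n)) \<and>
    (\<forall>n. d n \<in> lhom R (P (Suc n)) (P n)) \<and>
    e \<in> lhom R (P 0) M \<and>
    e ` carrier (P 0) = carrier M \<and>
    {x \<in> carrier (P 0). e x = \<zero>\<^bsub>M\<^esub>} = d 0 ` carrier (P 1) \<and>
    (\<forall>n. {x \<in> carrier (P (Suc n)). d n x = \<zero>\<^bsub>P n\<^esub>} = d (Suc n) ` carrier (P (Suc (Suc n))))"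

text \<open>Projective dimension, measured by resolutions whose modules live on the type \<open>'p\<close>; this is
  the true projective dimension as soon as \<open>'p\<close> is large enough for the syzygies of \<open>M\<close> to be
  covered by free modules on that type.\<close>

definition proj_dim :: "'p itself \<Rightarrow> ('a, 'r) ring_scheme \<Rightarrow> ('a, 'm) module \<Rightarrow> enat"
  where "proj_dim _ R M = Inf {enat D | D. \<exists>(P :: nat \<Rightarrow> ('a, 'p) module) d e.
    projective_resolution R M P d e \<and> (\<forall>n>D. carrier (P n) = {\<zero>\<^bsub>P n\<^esub>})}"

text \<open>From here on \<open>A\<close> is a \<open>'k\<close>-algebra: a ring record whose scalar multiplication is the
  action of the ground field \<open>'k\<close>. Then \<open>Hom\<^sub>A(M, N)\<close> is a vector space over \<open>'k\<close>.\<close>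

definition hom_module :: "('k, 'a) module \<Rightarrow> ('a, 'b) module \<Rightarrow> ('a, 'c) module
    \<Rightarrow> ('k, 'b \<Rightarrow> 'c) module"
  where "hom_module A M N = \<lparr>carrier = lhom A M N, monoid.mult = undefined, one = undefined,
    ring.zero = (\<lambda>x\<in>carrier M. \<zero>\<^bsub>N\<^esub>), add = (\<lambda>f g. \<lambda>x\<in>carrier M. f x \<oplus>\<^bsub>N\<^esub> g x),
    smult = (\<lambda>c f. \<lambda>x\<in>carrier M. (c \<odot>\<^bsub>A\<^esub> \<one>\<^bsub>A\<^esub>) \<odot>\<^bsub>N\<^esub> f x)\<rparr>"

definition hom_cocycles :: "('k, 'a) module \<Rightarrow> (nat \<Rightarrow> ('a, 'p) module) \<Rightarrow> (nat \<Rightarrow> 'p \<Rightarrow> 'p)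
    \<Rightarrow> ('a, 'c) module \<Rightarrow> nat \<Rightarrow> ('p \<Rightarrow> 'c) set"
  where "hom_cocycles A P d N n =
    {f \<in> lhom A (P n) N. \<forall>x\<in>carrier (P (Suc n)). f (d n x) = \<zero>\<^bsub>N\<^esub>}"

fun hom_coboundaries :: "('k, 'a) module \<Rightarrow> (nat \<Rightarrow> ('a, 'p) module) \<Rightarrow> (nat \<Rightarrow> 'p \<Rightarrow> 'p)
    \<Rightarrow> ('a, 'c) module \<Rightarrow> nat \<Rightarrow> ('p \<Rightarrow> 'c) set"
  where
    "hom_coboundaries A P d N 0 = {\<zero>\<^bsub>hom_module A (P 0) N\<^esub>}"
  | "hom_coboundaries A P d N (Suc n) =
       (\<lambda>g. \<lambda>x\<in>carrier (P (Suc n)). g (d n x)) ` lhom A (P n) N"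

definition hom_cohomology :: "('k, 'a) module \<Rightarrow> (nat \<Rightarrow> ('a, 'p) module)
    \<Rightarrow> (nat \<Rightarrow> 'p \<Rightarrow> 'p) \<Rightarrow> ('a, 'c) module \<Rightarrow> nat \<Rightarrow> ('k, ('p \<Rightarrow> 'c) set) module"
  where "hom_cohomology A P d N n =
    quot_module ((hom_module A (P n) N)\<lparr>carrier := hom_cocycles A P d N n\<rparr>)
      (hom_coboundaries A P d N n)"

text \<open>\<open>Ext\<^sup>n\<^sub>A(M, N)\<close> as a vector space over \<open>'k\<close>, computed from an arbitrarily chosen projective
  resolution of \<open>M\<close> on the type \<open>'p\<close>. Up to isomorphism the choice does not matter.\<close>

definition Ext :: "'p itself \<Rightarrow> ('k, 'a) module \<Rightarrow> ('a, 'm) module \<Rightarrow> ('a, 'c) module \<Rightarrow> nat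
    \<Rightarrow> ('k, ('p \<Rightarrow> 'c) set) module"
  where "Ext _ A M N n =
    (let (P, d, e) = (SOME (P :: nat \<Rightarrow> ('a, 'p) module, d, e). projective_resolution A M P d e)
     in hom_cohomology A P d N n)"


section \<open>The tensor algebra\<close>

text \<open>With the index set \<open>{1, \<dots>, q}\<close> rendered by a finite type \<open>'n\<close>, the words in the letters \<open>'n\<close>
  form a basis of \<open>T(E)\<close>. Lists form the free monoid (written additively, as
  \<^theory>\<open>HOL-Library.Poly_Mapping\<close> expects), and \<open>T(E)\<close> is its monoid algebra, the
  product being the tensor product.\<close>

instantiation list :: (type) monoid_add
begin
definition zero_list :: "'a list" where "zero_list = []"
definition plus_list :: "'a list \<Rightarrow> 'a list \<Rightarrow> 'a list" where "plus_list u v = u @ v"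
instance by standard (simp_all add: zero_list_def plus_list_def)
end

type_synonym ('k, 'n) tens = "'n list \<Rightarrow>\<^sub>0 'k"

definition tens_scale :: "'k::field \<Rightarrow> ('k, 'n) tens \<Rightarrow> ('k, 'n) tens"
  where "tens_scale c t = Poly_Mapping.single 0 c * t"

global_interpretation tens: vector_space "tens_scale :: 'k::field \<Rightarrow> ('k, 'n) tens \<Rightarrow> ('k, 'n) tens"
  defines tens_subspace = tens.subspace and tens_span = tens.span
  by standard (simp_all add: tens_scale_def algebra_simps single_add mult_single
      flip: mult.assoc)

definition tens_algebra :: "('k::field, ('k, 'n) tens) module"
  where "tens_algebra = \<lparr>carrier = UNIV, monoid.mult = (*), one = 1, ring.zero = 0, add = (+),
    smult = tens_scale\<rparr>"

definition gen :: "'n \<Rightarrow> ('k::field, 'n) tens"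
  where "gen l = Poly_Mapping.single [l] 1"

definition tens_power :: "nat \<Rightarrow> ('k::field, 'n) tens set"
  where "tens_power n = {t. \<forall>w\<in>Poly_Mapping.keys t. length w = n}"


section \<open>Quadratic algebras\<close>

definition relation_space :: "('k::field, 'n) tens set \<Rightarrow> bool"
  where "relation_space R \<longleftrightarrow> tens_subspace R \<and> R \<subseteq> tens_power 2"

text \<open>\<open>T(E)/(R)\<close>, as a \<open>'k\<close>-algebra whose elements are the cosets of \<open>(R)\<close>.\<close>

definition quad_algebra :: "('k::field, 'n) tens set \<Rightarrow> ('k, ('k, 'n) tens set) module"
  where "quad_algebra R = (let T = tens_algebra; I = Idl\<^bsub>T\<^esub> R in
    ring.extend (T Quot I)
      (module.fields (\<lambda>c Y. \<Union>x\<in>Y. I +>\<^bsub>T\<^esub> (c \<odot>\<^bsub>T\<^esub> x))))"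

definition homogeneous_part :: "('k::field, ('k, 'n) tens set) module \<Rightarrow> nat
    \<Rightarrow> ('k, 'n) tens set set"
  where "homogeneous_part A n = {a \<in> carrier A. \<exists>t\<in>tens_power n. t \<in> a}"

definition isomorphic_algebras :: "('k::field, ('k, 'n) tens set) module
    \<Rightarrow> ('k, ('k, 'n) tens set) module \<Rightarrow> bool"
  where "isomorphic_algebras A B \<longleftrightarrow> (\<exists>h \<in> ring_iso A B.
    (\<forall>c. \<forall>a\<in>carrier A. h (c \<odot>\<^bsub>A\<^esub> a) = c \<odot>\<^bsub>B\<^esub> h a) \<and>
    (\<forall>n. h ` homogeneous_part A n = homogeneous_part B n))"

text \<open>The projection of \<open>A\<close> onto its degree zero part \<open>'k\<close>, with kernel the sum of the \<open>A\<^sub>n\<close> for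
  \<open>n \<ge> 1\<close>: the constant coefficient, common to all tensors representing \<open>a\<close>.\<close>

definition augmentation :: "('k::field, 'n) tens set \<Rightarrow> 'k"
  where "augmentation a = (THE c. \<exists>t\<in>a. Poly_Mapping.lookup t [] = c)"

definition field_ring :: "'k::field ring"
  where "field_ring = \<lparr>carrier = UNIV, monoid.mult = (*), one = 1, ring.zero = 0, add = (+)\<rparr>"

definition trivial_module :: "(('k::field, 'n) tens set, 'k) module"
  where "trivial_module = \<lparr>carrier = UNIV, monoid.mult = (*), one = 1, ring.zero = 0, add = (+),
    smult = (\<lambda>a c. augmentation a * c)\<rparr>"

text \<open>Resolutions of the trivial module are taken on the type that carries the free \<open>A\<close>-modules
  with basis a set of words. This is large enough: \<open>A\<close> has countable dimension over \<open>'k\<close>, so a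
  submodule of a free module on countably many generators is itself generated by countably many
  elements, and there are countably infinitely many words.\<close>

type_synonym ('k, 'n) word_fun = "'n list \<Rightarrow> ('k, 'n) tens set"

definition global_dim :: "('k::field, ('k, 'n) tens set) module \<Rightarrow> enat"
  where "global_dim A = proj_dim TYPE(('k, 'n) word_fun) A trivial_module"

definition gorenstein :: "('k::field, ('k, 'n) tens set) module \<Rightarrow> bool"
  where "gorenstein A \<longleftrightarrow> (\<exists>D. global_dim A = enat D \<and>
    (let E = Ext TYPE(('k, 'n) word_fun) A trivial_module (regular_module A) in
      (\<forall>n. n \<noteq> D \<longrightarrow> carrier (E n) = {\<zero>\<^bsub>E n\<^esub>}) \<and>
      isomorphic_modules field_ring (E D) (regular_module field_ring)))"


section \<open>The Koszul complex\<close>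

definition koszul_space :: "('k::field, 'n) tens set \<Rightarrow> nat \<Rightarrow> ('k, 'n) tens set"
  where "koszul_space R n = (if n < 2 then tens_power n
    else \<Inter>(r, s) \<in> {(r, s). r + s = n - 2}.
      tens_span {u * v * w | u v w. u \<in> tens_power r \<and> v \<in> R \<and> w \<in> tens_power s})"

text \<open>\<open>A \<otimes> E\<^sup>\<otimes>\<^sup>n\<close> is the free \<open>A\<close>-module on the words of length \<open>n\<close>. Tensoring over a field being
  exact, \<open>A \<otimes> K\<^sub>n\<close> is the submodule additively generated by the \<open>a \<otimes> k\<close>, where
  \<open>a \<otimes> k\<close> has the value \<open>k\<^sub>w a\<close> at the word \<open>w\<close>.\<close>

definition koszul_module :: "('k::field, 'n) tens set \<Rightarrow> nat
    \<Rightarrow> (('k, 'n) tens set, ('k, 'n) word_fun) module"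
  where "koszul_module R n =
    (let A = quad_algebra R; F = free_module A {w :: 'n list. length w = n} in
      F\<lparr>carrier := generate (add_monoid F)
        {\<lambda>w. Poly_Mapping.lookup k w \<odot>\<^bsub>A\<^esub> a | a k. a \<in> carrier A \<and> k \<in> koszul_space R n}\<rparr>)"

text \<open>The map \<open>a \<otimes> v\<^sub>1 \<otimes> \<dots> \<otimes> v\<^sub>n \<mapsto> a v\<^sub>1 \<otimes> v\<^sub>2 \<otimes> \<dots> \<otimes> v\<^sub>n\<close> in coordinates.\<close>

definition koszul_diff :: "('k::field, 'n::finite) tens set
    \<Rightarrow> ('k, 'n) word_fun \<Rightarrow> ('k, 'n) word_fun"
  where "koszul_diff R f = (let T = tens_algebra; A = quad_algebra R in
    (\<lambda>w. \<Oplus>\<^bsub>A\<^esub>l\<in>UNIV. (f (l # w) \<otimes>\<^bsub>A\<^esub> (Idl\<^bsub>T\<^esub> R +>\<^bsub>T\<^esub> gen l))))"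

text \<open>Acyclicity in all degrees \<open>n \<ge> 1\<close>.\<close>

definition koszul :: "('k::field, 'n::finite) tens set \<Rightarrow> bool"
  where "koszul R \<longleftrightarrow> (\<forall>n\<ge>1.
    {f \<in> carrier (koszul_module R n). koszul_diff R f = \<zero>\<^bsub>koszul_module R (n - 1)\<^esub>} =
    koszul_diff R ` carrier (koszul_module R (Suc n)))"


section \<open>Bilinear forms\<close>

definition bilinear_form :: "('k::field ^ 'n \<Rightarrow> 'k ^ 'n \<Rightarrow> 'k) \<Rightarrow> bool"
  where "bilinear_form B \<longleftrightarrow>
    (\<forall>x. Vector_Spaces.linear (*s) (*) (\<lambda>y. B x y)) \<and>
    (\<forall>y. Vector_Spaces.linear (*s) (*) (\<lambda>x. B x y))"

definition nondegenerate :: "('k::field ^ 'n \<Rightarrow> 'k ^ 'n \<Rightarrow> 'k) \<Rightarrow> bool"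
  where "nondegenerate B \<longleftrightarrow>
    (\<forall>x. (\<forall>y. B x y = 0) \<longrightarrow> x = 0) \<and> (\<forall>y. (\<forall>x. B x y = 0) \<longrightarrow> y = 0)"

definition form_action :: "'k::field ^ 'n ^ 'n \<Rightarrow> ('k ^ 'n \<Rightarrow> 'k ^ 'n \<Rightarrow> 'k)
    \<Rightarrow> ('k ^ 'n \<Rightarrow> 'k ^ 'n \<Rightarrow> 'k)"
  where "form_action L B = (\<lambda>x y. B (matrix_inv L *v x) (matrix_inv L *v y))"

definition same_GL_orbit :: "('k::field ^ 'n \<Rightarrow> 'k ^ 'n \<Rightarrow> 'k)
    \<Rightarrow> ('k ^ 'n \<Rightarrow> 'k ^ 'n \<Rightarrow> 'k) \<Rightarrow> bool"
  where "same_GL_orbit B C \<longleftrightarrow> (\<exists>L :: 'k ^ 'n ^ 'n. invertible L \<and> C = form_action L B)"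

text \<open>The space of relations spanned by \<open>\<Sum> B\<^sub>\<mu>\<^sub>\<nu> x\<^sup>\<mu> x\<^sup>\<nu>\<close>.\<close>

definition form_relations :: "('k::field ^ 'n \<Rightarrow> 'k ^ 'n \<Rightarrow> 'k) \<Rightarrow> ('k, 'n::finite) tens set"
  where "form_relations B = tens_span
    {\<Sum>m\<in>UNIV. \<Sum>n\<in>UNIV. tens_scale (B (axis m 1) (axis n 1)) (gen m * gen n)}"

end

theory Submission
  imports Defs
begin

text \<open>Let \<open>b\<close> be the single relation of a nondegenerate form, \<open>b = \<Sum> y\<^sub>m x\<^sup>m\<close> with a basis \<open>y\<^sub>m\<close> of
  \<open>E\<close>. Every element of the ideal \<open>(b)\<close> is of the form \<open>u b + \<Sum> j\<^sub>m x\<^sup>m\<close> with \<open>j\<^sub>m\<close> in \<open>(b)\<close>, so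
  comparing last letters lowers degrees; for \<open>q \<ge> 2\<close> this shows by induction that nonzero vectors of
  \<open>E\<close> are regular in the quotient \<open>A\<close>. Hence \<open>0 \<rightarrow> A \<rightarrow> A\<^sup>q \<rightarrow> A\<close> is exact, and comparing first letters
  (that is, reversing all words) shows that the dual complex has cohomology only in degree two, where
  it is \<open>A\<close> modulo its augmentation ideal.

  Conversely, the differentials of the Koszul resolution have coefficients in the augmentation ideal.
  Therefore a resolution of length two forces \<open>K\<^sub>3 = 0\<close>, and \<open>Ext\<^sup>2\<close> is the cokernel of a map into
  cochains on \<open>R\<close> whose image consists of cochains with values in the augmentation ideal. That this
  cokernel is one-dimensional forces \<open>R\<close> to be spanned by one element, and all generators \<open>x\<^sup>l\<close> to lie
  in the right ideal generated by the \<open>y\<^sub>m\<close>, which is nondegeneracy.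

  Since \<open>Ext\<close> is computed from an arbitrary resolution and the global dimension is an infimum over
  all of them, both directions rest on the comparison theorem for projective resolutions.\<close>

section \<open>Calculus in the tensor algebra\<close>

text \<open>The quotient algebra is never given a basis. Questions about classes become questions
  about membership in the ideal, and these are decided one letter at a time: the tensors without
  constant term are free on the generators, both as a left and as a right module over T(E), and
  \<open>rdiv\<close> and \<open>ldiv\<close> are the coordinates. The bound q >= 2 enters as the
  existence of a nonzero vector orthogonal to a given one; for q = 1 the algebra would be
  K[x]/(x^2), of infinite global dimension. A second obstacle is that A \<otimes> K_n is only given
  by a spanning set. A linear projection of T(E) onto K_n exhibits it as a direct summand of the
  free module on the words, so it is projective without a choice of basis. That the dimension is not
  below two is read off from a nonzero class in Ext^2(K, A), not from minimality of a resolution. In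
  the converse, the vanishing in degree three is used with coefficients in the trivial module, about
  which the Gorenstein condition says nothing; it has to come from the global dimension.\<close>

abbreviation coef :: "('k::field, 'n) tens \<Rightarrow> 'n list \<Rightarrow> 'k"
  where "coef \<equiv> Poly_Mapping.lookup"

abbreviation mon :: "'n list \<Rightarrow> 'k \<Rightarrow> ('k::field, 'n) tens"
  where "mon \<equiv> Poly_Mapping.single"

lemma coef_mon: "coef (mon u c) w = (if u = w then c else 0)"
  by (simp add: lookup_single when_def)

lemma mon_mult: "mon u c * mon v d = mon (u @ v) (c * d)"
  by (simp add: mult_single plus_list_def)

lemma mon_Nil_1 [simp]: "mon [] 1 = 1"
  by (metis single_one zero_list_def)

lemma coef_one_Nil [simp]: "coef 1 [] = 1"
  by (simp add: coef_mon flip: mon_Nil_1)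

lemma tens_scale_mon [simp]: "tens_scale c (mon w d) = mon w (c * d)"
  by (simp add: tens_scale_def zero_list_def mon_mult)

lemma tens_expand: "t = (\<Sum>w\<in>Poly_Mapping.keys t. mon w (coef t w))"
  by (rule poly_mapping_eqI)
    (auto simp: lookup_sum coef_mon in_keys_iff sum.delta)

text \<open>Both sides of the product formulas below are additive in each tensor, so this induction
  leaves only the case of words.\<close>

lemma tens_induct [case_names mon add]:
  assumes "\<And>w c. P (mon w c)" and "\<And>s t. P s \<Longrightarrow> P t \<Longrightarrow> P (s + t)"
  shows "P t"
proof -
  have "P 0" using assms(1)[of "[]" 0] by simp
  have "finite S \<Longrightarrow> P (\<Sum>w\<in>S. mon w (coef t w))" for S
    by (induction S rule: finite_induct) (auto simp: assms \<open>P 0\<close>)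
  then show ?thesis using tens_expand[of t] by (metis finite_keys)
qed

lemma coef_scale [simp]: "coef (tens_scale c t) w = c * coef t w"
  by (induction t rule: tens_induct)
    (auto simp: tens.scale_right_distrib lookup_add distrib_left coef_mon)

lemma tens_scale_mult_left: "tens_scale c (s * t) = tens_scale c s * t"
  by (simp add: tens_scale_def mult.assoc)

text \<open>\<open>tens_scale\<close> is left multiplication by a constant; moving the scalar past
  \<open>s\<close> uses that constants are central, which has to be checked on words.\<close>

lemma tens_scale_mult_right: "tens_scale c (s * t) = s * tens_scale c t"
proof (induction s rule: tens_induct)
  case (mon w d)
  show ?case by (induction t rule: tens_induct)
      (auto simp: mon_mult distrib_left tens.scale_right_distrib mult_ac)
qed (auto simp: distrib_right tens.scale_right_distrib)

lemma coef_gen: "coef (gen l) w = (if w = [l] then 1 else 0)"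
  by (auto simp: gen_def coef_mon)

text \<open>Right and left division by a generator, dropping the words that are not divisible.\<close>

definition rdiv :: "'n \<Rightarrow> ('k::field, 'n) tens \<Rightarrow> ('k, 'n) tens"
  where "rdiv l = Poly_Mapping.map_key (\<lambda>w. w @ [l])"

definition ldiv :: "'n \<Rightarrow> ('k::field, 'n) tens \<Rightarrow> ('k, 'n) tens"
  where "ldiv l = Poly_Mapping.map_key (\<lambda>w. l # w)"

definition reversal :: "('k::field, 'n) tens \<Rightarrow> ('k, 'n) tens"
  where "reversal = Poly_Mapping.map_key rev"

lemma coef_rdiv [simp]: "coef (rdiv l t) w = coef t (w @ [l])"
  by (simp add: rdiv_def map_key.rep_eq inj_def)

lemma coef_ldiv [simp]: "coef (ldiv l t) w = coef t (l # w)"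
  by (simp add: ldiv_def map_key.rep_eq inj_def)

lemma coef_reversal [simp]: "coef (reversal t) w = coef t (rev w)"
  by (simp add: reversal_def map_key.rep_eq inj_def)

lemma rdiv_add [simp]: "rdiv l (s + t) = rdiv l s + rdiv l t"
  by (rule poly_mapping_eqI) (simp add: lookup_add)

lemma ldiv_add [simp]: "ldiv l (s + t) = ldiv l s + ldiv l t"
  by (rule poly_mapping_eqI) (simp add: lookup_add)

lemma reversal_add [simp]: "reversal (s + t) = reversal s + reversal t"
  by (rule poly_mapping_eqI) (simp add: lookup_add)

lemma rdiv_zero [simp]: "rdiv l 0 = 0"
  by (rule poly_mapping_eqI) simp

lemma ldiv_zero [simp]: "ldiv l 0 = 0"
  by (rule poly_mapping_eqI) simp

lemma reversal_zero [simp]: "reversal 0 = 0"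
  by (rule poly_mapping_eqI) simp

lemma rdiv_scale [simp]: "rdiv l (tens_scale c t) = tens_scale c (rdiv l t)"
  by (rule poly_mapping_eqI) simp

lemma ldiv_scale [simp]: "ldiv l (tens_scale c t) = tens_scale c (ldiv l t)"
  by (rule poly_mapping_eqI) simp

lemma reversal_scale [simp]: "reversal (tens_scale c t) = tens_scale c (reversal t)"
  by (rule poly_mapping_eqI) simp

lemma rdiv_sum: "rdiv l (sum f S) = (\<Sum>i\<in>S. rdiv l (f i))"
  by (rule poly_mapping_eqI) (simp add: lookup_sum)

lemma ldiv_sum: "ldiv l (sum f S) = (\<Sum>i\<in>S. ldiv l (f i))"
  by (rule poly_mapping_eqI) (simp add: lookup_sum)

lemma reversal_sum: "reversal (sum f S) = (\<Sum>i\<in>S. reversal (f i))"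
  by (rule poly_mapping_eqI) (simp add: lookup_sum)

lemma reversal_reversal [simp]: "reversal (reversal t) = t"
  by (rule poly_mapping_eqI) simp

lemma reversal_mon [simp]: "reversal (mon w c) = mon (rev w) c"
  by (rule poly_mapping_eqI) (auto simp: coef_mon)

lemma reversal_gen [simp]: "reversal (gen l) = gen l"
  by (simp add: gen_def)

lemma reversal_mult: "reversal (s * t) = reversal t * reversal s"
proof (induction s rule: tens_induct)
  case (mon w d)
  show ?case by (induction t rule: tens_induct)
      (auto simp: mon_mult distrib_left distrib_right mult_ac)
qed (auto simp: distrib_left distrib_right)

lemma rdiv_mult_gen: "rdiv l (t * gen m) = (if l = m then t else 0)"
proof (induction t rule: tens_induct)
  case (mon w d)
  then show ?case
    by (auto simp: gen_def mon_mult coef_mon intro!: poly_mapping_eqI)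
qed (auto simp: distrib_right)

lemma ldiv_gen_mult: "ldiv l (gen m * t) = (if l = m then t else 0)"
proof (induction t rule: tens_induct)
  case (mon w d)
  then show ?case
    by (auto simp: gen_def mon_mult coef_mon intro!: poly_mapping_eqI)
qed (auto simp: distrib_left)

text \<open>T(E) is the direct sum of K and T(E)E, because a nonempty word has exactly one last
  letter. The summands \<open>rdiv l t\<close> are the coordinates of the second part.\<close>

lemma right_expand:
  fixes t :: "('k::field, 'n::finite) tens"
  shows "t = mon [] (coef t []) + (\<Sum>l\<in>UNIV. rdiv l t * gen l)"
proof (rule poly_mapping_eqI)
  fix w :: "'n list"
  have *: "coef (s * gen l) (v @ [m]) = (if m = l then coef s v else 0)"
    for s :: "('k, 'n) tens" and l m v
    using arg_cong[OF rdiv_mult_gen[of m s l], of "\<lambda>t. coef t v"] by (simp split: if_splits)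
  have **: "coef (s * gen l) [] = 0" for s :: "('k, 'n) tens" and l
    by (induction s rule: tens_induct) (auto simp: gen_def mon_mult coef_mon distrib_right lookup_add)
  show "coef t w = coef (mon [] (coef t []) + (\<Sum>l\<in>UNIV. rdiv l t * gen l)) w"
    by (cases w rule: rev_cases) (auto simp: lookup_add lookup_sum coef_mon * **)
qed

lemma left_expand:
  fixes t :: "('k::field, 'n::finite) tens"
  shows "t = mon [] (coef t []) + (\<Sum>l\<in>UNIV. gen l * ldiv l t)"
proof -
  \<comment> \<open>Reversal exchanges last and first letters, so the left-hand expansion is the
    mirror image of \<open>right_expand\<close>.\<close>
  have "rdiv l (reversal t) = reversal (ldiv l t)" for l
    by (rule poly_mapping_eqI) simp
  with arg_cong[OF right_expand[of "reversal t"], of reversal] show ?thesis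
    by (simp add: reversal_sum reversal_mult)
qed

lemma coef_mult_Nil: "coef (s * t) [] = coef s [] * coef t []"
proof (induction s rule: tens_induct)
  case (mon w d)
  show ?case by (induction t rule: tens_induct)
      (auto simp: mon_mult coef_mon distrib_left lookup_add)
qed (auto simp: distrib_right lookup_add)

text \<open>A word of one letter factors only with an empty factor on one side, so linear parts obey
  a Leibniz rule.\<close>

lemma coef_mult_single: "coef (s * t) [l] = coef s [] * coef t [l] + coef s [l] * coef t []"
proof (induction s rule: tens_induct)
  case (mon w d)
  show ?case by (induction t rule: tens_induct)
      (auto simp: mon_mult coef_mon append_eq_Cons_conv distrib_left lookup_add)
qed (auto simp: distrib_right lookup_add)

text \<open>A constant term in \<open>t\<close> would let the last letter of the product come from
  \<open>s\<close>; without it, the last letter always belongs to \<open>t\<close>.\<close>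

lemma rdiv_mult:
  fixes t :: "('k::field, 'n::finite) tens"
  assumes "coef t [] = 0"
  shows "rdiv l (s * t) = s * rdiv l t"
proof -
  have "s * t = (\<Sum>m\<in>UNIV. (s * rdiv m t) * gen m)"
    by (subst right_expand[of t]) (simp add: assms sum_distrib_left mult.assoc)
  then show ?thesis by (simp add: rdiv_sum rdiv_mult_gen)
qed

lemma ldiv_mult:
  fixes t :: "('k::field, 'n::finite) tens"
  assumes "coef t [] = 0"
  shows "ldiv l (t * s) = ldiv l t * s"
proof -
  have "t * s = (\<Sum>m\<in>UNIV. gen m * (ldiv m t * s))"
    by (subst left_expand[of t]) (simp add: assms sum_distrib_right mult.assoc)
  then show ?thesis by (simp add: ldiv_sum ldiv_gen_mult)
qed

lemma tens_power_iff: "t \<in> tens_power n \<longleftrightarrow> (\<forall>w. length w \<noteq> n \<longrightarrow> coef t w = 0)"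
  by (auto simp: tens_power_def in_keys_iff)

lemma mon_in_tens_power: "length w = n \<Longrightarrow> mon w c \<in> tens_power n"
  by (auto simp: tens_power_iff coef_mon)

lemma gen_in_tens_power: "gen l \<in> tens_power 1"
  by (simp add: gen_def mon_in_tens_power)

lemma subspace_tens_power: "tens_subspace (tens_power n)"
  by (auto simp: tens.subspace_def tens_power_iff lookup_add)

lemma tens_power_mult:
  assumes "s \<in> tens_power m" "t \<in> tens_power n"
  shows "s * t \<in> tens_power (m + n)"
proof -
  have "w \<in> Poly_Mapping.keys (s * t) \<Longrightarrow> length w = m + n" for w
    using keys_mult[of s t] assms by (fastforce simp: tens_power_def plus_list_def)
  then show ?thesis by (simp add: tens_power_def)
qed

lemma tens_power_0: "t \<in> tens_power 0 \<Longrightarrow> t = mon [] (coef t [])"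
  by (rule poly_mapping_eqI) (auto simp: coef_mon tens_power_iff)

lemma tens_power_1:
  fixes t :: "('k::field, 'n::finite) tens"
  assumes "t \<in> tens_power 1"
  shows "t = (\<Sum>l\<in>UNIV. tens_scale (coef t [l]) (gen l))"
proof (rule poly_mapping_eqI)
  fix w :: "'n list"
  show "coef t w = coef (\<Sum>l\<in>UNIV. tens_scale (coef t [l]) (gen l)) w"
  proof (cases "\<exists>l. w = [l]")
    case True
    then show ?thesis by (auto simp: lookup_sum coef_gen sum.delta' if_distrib[of "\<lambda>x. _ * x"] cong: if_cong)
  next
    case False
    then have "length w \<noteq> 1" by (auto simp: length_Suc_conv)
    then show ?thesis using False assms by (auto simp: lookup_sum coef_gen tens_power_iff)
  qed
qed

section \<open>The grading by word length\<close>

definition hom_part :: "nat \<Rightarrow> ('k::field, 'n) tens \<Rightarrow> ('k, 'n) tens"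
  where "hom_part n t = (\<Sum>w \<in> Poly_Mapping.keys t. if length w = n then mon w (coef t w) else 0)"

lemma coef_hom_part [simp]: "coef (hom_part n t) w = (if length w = n then coef t w else 0)"
proof -
  have "coef (hom_part n t) w =
      (\<Sum>v\<in>Poly_Mapping.keys t. if v = w then (if length w = n then coef t w else 0) else 0)"
    unfolding hom_part_def lookup_sum by (intro sum.cong) (auto simp: coef_mon)
  then show ?thesis by (auto simp: in_keys_iff)
qed

lemma hom_part_add [simp]: "hom_part n (s + t) = hom_part n s + hom_part n t"
  by (rule poly_mapping_eqI) (simp add: lookup_add)

lemma hom_part_mon [simp]: "hom_part n (mon w c) = (if length w = n then mon w c else 0)"
  by (rule poly_mapping_eqI) (auto simp: coef_mon)

lemma hom_part_in: "hom_part n t \<in> tens_power n"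
  by (simp add: tens_power_iff)

lemma hom_part_id: "t \<in> tens_power n \<Longrightarrow> hom_part m t = (if m = n then t else 0)"
  by (rule poly_mapping_eqI) (auto simp: tens_power_iff)

lemma hom_part_scale [simp]: "hom_part n (tens_scale c t) = tens_scale c (hom_part n t)"
  by (rule poly_mapping_eqI) simp

text \<open>A homogeneous right factor merely shifts degrees, so components can be taken in the left
  factor.\<close>

lemma hom_part_mult:
  assumes "t \<in> tens_power k"
  shows "hom_part (n + k) (s * t) = hom_part n s * t"
proof (induction s rule: tens_induct)
  case (mon w c)
  have "mon w c * t \<in> tens_power (length w + k)"
    by (simp add: tens_power_mult mon_in_tens_power assms)
  then show ?case by (auto simp: hom_part_id)
qed (simp add: distrib_right)

lemma hom_part_expand: "\<exists>N. t = (\<Sum>n<N. hom_part n t)"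
proof -
  obtain N where N: "\<And>w. w \<in> Poly_Mapping.keys t \<Longrightarrow> length w < N"
    using finite_nat_set_iff_bounded[of "length ` Poly_Mapping.keys t"] by auto
  have "t = (\<Sum>n<N. hom_part n t)"
    using N by (intro poly_mapping_eqI) (auto simp: lookup_sum in_keys_iff)
  then show ?thesis ..
qed

section \<open>The ideal of relations and the quotient\<close>

lemma tens_algebra_simps [simp]:
  "carrier tens_algebra = UNIV" "monoid.mult tens_algebra = (*)" "one tens_algebra = 1"
  "ring.zero tens_algebra = 0" "add tens_algebra = (+)" "module.smult tens_algebra = tens_scale"
  by (simp_all add: tens_algebra_def)

lemma ring_tens_algebra: "ring (tens_algebra :: ('k::field, ('k, 'n) tens) module)"
proof (rule ringI)
  show "abelian_group (tens_algebra :: ('k, ('k, 'n) tens) module)"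
    by (rule abelian_groupI) (auto simp: add.assoc add.commute intro: exI[of _ "- _"] left_minus)
  show "monoid (tens_algebra :: ('k, ('k, 'n) tens) module)"
    by (rule monoidI) (auto simp: mult.assoc)
qed (auto simp: distrib_left distrib_right)

lemma a_inv_tens_algebra [simp]: "\<ominus>\<^bsub>tens_algebra\<^esub> t = - t"
  by (rule abelian_group.minus_equality[OF ring.is_abelian_group[OF ring_tens_algebra]]) auto

definition rel_ideal :: "('k::field, 'n) tens set \<Rightarrow> ('k, 'n) tens set"
  where "rel_ideal R = Idl\<^bsub>tens_algebra\<^esub> R"

text \<open>The induction principle for spans used throughout. Linearity of \<open>f\<close> is a
  pair of hypotheses, so no linear-map locale has to be set up; with \<open>f\<close> the identity
  it shows that a span lies in a subspace given by a property.\<close>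

lemma tens_span_linear_image:
  assumes "t \<in> tens_span S"
    and "\<And>s t. f (s + t) = f s + f t" and "\<And>c t. f (tens_scale c t) = tens_scale c (f t)"
    and "\<And>s. s \<in> S \<Longrightarrow> f s \<in> V" and "tens_subspace V"
  shows "f t \<in> V"
proof -
  have "f 0 = 0" using assms(3)[of 0 0] by simp
  then have "tens_subspace {t. f t \<in> V}"
    using assms(2,3,5) by (auto simp: tens.subspace_def)
  with assms(1,4) show ?thesis using tens.span_induct[of t S "\<lambda>t. f t \<in> V"] by auto
qed

lemma tens_subspace_memI:
  assumes "tens_subspace V" shows "0 \<in> V" "s \<in> V \<Longrightarrow> t \<in> V \<Longrightarrow> s + t \<in> V"
    "s \<in> V \<Longrightarrow> t \<in> V \<Longrightarrow> s - t \<in> V" "s \<in> V \<Longrightarrow> - s \<in> V" "s \<in> V \<Longrightarrow> tens_scale c s \<in> V"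
  by (fact tens.subspace_0[OF assms] tens.subspace_add[OF assms] tens.subspace_diff[OF assms]
      tens.subspace_neg[OF assms] tens.subspace_scale[OF assms])+

lemma tens_subspace_sum: "tens_subspace V \<Longrightarrow> (\<And>i. i \<in> S \<Longrightarrow> f i \<in> V) \<Longrightarrow> sum f S \<in> V"
  by (rule tens.subspace_sum)

text \<open>Words suffice as multipliers on both sides, since they span T(E) and only the linear
  span of this set is used.\<close>

definition rel_gens :: "('k::field, 'n) tens set \<Rightarrow> ('k, 'n) tens set"
  where "rel_gens R = {mon u 1 * r * mon v 1 | u r v. r \<in> R}"

lemma rel_gensI: "r \<in> R \<Longrightarrow> mon u 1 * r * mon v 1 \<in> rel_gens R"
  by (auto simp: rel_gens_def)

lemma rel_gensE:
  assumes "s \<in> rel_gens R" obtains u r v where "s = mon u 1 * r * mon v 1" "r \<in> R"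
  using assms by (auto simp: rel_gens_def)

lemma span_rel_gens_mult:
  assumes "t \<in> tens_span (rel_gens R)"
  shows "s * t \<in> tens_span (rel_gens R)" "t * s \<in> tens_span (rel_gens R)"
proof -
  let ?I = "tens_span (rel_gens R)"
  have sub: "tens_subspace ?I" by (rule tens.subspace_span)
  have gens: "mon u 1 * r * mon v 1 \<in> ?I" if "r \<in> R" for u r v
    using that by (intro tens.span_base rel_gensI)
  show "s * t \<in> ?I"
  proof (induction s rule: tens_induct)
    case (mon w c)
    have "tens_scale c (mon w 1 * t) \<in> ?I"
    proof (rule tens_span_linear_image[OF assms, where f = "\<lambda>t. tens_scale c (mon w 1 * t)"])
      fix s assume "s \<in> rel_gens R"
      then obtain u r v where "s = mon u 1 * r * mon v 1" "r \<in> R" by (rule rel_gensE)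
      then have "mon w 1 * s = mon (w @ u) 1 * r * mon v 1"
        by (simp add: mon_mult flip: mult.assoc)
      then show "tens_scale c (mon w 1 * s) \<in> ?I"
        using gens[OF \<open>r \<in> R\<close>] by (simp add: tens.span_scale)
    qed (simp_all add: sub distrib_left tens.scale_right_distrib tens.scale_left_commute
          flip: tens_scale_mult_right)
    then show ?case by (simp add: tens_scale_mult_left)
  qed (simp add: distrib_right tens.span_add)
  show "t * s \<in> ?I"
  proof (induction s rule: tens_induct)
    case (mon w c)
    have "tens_scale c (t * mon w 1) \<in> ?I"
    proof (rule tens_span_linear_image[OF assms, where f = "\<lambda>t. tens_scale c (t * mon w 1)"])
      fix s assume "s \<in> rel_gens R"
      then obtain u r v where "s = mon u 1 * r * mon v 1" "r \<in> R" by (rule rel_gensE)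
      then have "s * mon w 1 = mon u 1 * r * mon (v @ w) 1"
        by (simp add: mon_mult mult.assoc)
      then show "tens_scale c (s * mon w 1) \<in> ?I"
        using gens[OF \<open>r \<in> R\<close>] by (simp add: tens.span_scale)
    qed (simp_all add: sub distrib_right tens.scale_right_distrib tens.scale_left_commute
          flip: tens_scale_mult_left)
    then show ?case by (simp add: tens_scale_mult_right)
  qed (simp add: distrib_left tens.span_add)
qed

text \<open>The ideal is an intersection by definition. As a linear span it becomes accessible to
  \<open>tens_span_linear_image\<close>, which drives the facts below on coefficients, degrees and
  last letters.\<close>

lemma rel_ideal_eq: "rel_ideal R = tens_span (rel_gens R)"
proof
  have sub: "tens_subspace (tens_span (rel_gens R))" by (rule tens.subspace_span)
  have "ideal (tens_span (rel_gens R)) tens_algebra"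
  proof (rule idealI[OF ring_tens_algebra])
    show "subgroup (tens_span (rel_gens R)) (add_monoid tens_algebra)"
    proof (rule group.subgroupI)
      show "Group.group (add_monoid (tens_algebra :: ('k::field, ('k, 'n) tens) module))"
        by (rule abelian_group.a_group[OF ring.is_abelian_group[OF ring_tens_algebra]])
      show "inv\<^bsub>add_monoid tens_algebra\<^esub> t \<in> tens_span (rel_gens R)"
        if "t \<in> tens_span (rel_gens R)" for t
        using tens_subspace_memI(4)[OF sub that] a_inv_tens_algebra[of t] by (simp add: a_inv_def)
    qed (use tens_subspace_memI(1,2)[OF sub] in auto)
  qed (auto simp: span_rel_gens_mult)
  moreover have "R \<subseteq> tens_span (rel_gens R)"
  proof
    fix r assume "r \<in> R"
    then have "mon [] 1 * r * mon [] 1 \<in> tens_span (rel_gens R)"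
      by (intro tens.span_base rel_gensI)
    then show "r \<in> tens_span (rel_gens R)" by simp
  qed
  ultimately show "rel_ideal R \<subseteq> tens_span (rel_gens R)"
    unfolding rel_ideal_def by (rule ring.genideal_minimal[OF ring_tens_algebra])
next
  have id: "ideal (rel_ideal R) tens_algebra"
    unfolding rel_ideal_def by (rule ring.genideal_ideal[OF ring_tens_algebra]) simp
  have RI: "R \<subseteq> rel_ideal R"
    unfolding rel_ideal_def by (rule ring.genideal_self[OF ring_tens_algebra]) simp
  note add = additive_subgroup.a_closed[OF ideal.axioms(1)[OF id]]
    and zero = additive_subgroup.zero_closed[OF ideal.axioms(1)[OF id]]
  have "tens_subspace (rel_ideal R)"
    unfolding tens.subspace_def
  proof (intro conjI ballI allI)
    show "0 \<in> rel_ideal R" using zero by simp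
    show "s + t \<in> rel_ideal R" if "s \<in> rel_ideal R" "t \<in> rel_ideal R" for s t
      using add[OF that] by simp
    show "tens_scale c t \<in> rel_ideal R" if "t \<in> rel_ideal R" for c t
      using ideal.I_l_closed[OF id that, of "Poly_Mapping.single 0 c"] by (simp add: tens_scale_def)
  qed
  moreover have "rel_gens R \<subseteq> rel_ideal R"
  proof
    fix s assume "s \<in> rel_gens R"
    then obtain u r v where s: "s = mon u 1 * r * mon v 1" "r \<in> R" by (rule rel_gensE)
    then have "mon u 1 * r \<in> rel_ideal R"
      using ideal.I_l_closed[OF id, of r "mon u 1"] RI by auto
    then show "s \<in> rel_ideal R"
      using ideal.I_r_closed[OF id, of "mon u 1 * r" "mon v 1"] s by simp
  qed
  ultimately show "tens_span (rel_gens R) \<subseteq> rel_ideal R"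
    by (intro tens.span_minimal)
qed

lemma subspace_rel_ideal: "tens_subspace (rel_ideal R)"
  unfolding rel_ideal_eq by (rule tens.subspace_span)

lemmas rel_ideal_memI = tens_subspace_memI[OF subspace_rel_ideal]

lemma rel_ideal_mult:
  assumes "t \<in> rel_ideal R" shows "s * t \<in> rel_ideal R" "t * s \<in> rel_ideal R"
  using assms unfolding rel_ideal_eq by (rule span_rel_gens_mult)+

lemma rel_ideal_base: "r \<in> R \<Longrightarrow> r \<in> rel_ideal R"
  unfolding rel_ideal_def
  using ring.genideal_self[OF ring_tens_algebra, of R] by auto

text \<open>A homomorphism of tensor algebras that sends relations into an ideal sends all multiples
  u r v there as well; this is how maps between quotients become well defined.\<close>

lemma rel_ideal_minimal:
  assumes "\<And>r. r \<in> R \<Longrightarrow> f r \<in> rel_ideal S"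
    and "\<And>s t. f (s + t) = f s + f t" and "\<And>c t. f (tens_scale c t) = tens_scale c (f t)"
    and "\<And>s t. f (s * t) = f s * f t" and "t \<in> rel_ideal R"
  shows "f t \<in> rel_ideal S"
  using assms(5) unfolding rel_ideal_eq[of R]
proof (rule tens_span_linear_image)
  fix s assume "s \<in> rel_gens R"
  then obtain u r v where "s = mon u 1 * r * mon v 1" "r \<in> R" by (rule rel_gensE)
  then show "f s \<in> rel_ideal S"
    using rel_ideal_mult(2)[OF rel_ideal_mult(1)[OF assms(1)]] by (simp only: assms(4))
qed (simp_all add: assms(2,3) subspace_rel_ideal)

text \<open>Multiples of quadratic relations start in degree two. Hence constant and linear parts of
  a tensor can be read off from its class.\<close>

lemma rel_ideal_low_coef:
  assumes "R \<subseteq> tens_power 2" "t \<in> rel_ideal R"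
  shows "coef t [] = 0" "coef t [l] = 0"
proof -
  have "t \<in> {t. coef t [] = 0 \<and> (\<forall>l. coef t [l] = 0)}"
    using assms(2) unfolding rel_ideal_eq
  proof (rule tens_span_linear_image[where f = "\<lambda>t. t"])
    fix s assume "s \<in> rel_gens R"
    then obtain u r v where "s = mon u 1 * r * mon v 1" "r \<in> R" by (rule rel_gensE)
    then show "s \<in> {t. coef t [] = 0 \<and> (\<forall>l. coef t [l] = 0)}"
      using assms(1) by (auto simp: coef_mult_Nil coef_mult_single tens_power_iff)
  next
    show "tens_subspace {t. coef t [] = 0 \<and> (\<forall>l. coef t [l] = 0)}"
      unfolding tens.subspace_def by (simp add: lookup_add)
  qed simp_all
  then show "coef t [] = 0" "coef t [l] = 0" by simp_all
qed

text \<open>The spanning elements u r v are homogeneous, so the ideal contains the components of its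
  elements.\<close>

lemma rel_ideal_hom_part:
  assumes "R \<subseteq> tens_power 2" "t \<in> rel_ideal R"
  shows "hom_part n t \<in> rel_ideal R"
  using assms(2) unfolding rel_ideal_eq[of R]
proof (rule tens_span_linear_image)
  fix s assume s: "s \<in> rel_gens R"
  then obtain u r v where "s = mon u 1 * r * mon v 1" "r \<in> R" by (rule rel_gensE)
  then have "s \<in> tens_power (length u + 2 + length v)"
    by (auto intro!: tens_power_mult mon_in_tens_power refl subsetD[OF assms(1)] simp del: add_2_eq_Suc')
  then show "hom_part n s \<in> tens_span (rel_gens R)"
    using tens.span_base[OF s] by (simp add: hom_part_id tens.span_zero)
qed (simp_all add: tens.subspace_span)

section \<open>Cosets of the ideal and arithmetic in the quotient\<close>

definition cls :: "('k::field, 'n) tens set \<Rightarrow> ('k, 'n) tens \<Rightarrow> ('k, 'n) tens set"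
  where "cls R t = rel_ideal R +>\<^bsub>tens_algebra\<^esub> t"

lemma cls_eq_image: "cls R t = (\<lambda>h. h + t) ` rel_ideal R"
  by (auto simp: cls_def a_r_coset_def r_coset_def)

lemma mem_cls_iff: "s \<in> cls R t \<longleftrightarrow> s - t \<in> rel_ideal R"
  unfolding cls_eq_image using image_iff by fastforce

lemma cls_self: "t \<in> cls R t"
  by (simp add: mem_cls_iff rel_ideal_memI)

lemma cls_eq_iff: "cls R s = cls R t \<longleftrightarrow> s - t \<in> rel_ideal R"
proof
  assume "cls R s = cls R t"
  then show "s - t \<in> rel_ideal R" using cls_self mem_cls_iff by blast
next
  assume st: "s - t \<in> rel_ideal R"
  have "u - s \<in> rel_ideal R \<longleftrightarrow> u - t \<in> rel_ideal R" for u
    using rel_ideal_memI(2)[OF _ st, of "u - s"] rel_ideal_memI(3)[OF _ st, of "u - t"] by auto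
  then show "cls R s = cls R t" by (auto simp: mem_cls_iff)
qed

lemma cls_eq_zero_iff: "cls R t = cls R 0 \<longleftrightarrow> t \<in> rel_ideal R"
  by (simp add: cls_eq_iff)

lemma cls_Union:
  assumes "S \<noteq> {}" and "\<And>x. x \<in> S \<Longrightarrow> f x - t \<in> rel_ideal R"
  shows "(\<Union>x\<in>S. cls R (f x)) = cls R t"
proof -
  have "cls R (f x) = cls R t" if "x \<in> S" for x using assms(2)[OF that] by (simp add: cls_eq_iff)
  with assms(1) show ?thesis by auto
qed

lemma cls_nonempty: "cls R t \<noteq> {}"
  using cls_self by blast

text \<open>\<open>quad_algebra_def\<close> is unfolded only here; afterwards every computation in
  the quotient runs on representatives.\<close>

lemma quad_algebra_simps:
  "carrier (quad_algebra R) = range (cls R)"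
  "cls R s \<otimes>\<^bsub>quad_algebra R\<^esub> cls R t = cls R (s * t)"
  "\<one>\<^bsub>quad_algebra R\<^esub> = cls R 1"
  "\<zero>\<^bsub>quad_algebra R\<^esub> = cls R 0"
  "cls R s \<oplus>\<^bsub>quad_algebra R\<^esub> cls R t = cls R (s + t)"
  "c \<odot>\<^bsub>quad_algebra R\<^esub> cls R t = cls R (tens_scale c t)"
proof -
  note defs = quad_algebra_def Let_def ring.extend_def module.fields_def FactRing_def
    rel_ideal_def[symmetric]
  show "carrier (quad_algebra R) = range (cls R)"
    by (auto simp: defs A_RCOSETS_def RCOSETS_def cls_def a_r_coset_def)
  show "\<one>\<^bsub>quad_algebra R\<^esub> = cls R 1"
    by (simp add: defs cls_def)
  show "\<zero>\<^bsub>quad_algebra R\<^esub> = cls R 0"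
    by (simp add: defs cls_eq_image)
  show "c \<odot>\<^bsub>quad_algebra R\<^esub> cls R t = cls R (tens_scale c t)"
    unfolding defs using cls_nonempty
    by (auto simp: cls_def[symmetric] mem_cls_iff rel_ideal_memI
        simp flip: tens.scale_right_diff_distrib intro!: cls_Union)
  show "cls R s \<oplus>\<^bsub>quad_algebra R\<^esub> cls R t = cls R (s + t)"
  proof -
    have "cls R s \<oplus>\<^bsub>quad_algebra R\<^esub> cls R t = {x + y | x y. x \<in> cls R s \<and> y \<in> cls R t}"
      by (auto simp: defs set_add_def set_mult_def)
    also have "\<dots> = cls R (s + t)"
    proof (intro equalityI subsetI)
      fix u assume "u \<in> {x + y | x y. x \<in> cls R s \<and> y \<in> cls R t}"
      then obtain x y where "u = x + y" "x - s \<in> rel_ideal R" "y - t \<in> rel_ideal R"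
        by (auto simp: mem_cls_iff)
      moreover have "(x + y) - (s + t) = (x - s) + (y - t)" by simp
      ultimately show "u \<in> cls R (s + t)" using rel_ideal_memI(2) mem_cls_iff by metis
    next
      fix u assume "u \<in> cls R (s + t)"
      then have "u - t \<in> cls R s" by (simp add: mem_cls_iff algebra_simps)
      then show "u \<in> {x + y | x y. x \<in> cls R s \<and> y \<in> cls R t}"
        using cls_self[of t R] by (intro CollectI exI[of _ "u - t"] exI[of _ t]) auto
    qed
    finally show ?thesis .
  qed
  show "cls R s \<otimes>\<^bsub>quad_algebra R\<^esub> cls R t = cls R (s * t)"
  proof -
    have "cls R (x * y) = cls R (s * t)" if "x \<in> cls R s" "y \<in> cls R t" for x y
    proof -
      have "x * y - s * t = (x - s) * y + s * (y - t)" by (simp add: algebra_simps)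
      then show ?thesis
        using that by (simp add: cls_eq_iff mem_cls_iff rel_ideal_mult rel_ideal_memI)
    qed
    moreover have "cls R s \<otimes>\<^bsub>quad_algebra R\<^esub> cls R t = (\<Union>x\<in>cls R s. \<Union>y\<in>cls R t. cls R (x * y))"
      by (simp add: defs rcoset_mult_def cls_def)
    ultimately show ?thesis using cls_nonempty[of R s] cls_nonempty[of R t] by auto
  qed
qed

lemma cls_in_carrier [simp]: "cls R t \<in> carrier (quad_algebra R)"
  by (simp add: quad_algebra_simps)

lemma quad_carrierE:
  assumes "a \<in> carrier (quad_algebra R)" obtains t where "a = cls R t"
  using assms by (auto simp: quad_algebra_simps)

lemma ring_quad_algebra: "ring (quad_algebra R)"
proof (rule ringI)
  have inv: "\<exists>y\<in>range (cls R). y \<oplus>\<^bsub>quad_algebra R\<^esub> cls R t = cls R 0" for t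
    by (rule bexI[of _ "cls R (- t)"]) (simp_all add: quad_algebra_simps)
  then show "abelian_group (quad_algebra R)"
    by (intro abelian_groupI) (auto simp: quad_algebra_simps add_ac)
  show "monoid (quad_algebra R)"
    by (rule monoidI) (auto simp: quad_algebra_simps mult.assoc)
qed (auto simp: quad_algebra_simps distrib_left distrib_right)

text \<open>The description operator picks a unique value because elements of the ideal have no
  constant term, which is where the relations being quadratic enters.\<close>

lemma augmentation_cls:
  assumes "R \<subseteq> tens_power 2"
  shows "augmentation (cls R t) = coef t []"
  unfolding augmentation_def
proof (rule the_equality)
  fix c assume "\<exists>s\<in>cls R t. coef s [] = c"
  then obtain s where "s - t \<in> rel_ideal R" "coef s [] = c" by (auto simp: mem_cls_iff)
  with rel_ideal_low_coef(1)[OF assms this(1)] show "c = coef t []"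
    by (simp add: lookup_minus)
qed (use cls_self in blast)

lemma finsum_cls:
  "finite S \<Longrightarrow> (\<Oplus>\<^bsub>quad_algebra R\<^esub>i\<in>S. cls R (f i)) = cls R (\<Sum>i\<in>S. f i)"
proof (induction S rule: finite_induct)
  interpret ring "quad_algebra R" by (rule ring_quad_algebra)
  case empty
  show ?case by (simp add: quad_algebra_simps)
next
  interpret ring "quad_algebra R" by (rule ring_quad_algebra)
  case (insert i S)
  then show ?case by (simp add: finsum_insert quad_algebra_simps)
qed

section \<open>Homological algebra of left modules\<close>

lemma (in abelian_group) a_minus_zero: "x \<in> carrier G \<Longrightarrow> x \<ominus> \<zero> = x"
  using minus_equality[of \<zero> \<zero>] by (simp add: a_minus_def)

context left_module
begin

lemma smult_l_null: "x \<in> carrier M \<Longrightarrow> \<zero> \<odot>\<^bsub>M\<^esub> x = \<zero>\<^bsub>M\<^esub>"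
  using smult_l_distr[of \<zero> \<zero> x] smult_closed[of \<zero> x] M.add.r_cancel_one'
  by (metis R.l_zero R.zero_closed)

lemma smult_r_null: "a \<in> carrier R \<Longrightarrow> a \<odot>\<^bsub>M\<^esub> \<zero>\<^bsub>M\<^esub> = \<zero>\<^bsub>M\<^esub>"
  using smult_r_distr[of a "\<zero>\<^bsub>M\<^esub>" "\<zero>\<^bsub>M\<^esub>"] smult_closed[of a "\<zero>\<^bsub>M\<^esub>"]
  by (metis M.add.r_cancel_one' M.l_zero M.zero_closed)

lemma smult_r_minus:
  assumes "a \<in> carrier R" "x \<in> carrier M"
  shows "a \<odot>\<^bsub>M\<^esub> (\<ominus>\<^bsub>M\<^esub> x) = \<ominus>\<^bsub>M\<^esub> (a \<odot>\<^bsub>M\<^esub> x)"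
proof -
  have "a \<odot>\<^bsub>M\<^esub> (\<ominus>\<^bsub>M\<^esub> x) \<oplus>\<^bsub>M\<^esub> (a \<odot>\<^bsub>M\<^esub> x) = \<zero>\<^bsub>M\<^esub>"
    using assms by (simp add: smult_r_null M.l_neg flip: smult_r_distr)
  then show ?thesis using assms by (simp add: M.minus_equality smult_closed)
qed

lemma finsum_smult:
  assumes "finite S" "a \<in> carrier R" "f \<in> S \<rightarrow> carrier M"
  shows "a \<odot>\<^bsub>M\<^esub> finsum M f S = finsum M (\<lambda>i. a \<odot>\<^bsub>M\<^esub> f i) S"
  using assms(1,3)
proof (induction S rule: finite_induct)
  case (insert i S)
  have f: "f \<in> S \<rightarrow> carrier M" "f i \<in> carrier M" using insert.prems by auto
  then have "(\<lambda>i. a \<odot>\<^bsub>M\<^esub> f i) \<in> S \<rightarrow> carrier M" 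
    using smult_closed[OF assms(2)] by (simp add: Pi_iff)
  with insert.hyps f assms(2) insert.IH show ?case
    by (simp add: M.finsum_insert smult_r_distr smult_closed M.finsum_closed)
qed (simp add: smult_r_null assms(2))

end

lemma left_moduleD:
  assumes "left_module R M" shows "ring R" "abelian_group M"
  using assms by (auto simp: left_module_def)

lemma lhomI:
  assumes "f \<in> carrier M \<rightarrow>\<^sub>E carrier N"
    and "\<And>x y. x \<in> carrier M \<Longrightarrow> y \<in> carrier M \<Longrightarrow> f (x \<oplus>\<^bsub>M\<^esub> y) = f x \<oplus>\<^bsub>N\<^esub> f y"
    and "\<And>a x. a \<in> carrier R \<Longrightarrow> x \<in> carrier M \<Longrightarrow> f (a \<odot>\<^bsub>M\<^esub> x) = a \<odot>\<^bsub>N\<^esub> f x"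
  shows "f \<in> lhom R M N"
  using assms by (auto simp: lhom_def)

lemma lhomD:
  assumes "f \<in> lhom R M N"
  shows "f \<in> carrier M \<rightarrow>\<^sub>E carrier N"
    and "x \<in> carrier M \<Longrightarrow> f x \<in> carrier N"
    and "x \<in> carrier M \<Longrightarrow> y \<in> carrier M \<Longrightarrow> f (x \<oplus>\<^bsub>M\<^esub> y) = f x \<oplus>\<^bsub>N\<^esub> f y"
    and "a \<in> carrier R \<Longrightarrow> x \<in> carrier M \<Longrightarrow> f (a \<odot>\<^bsub>M\<^esub> x) = a \<odot>\<^bsub>N\<^esub> f x"
  using assms by (auto simp: lhom_def)

lemma lhom_restrictI:
  assumes "left_module R M"
    and "\<And>x. x \<in> carrier M \<Longrightarrow> f x \<in> carrier N"
    and "\<And>x y. x \<in> carrier M \<Longrightarrow> y \<in> carrier M \<Longrightarrow> f (x \<oplus>\<^bsub>M\<^esub> y) = f x \<oplus>\<^bsub>N\<^esub> f y"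
    and "\<And>a x. a \<in> carrier R \<Longrightarrow> x \<in> carrier M \<Longrightarrow> f (a \<odot>\<^bsub>M\<^esub> x) = a \<odot>\<^bsub>N\<^esub> f x"
  shows "(\<lambda>x\<in>carrier M. f x) \<in> lhom R M N"
proof -
  interpret left_module R M by fact
  show ?thesis using assms(2-4) by (intro lhomI) (auto simp: smult_closed)
qed

lemma lhom_ext:
  assumes "f \<in> lhom R M N" "g \<in> lhom R M N" "\<And>x. x \<in> carrier M \<Longrightarrow> f x = g x"
  shows "f = g"
  by (rule PiE_ext[OF lhomD(1)[OF assms(1)] lhomD(1)[OF assms(2)] assms(3)])

lemma lhom_zero:
  assumes "left_module R M" "left_module R N" "f \<in> lhom R M N"
  shows "f \<zero>\<^bsub>M\<^esub> = \<zero>\<^bsub>N\<^esub>"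
proof -
  interpret M: left_module R M by fact
  interpret N: left_module R N by fact
  have "f (\<zero>\<^bsub>M\<^esub> \<oplus>\<^bsub>M\<^esub> \<zero>\<^bsub>M\<^esub>) = f \<zero>\<^bsub>M\<^esub> \<oplus>\<^bsub>N\<^esub> f \<zero>\<^bsub>M\<^esub>"
    by (rule lhomD(3)[OF assms(3)]) simp_all
  then show ?thesis
    using lhomD(2)[OF assms(3), of "\<zero>\<^bsub>M\<^esub>"]
    by (metis M.M.l_zero M.M.zero_closed N.M.add.r_cancel_one')
qed

lemma lhom_neg:
  assumes "left_module R M" "left_module R N" "f \<in> lhom R M N" "x \<in> carrier M"
  shows "f (\<ominus>\<^bsub>M\<^esub> x) = \<ominus>\<^bsub>N\<^esub> f x"
proof -
  interpret M: left_module R M by fact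
  interpret N: left_module R N by fact
  have "f (\<ominus>\<^bsub>M\<^esub> x) \<oplus>\<^bsub>N\<^esub> f x = \<zero>\<^bsub>N\<^esub>"
    using assms by (simp add: M.M.l_neg lhom_zero flip: lhomD(3)[OF assms(3)])
  then show ?thesis using assms lhomD(2)[OF assms(3)] by (simp add: N.M.minus_equality)
qed

lemma lhom_minus:
  assumes "left_module R M" "left_module R N" "f \<in> lhom R M N" "x \<in> carrier M" "y \<in> carrier M"
  shows "f (x \<ominus>\<^bsub>M\<^esub> y) = f x \<ominus>\<^bsub>N\<^esub> f y"
proof -
  interpret M: left_module R M by fact
  show ?thesis
    using assms by (simp add: a_minus_def lhomD(3)[OF assms(3)] lhom_neg)
qed

lemma lhom_compose:
  assumes "left_module R M" "f \<in> lhom R M N" "g \<in> lhom R N P"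
  shows "(\<lambda>x\<in>carrier M. g (f x)) \<in> lhom R M P"
  using lhomD[OF assms(2)] lhomD[OF assms(3)] by (intro lhom_restrictI assms(1)) auto

lemma lhom_combine:
  assumes "left_module R M" "left_module R N" "f \<in> lhom R M N" "g \<in> lhom R M N"
  shows "(\<lambda>x\<in>carrier M. f x \<ominus>\<^bsub>N\<^esub> g x) \<in> lhom R M N"
proof -
  interpret N: left_module R N by fact
  note f = lhomD[OF assms(3)] and g = lhomD[OF assms(4)]
  show ?thesis
  proof (rule lhom_restrictI[OF assms(1)])
    fix x y assume xy: "x \<in> carrier M" "y \<in> carrier M"
    note f(2)[OF xy(1)] f(2)[OF xy(2)] g(2)[OF xy(1)] g(2)[OF xy(2)]
    then show "f (x \<oplus>\<^bsub>M\<^esub> y) \<ominus>\<^bsub>N\<^esub> g (x \<oplus>\<^bsub>M\<^esub> y) = (f x \<ominus>\<^bsub>N\<^esub> g x) \<oplus>\<^bsub>N\<^esub> (f y \<ominus>\<^bsub>N\<^esub> g y)"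
      using xy by (simp add: f g a_minus_def N.M.minus_add N.M.a_ac)
  next
    fix a x assume "a \<in> carrier R" "x \<in> carrier M"
    then show "f (a \<odot>\<^bsub>M\<^esub> x) \<ominus>\<^bsub>N\<^esub> g (a \<odot>\<^bsub>M\<^esub> x) = a \<odot>\<^bsub>N\<^esub> (f x \<ominus>\<^bsub>N\<^esub> g x)"
      by (simp add: f g a_minus_def N.smult_r_distr N.smult_r_minus)
  qed (simp add: f g)
qed

lemma id_lhom: "left_module R M \<Longrightarrow> (\<lambda>x\<in>carrier M. x) \<in> lhom R M M"
  by (rule lhom_restrictI) auto

subsection \<open>Free modules\<close>

lemma free_module_simps:
  "carrier (free_module R I) =
    {f. (\<forall>i. f i \<in> carrier R) \<and> (\<forall>i. i \<notin> I \<longrightarrow> f i = \<zero>\<^bsub>R\<^esub>) \<and> finite {i. f i \<noteq> \<zero>\<^bsub>R\<^esub>}}"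
  "\<zero>\<^bsub>free_module R I\<^esub> = (\<lambda>_. \<zero>\<^bsub>R\<^esub>)"
  "f \<oplus>\<^bsub>free_module R I\<^esub> g = (\<lambda>i. f i \<oplus>\<^bsub>R\<^esub> g i)"
  "a \<odot>\<^bsub>free_module R I\<^esub> f = (\<lambda>i. a \<otimes>\<^bsub>R\<^esub> f i)"
  by (simp_all add: free_module_def)

lemma left_module_free:
  fixes R :: "('a, 'r) ring_scheme" (structure)
  assumes "ring R" shows "left_module R (free_module R I)"
proof -
  interpret ring R by fact
  have sub: "finite {i. f i \<oplus> g i \<noteq> \<zero>}"
    if "finite {i. f i \<noteq> \<zero>}" "finite {i. g i \<noteq> \<zero>}" for f g :: "'i \<Rightarrow> 'a"
    by (rule finite_subset[OF _ finite_UnI[OF that]]) auto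
  have "abelian_group (free_module R I)"
  proof (rule abelian_groupI)
    fix f assume f: "f \<in> carrier (free_module R I)"
    have "{i. \<ominus> f i \<noteq> \<zero>} \<subseteq> {i. f i \<noteq> \<zero>}" by auto
    then have "(\<lambda>i. \<ominus> f i) \<in> carrier (free_module R I)"
      using f by (auto simp: free_module_simps intro: finite_subset)
    moreover have "(\<lambda>i. \<ominus> f i) \<oplus>\<^bsub>free_module R I\<^esub> f = \<zero>\<^bsub>free_module R I\<^esub>"
      using f by (auto simp: free_module_simps l_neg)
    ultimately show "\<exists>g\<in>carrier (free_module R I). g \<oplus>\<^bsub>free_module R I\<^esub> f = \<zero>\<^bsub>free_module R I\<^esub>"
      by blast
  qed (auto simp: free_module_simps sub a_assoc intro!: ext a_comm)
  moreover have "finite {i. a \<otimes> f i \<noteq> \<zero>}" if "finite {i. f i \<noteq> \<zero>}" "a \<in> carrier R"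
    for a and f :: "'i \<Rightarrow> 'a"
    by (rule finite_subset[OF _ that(1)]) (use that(2) in auto)
  ultimately show ?thesis
    using assms unfolding left_module_def left_module_axioms_def
    by (auto simp: free_module_simps l_distr r_distr m_assoc)
qed

definition free_basis :: "('a, 'r) ring_scheme \<Rightarrow> 'i \<Rightarrow> 'i \<Rightarrow> 'a"
  where "free_basis R i = (\<lambda>j. if j = i then \<one>\<^bsub>R\<^esub> else \<zero>\<^bsub>R\<^esub>)"

lemma free_basis_closed:
  assumes "ring R" "i \<in> I" shows "free_basis R i \<in> carrier (free_module R I)"
proof -
  interpret ring R by fact
  have "{j. free_basis R i j \<noteq> \<zero>\<^bsub>R\<^esub>} \<subseteq> {i}" by (auto simp: free_basis_def)
  then have "finite {j. free_basis R i j \<noteq> \<zero>\<^bsub>R\<^esub>}" by (rule finite_subset) simp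
  then show ?thesis using assms(2) by (auto simp: free_module_simps free_basis_def)
qed

text \<open>Elements of a free module are plain functions of finite support, so the induction is on
  the size of the support, splitting off one coordinate at a time.\<close>

lemma free_lhom_eq:
  fixes R :: "('a, 'r) ring_scheme" (structure)
  assumes "ring R" "left_module R Y"
    and f: "f \<in> lhom R (free_module R I) Y" and g: "g \<in> lhom R (free_module R I) Y"
    and eq: "\<And>i. i \<in> I \<Longrightarrow> f (free_basis R i) = g (free_basis R i)"
    and x: "x \<in> carrier (free_module R I)"
  shows "f x = g x"
proof -
  interpret ring R by fact
  let ?F = "free_module R I"
  have lm: "left_module R ?F" by (rule left_module_free) fact
  have "\<forall>x\<in>carrier ?F. card {i. x i \<noteq> \<zero>} = n \<longrightarrow> f x = g x" for n
  proof (induction n)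
    case 0
    have "x = \<zero>\<^bsub>?F\<^esub>" if "x \<in> carrier ?F" "card {i. x i \<noteq> \<zero>} = 0" for x
      using that by (auto simp: free_module_simps)
    then show ?case using lhom_zero[OF lm assms(2)] f g by metis
  next
    case (Suc n)
    show ?case
    proof (intro ballI impI)
      fix x assume x: "x \<in> carrier ?F" and c: "card {i. x i \<noteq> \<zero>} = Suc n"
      then obtain i where i: "x i \<noteq> \<zero>" by (metis (mono_tags) card.empty empty_Collect_eq nat.simps(3))
      then have iI: "i \<in> I" using x by (auto simp: free_module_simps)
      define y where "y = x(i := \<zero>)"
      have s: "{j. y j \<noteq> \<zero>} = {j. x j \<noteq> \<zero>} - {i}" by (auto simp: y_def)
      then have "card {j. y j \<noteq> \<zero>} = n" using c i by (simp add: card_Diff_singleton)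
      moreover have y: "y \<in> carrier ?F"
        using x s by (auto simp: free_module_simps y_def)
      ultimately have "f y = g y" using Suc.IH by blast
      moreover have "x = (x i \<odot>\<^bsub>?F\<^esub> free_basis R i) \<oplus>\<^bsub>?F\<^esub> y"
        using x by (auto simp: free_module_simps free_basis_def y_def)
      moreover have "x i \<in> carrier R" using x by (auto simp: free_module_simps)
      moreover have "x i \<odot>\<^bsub>?F\<^esub> free_basis R i \<in> carrier ?F"
        using left_module.smult_closed[OF lm] free_basis_closed[OF assms(1) iI] \<open>x i \<in> carrier R\<close> by blast
      ultimately show "f x = g x"
        using lhomD(3,4)[OF f] lhomD(3,4)[OF g] eq[OF iI] y free_basis_closed[OF assms(1) iI] by metis
    qed
  qed
  then show ?thesis using x by blast
qed

lemma free_lhom_exists: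
  fixes R :: "('a, 'r) ring_scheme" (structure)
  assumes "ring R" "left_module R Y" and y: "\<And>i. i \<in> I \<Longrightarrow> y i \<in> carrier Y"
  shows "\<exists>f\<in>lhom R (free_module R I) Y. \<forall>i\<in>I. f (free_basis R i) = y i"
proof -
  interpret left_module R Y by fact
  let ?F = "free_module R I"
  have lm: "left_module R ?F" by (rule left_module_free) fact
  define E where "E x = finsum Y (\<lambda>i. x i \<odot>\<^bsub>Y\<^esub> y i) {i. x i \<noteq> \<zero>}" for x
  have cl: "x i \<in> carrier R" if "x \<in> carrier ?F" for x i
    using that by (auto simp: free_module_simps)
  have supp: "{i. x i \<noteq> \<zero>} \<subseteq> I" "finite {i. x i \<noteq> \<zero>}" if "x \<in> carrier ?F" for x
    using that by (auto simp: free_module_simps)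
  have fn: "(\<lambda>i. x i \<odot>\<^bsub>Y\<^esub> y i) \<in> S \<rightarrow> carrier Y" if "x \<in> carrier ?F" "S \<subseteq> I" for x S
    using that y cl by (auto intro!: smult_closed)
  \<comment> \<open>The sum defining \<open>E x\<close> runs over the support of \<open>x\<close>,
    which changes under addition and scaling; enlarging it to a common finite set makes such sums
    comparable.\<close>
  have E: "E x = finsum Y (\<lambda>i. x i \<odot>\<^bsub>Y\<^esub> y i) S"
    if "x \<in> carrier ?F" "finite S" "{i. x i \<noteq> \<zero>} \<subseteq> S" "S \<subseteq> I" for x S
    unfolding E_def
    by (rule M.add.finprod_mono_neutral_cong_left)
      (use that y fn in \<open>auto simp: smult_l_null\<close>)
  have "(\<lambda>x\<in>carrier ?F. E x) \<in> lhom R ?F Y"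
  proof (rule lhom_restrictI[OF lm])
    fix x assume x: "x \<in> carrier ?F"
    show "E x \<in> carrier Y"
      unfolding E_def by (rule M.finsum_closed) (use fn[OF x supp(1)[OF x]] in auto)
    fix z assume z: "z \<in> carrier ?F"
    let ?S = "{i. x i \<noteq> \<zero>} \<union> {i. z i \<noteq> \<zero>}"
    have xz: "x \<oplus>\<^bsub>?F\<^esub> z \<in> carrier ?F"
      using x z abelian_group.axioms(1)[OF left_moduleD(2)[OF lm]] by (simp add: abelian_monoid.a_closed)
    have S: "finite ?S" "?S \<subseteq> I" using supp[OF x] supp[OF z] by auto
    have "E (x \<oplus>\<^bsub>?F\<^esub> z) = finsum Y (\<lambda>i. (x \<oplus>\<^bsub>?F\<^esub> z) i \<odot>\<^bsub>Y\<^esub> y i) ?S"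
      by (rule E[OF xz S(1) _ S(2)]) (auto simp: free_module_simps)
    also have "\<dots> = finsum Y (\<lambda>i. (x i \<odot>\<^bsub>Y\<^esub> y i) \<oplus>\<^bsub>Y\<^esub> (z i \<odot>\<^bsub>Y\<^esub> y i)) ?S"
      using S(2) y cl[OF x] cl[OF z] fn[OF x S(2)] fn[OF z S(2)]
      by (intro M.finsum_cong') (auto simp: free_module_simps smult_l_distr subset_iff)
    also have "\<dots> = E x \<oplus>\<^bsub>Y\<^esub> E z"
      using fn[OF x S(2)] fn[OF z S(2)] E[OF x S(1) _ S(2)] E[OF z S(1) _ S(2)]
      by (simp add: M.finsum_addf)
    finally show "E (x \<oplus>\<^bsub>?F\<^esub> z) = E x \<oplus>\<^bsub>Y\<^esub> E z" .
  next
    fix a x assume a: "a \<in> carrier R" and x: "x \<in> carrier ?F"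
    have ax: "a \<odot>\<^bsub>?F\<^esub> x \<in> carrier ?F" using left_module.smult_closed[OF lm a x] .
    have "E (a \<odot>\<^bsub>?F\<^esub> x) = finsum Y (\<lambda>i. (a \<odot>\<^bsub>?F\<^esub> x) i \<odot>\<^bsub>Y\<^esub> y i) {i. x i \<noteq> \<zero>}"
      using a x supp[OF x] by (intro E ax) (auto simp: free_module_simps)
    also have "\<dots> = finsum Y (\<lambda>i. a \<odot>\<^bsub>Y\<^esub> (x i \<odot>\<^bsub>Y\<^esub> y i)) {i. x i \<noteq> \<zero>}"
      using fn[OF x supp(1)[OF x]] a y supp(1)[OF x] cl[OF x]
      by (intro M.finsum_cong') (auto simp: free_module_simps smult_assoc smult_closed subset_iff)
    also have "\<dots> = a \<odot>\<^bsub>Y\<^esub> E x"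
      unfolding E_def by (rule finsum_smult[symmetric, OF supp(2)[OF x] a fn[OF x supp(1)[OF x]]])
    finally show "E (a \<odot>\<^bsub>?F\<^esub> x) = a \<odot>\<^bsub>Y\<^esub> E x" .
  qed
  moreover have "E (free_basis R i) = y i" if "i \<in> I" for i
  proof -
    have "E (free_basis R i) = finsum Y (\<lambda>j. free_basis R i j \<odot>\<^bsub>Y\<^esub> y j) {i}"
      using that by (intro E free_basis_closed assms(1)) (auto simp: free_basis_def)
    then show ?thesis using y[OF that] by (simp add: free_basis_def smult_one)
  qed
  ultimately show ?thesis
    by (intro bexI[of _ "restrict E (carrier ?F)"]) (simp_all add: free_basis_closed assms(1))
qed

text \<open>Lifting is done on the basis of a free module that has \<open>P\<close> as a summand:
  extend \<open>g\<close> to it along \<open>p\<close>, lift, and restrict along the section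
  \<open>s\<close>.\<close>

lemma projective_lift:
  fixes P :: "('a, 'p) module"
  assumes "projective_module R P" "left_module R N" "left_module R Y"
    and g: "g \<in> lhom R P Y" and h: "h \<in> lhom R N Y" and im: "g ` carrier P \<subseteq> h ` carrier N"
  shows "\<exists>f\<in>lhom R P N. \<forall>x\<in>carrier P. h (f x) = g x"
proof -
  from assms(1) obtain I :: "'p set" and s p where lP: "left_module R P"
    and s: "s \<in> lhom R P (free_module R I)" and p: "p \<in> lhom R (free_module R I) P"
    and ps: "\<And>x. x \<in> carrier P \<Longrightarrow> p (s x) = x"
    unfolding projective_module_def by blast
  note rng = left_moduleD(1)[OF lP]
  let ?F = "free_module R I"
  have lF: "left_module R ?F" by (rule left_module_free[OF rng])
  have "\<forall>i\<in>I. \<exists>x. x \<in> carrier N \<and> h x = g (p (free_basis R i))"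
  proof
    fix i assume "i \<in> I"
    then have "p (free_basis R i) \<in> carrier P" by (rule lhomD(2)[OF p free_basis_closed[OF rng]])
    with im have "g (p (free_basis R i)) \<in> h ` carrier N" by blast
    then show "\<exists>x. x \<in> carrier N \<and> h x = g (p (free_basis R i))" by force
  qed
  from bchoice[OF this] obtain x where x: "\<And>i. i \<in> I \<Longrightarrow> x i \<in> carrier N"
    and hx: "\<And>i. i \<in> I \<Longrightarrow> h (x i) = g (p (free_basis R i))" by blast
  have "\<exists>f\<in>lhom R ?F N. \<forall>i\<in>I. f (free_basis R i) = x i"
    by (rule free_lhom_exists[OF rng assms(2) x])
  then obtain f where f: "f \<in> lhom R ?F N" and fb: "\<forall>i\<in>I. f (free_basis R i) = x i" ..
  have "h (f z) = g (p z)" if "z \<in> carrier ?F" for z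
  proof -
    have "(\<lambda>z\<in>carrier ?F. h (f z)) z = (\<lambda>z\<in>carrier ?F. g (p z)) z"
    proof (rule free_lhom_eq[OF rng assms(3) lhom_compose[OF lF f h] lhom_compose[OF lF p g] _ that])
      fix i assume "i \<in> I"
      with free_basis_closed[OF rng this] show "(\<lambda>z\<in>carrier ?F. h (f z)) (free_basis R i) =
          (\<lambda>z\<in>carrier ?F. g (p z)) (free_basis R i)"
        by (simp add: fb hx)
    qed
    then show ?thesis using that by simp
  qed
  then show ?thesis
    by (intro bexI[OF _ lhom_compose[OF lP s f]]) (simp add: lhomD(2)[OF s] ps)
qed

subsection \<open>Comparison of projective resolutions\<close>

lemma projective_resolutionD:
  assumes "projective_resolution R M P d e"
  shows "projective_module R (P n)" "left_module R (P n)" "d n \<in> lhom R (P (Suc n)) (P n)"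
    "e \<in> lhom R (P 0) M" "e ` carrier (P 0) = carrier M"
    "x \<in> carrier (P 0) \<Longrightarrow> e x = \<zero>\<^bsub>M\<^esub> \<longleftrightarrow> x \<in> d 0 ` carrier (P 1)"
    "y \<in> carrier (P (Suc n)) \<Longrightarrow> d n y = \<zero>\<^bsub>P n\<^esub> \<longleftrightarrow> y \<in> d (Suc n) ` carrier (P (Suc (Suc n)))"
  using assms unfolding projective_resolution_def projective_module_def by blast+

lemma resolution_d_d:
  assumes "projective_resolution R M P d e" "x \<in> carrier (P (Suc (Suc n)))"
  shows "d n (d (Suc n) x) = \<zero>\<^bsub>P n\<^esub>"
  using projective_resolutionD(7)[OF assms(1), of "d (Suc n) x" n]
    lhomD(2)[OF projective_resolutionD(3)[OF assms(1)] assms(2)] assms(2) by blast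

lemma resolution_e_d:
  assumes "projective_resolution R M P d e" "x \<in> carrier (P 1)"
  shows "e (d 0 x) = \<zero>\<^bsub>M\<^esub>"
  using projective_resolutionD(6)[OF assms(1), of "d 0 x"]
    lhomD(2)[OF projective_resolutionD(3)[OF assms(1)], of x 0] assms(2) by auto

definition chain_map ::
  "('a, 'r) ring_scheme \<Rightarrow> (nat \<Rightarrow> ('a, 'p) module) \<Rightarrow> (nat \<Rightarrow> 'p \<Rightarrow> 'p) \<Rightarrow> ('p \<Rightarrow> 'm)
    \<Rightarrow> (nat \<Rightarrow> ('a, 'q) module) \<Rightarrow> (nat \<Rightarrow> 'q \<Rightarrow> 'q) \<Rightarrow> ('q \<Rightarrow> 'm) \<Rightarrow> (nat \<Rightarrow> 'p \<Rightarrow> 'q) \<Rightarrow> bool"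
  where "chain_map R P d e Q d' e' f \<longleftrightarrow> (\<forall>n. f n \<in> lhom R (P n) (Q n)) \<and>
    (\<forall>x\<in>carrier (P 0). e' (f 0 x) = e x) \<and>
    (\<forall>n. \<forall>x\<in>carrier (P (Suc n)). d' n (f (Suc n) x) = f n (d n x))"

lemma chain_mapD:
  assumes "chain_map R P d e Q d' e' f"
  shows "f n \<in> lhom R (P n) (Q n)"
    "x \<in> carrier (P 0) \<Longrightarrow> e' (f 0 x) = e x"
    "y \<in> carrier (P (Suc n)) \<Longrightarrow> d' n (f (Suc n) y) = f n (d n y)"
  using assms by (auto simp: chain_map_def)

lemma chain_map_exists:
  assumes P: "projective_resolution R M P d e" and Q: "projective_resolution R M Q d' e'"
    and M: "left_module R M"
  shows "\<exists>f. chain_map R P d e Q d' e' f"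
proof -
  note PD = projective_resolutionD[OF P] and QD = projective_resolutionD[OF Q]
  \<comment> \<open>Besides linearity the invariant records that \<open>f\<close> maps boundaries to
    boundaries. This is the inclusion of images that \<open>projective_lift\<close> demands in the
    next degree; in degree 0 it also keeps the compatibility with the augmentations.\<close>
  define good where "good n f \<longleftrightarrow> f \<in> lhom R (P n) (Q n) \<and>
    (\<forall>x\<in>carrier (P (Suc n)). f (d n x) \<in> d' n ` carrier (Q (Suc n))) \<and>
    (n = 0 \<longrightarrow> (\<forall>x\<in>carrier (P 0). e' (f x) = e x))" for n f
  have dP: "d n x \<in> carrier (P n)" if "x \<in> carrier (P (Suc n))" for n x
    by (rule lhomD(2)[OF PD(3) that])
  have "e ` carrier (P 0) \<subseteq> e' ` carrier (Q 0)" using PD(5) QD(5) by simp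
  from projective_lift[OF PD(1) QD(2) M PD(4) QD(4) this]
  obtain f0 where f0: "f0 \<in> lhom R (P 0) (Q 0)" and e0: "\<And>x. x \<in> carrier (P 0) \<Longrightarrow> e' (f0 x) = e x"
    by blast
  have "f0 (d 0 x) \<in> d' 0 ` carrier (Q 1)" if "x \<in> carrier (P 1)" for x
  proof -
    have dx: "d 0 x \<in> carrier (P 0)" using dP[of x 0] that by simp
    show ?thesis
      using QD(6)[OF lhomD(2)[OF f0 dx]] e0[OF dx] resolution_e_d[OF P that] by simp
  qed
  then have base: "good 0 f0" using f0 e0 by (simp add: good_def)
  have step: "\<exists>f'. good (Suc n) f' \<and> (\<forall>x\<in>carrier (P (Suc n)). d' n (f' x) = f (d n x))"
    if f: "good n f" for n f
  proof -
    have fh: "f \<in> lhom R (P n) (Q n)" using f by (simp add: good_def)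
    have "(\<lambda>x\<in>carrier (P (Suc n)). f (d n x)) ` carrier (P (Suc n)) \<subseteq> d' n ` carrier (Q (Suc n))"
      using f by (auto simp: good_def)
    from projective_lift[OF PD(1) QD(2) QD(2) lhom_compose[OF PD(2) PD(3) fh] QD(3) this]
    obtain f' where f': "f' \<in> lhom R (P (Suc n)) (Q (Suc n))"
      and eq: "\<And>x. x \<in> carrier (P (Suc n)) \<Longrightarrow> d' n (f' x) = f (d n x)" by auto
    have "f' (d (Suc n) x) \<in> d' (Suc n) ` carrier (Q (Suc (Suc n)))"
      if x: "x \<in> carrier (P (Suc (Suc n)))" for x
    proof -
      have "d' n (f' (d (Suc n) x)) = f (d n (d (Suc n) x))" by (rule eq[OF dP[OF x]])
      also have "\<dots> = \<zero>\<^bsub>Q n\<^esub>"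
        by (simp add: resolution_d_d[OF P x] lhom_zero[OF PD(2) QD(2) fh])
      finally show ?thesis using QD(7)[OF lhomD(2)[OF f' dP[OF x]]] by simp
    qed
    then show ?thesis using f' eq by (auto simp: good_def)
  qed
  obtain f where "\<And>n. good n (f n)" "f 0 = f0"
    "\<And>n. \<forall>x\<in>carrier (P (Suc n)). d' n (f (Suc n) x) = f n (d n x)"
    using dependent_nat_choice[of "\<lambda>n f. good n f \<and> (n = 0 \<longrightarrow> f = f0)"
        "\<lambda>n f f'. \<forall>x\<in>carrier (P (Suc n)). d' n (f' x) = f (d n x)"] base step
    by (metis nat.simps(3))
  then have "chain_map R P d e Q d' e' f" by (auto simp: chain_map_def good_def)
  then show ?thesis by blast
qed

lemma chain_map_compose:
  assumes "chain_map R P d e Q d' e' f" "chain_map R Q d' e' P d e g"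
    and P: "projective_resolution R M P d e"
  shows "chain_map R P d e P d e (\<lambda>n. \<lambda>x\<in>carrier (P n). g n (f n x))"
proof -
  note f = chain_mapD[OF assms(1)] and g = chain_mapD[OF assms(2)]
    and PD = projective_resolutionD[OF P]
  have "d n (g (Suc n) (f (Suc n) x)) = g n (f n (d n x))" if "x \<in> carrier (P (Suc n))" for n x
    using g(3)[OF lhomD(2)[OF f(1) that]] f(3)[OF that] by simp
  moreover have "e (g 0 (f 0 x)) = e x" if "x \<in> carrier (P 0)" for x
    using g(2)[OF lhomD(2)[OF f(1) that]] f(2)[OF that] by simp
  ultimately show ?thesis
    using lhomD(2)[OF PD(3)] lhom_compose[OF PD(2) f(1) g(1)] by (simp add: chain_map_def)
qed

text \<open>Only homotopies to the identity are needed: the comparison applies this to the two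
  composites of a pair of chain maps going back and forth.\<close>

lemma chain_map_homotopy:
  fixes P :: "nat \<Rightarrow> ('a, 'p) module"
  assumes P: "projective_resolution R M P d e" and M: "left_module R M"
    and f: "chain_map R P d e P d e f"
  shows "\<exists>h. (\<forall>n. h n \<in> lhom R (P n) (P (Suc n))) \<and>
    (\<forall>x\<in>carrier (P 0). d 0 (h 0 x) = f 0 x \<ominus>\<^bsub>P 0\<^esub> x) \<and>
    (\<forall>n. \<forall>x\<in>carrier (P (Suc n)).
      d (Suc n) (h (Suc n) x) = (f (Suc n) x \<ominus>\<^bsub>P (Suc n)\<^esub> x) \<ominus>\<^bsub>P (Suc n)\<^esub> h n (d n x))"
proof -
  note PD = projective_resolutionD[OF P] and fD = chain_mapD[OF f]
  have dP: "d n x \<in> carrier (P n)" if "x \<in> carrier (P (Suc n))" for n x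
    by (rule lhomD(2)[OF PD(3) that])
  have fP: "f n x \<in> carrier (P n)" if "x \<in> carrier (P n)" for n x
    by (rule lhomD(2)[OF fD(1) that])
  have mz: "x \<ominus>\<^bsub>P n\<^esub> x = \<zero>\<^bsub>P n\<^esub>" if "x \<in> carrier (P n)" for x n
    using abelian_group.r_neg[OF left_moduleD(2)[OF PD(2)] that] by (simp add: a_minus_def)
  have mzM: "x \<ominus>\<^bsub>M\<^esub> x = \<zero>\<^bsub>M\<^esub>" if "x \<in> carrier M" for x
    using abelian_group.r_neg[OF left_moduleD(2)[OF M] that] by (simp add: a_minus_def)
  define g where "g n = (\<lambda>x\<in>carrier (P n). f n x \<ominus>\<^bsub>P n\<^esub> x)" for n
  have "(\<lambda>x\<in>carrier (P n). f n x \<ominus>\<^bsub>P n\<^esub> (\<lambda>x\<in>carrier (P n). x) x) \<in> lhom R (P n) (P n)" for n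
    by (rule lhom_combine[OF PD(2) PD(2) fD(1) id_lhom[OF PD(2)]])
  moreover have "(\<lambda>x\<in>carrier (P n). f n x \<ominus>\<^bsub>P n\<^esub> (\<lambda>x\<in>carrier (P n). x) x) = g n" for n
    by (auto simp: g_def)
  ultimately have gh: "g n \<in> lhom R (P n) (P n)" for n by simp
  have dg: "d n (g (Suc n) x) = g n (d n x)" if "x \<in> carrier (P (Suc n))" for n x
    using that by (simp add: g_def dP fD(3) lhom_minus[OF PD(2) PD(2) PD(3)] fP)
  have eg: "e (g 0 x) = \<zero>\<^bsub>M\<^esub>" if "x \<in> carrier (P 0)" for x
    using that lhomD(2)[OF PD(4) that] by (simp add: g_def lhom_minus[OF PD(2) M PD(4)] fP fD(2) mzM)
  \<comment> \<open>\<open>k n h\<close> is what is left of \<open>f - id\<close> in degree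
    \<open>Suc n\<close> after subtracting \<open>h\<close> composed with the differential. The
    invariant \<open>good\<close> says that its values are cycles, hence boundaries by exactness,
    and a lift of it is the next homotopy component.\<close>
  define k where "k n h = (\<lambda>x\<in>carrier (P (Suc n)).
    g (Suc n) x \<ominus>\<^bsub>P (Suc n)\<^esub> (\<lambda>x\<in>carrier (P (Suc n)). h (d n x)) x)" for n and h :: "'p \<Rightarrow> 'p"
  define good where "good n h \<longleftrightarrow> h \<in> lhom R (P n) (P (Suc n)) \<and>
    (\<forall>x\<in>carrier (P (Suc n)). d n (k n h x) = \<zero>\<^bsub>P n\<^esub>)" for n h
  have "g 0 ` carrier (P 0) \<subseteq> d 0 ` carrier (P (Suc 0))"
    using PD(6)[OF lhomD(2)[OF gh]] eg by auto
  from projective_lift[OF PD(1) PD(2) PD(2) gh PD(3) this]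
  obtain h0 where h0: "h0 \<in> lhom R (P 0) (P (Suc 0))"
    and d0: "\<And>x. x \<in> carrier (P 0) \<Longrightarrow> d 0 (h0 x) = g 0 x" by blast
  have dk: "d n (k n h x) = g n (d n x) \<ominus>\<^bsub>P n\<^esub> d n (h (d n x))"
    if "h \<in> lhom R (P n) (P (Suc n))" "x \<in> carrier (P (Suc n))" for n h x
    using that by (simp add: k_def lhom_minus[OF PD(2) PD(2) PD(3)] lhomD(2)[OF gh] lhomD(2) dP dg)
  have base: "good 0 h0"
    unfolding good_def using h0 by (simp add: dk d0 dP mz lhomD(2)[OF gh])
  have step: "\<exists>h'. good (Suc n) h' \<and> (\<forall>x\<in>carrier (P (Suc n)). d (Suc n) (h' x) = k n h x)"
    if h: "good n h" for n h
  proof -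
    have hh: "h \<in> lhom R (P n) (P (Suc n))" using h by (simp add: good_def)
    have kh: "k n h \<in> lhom R (P (Suc n)) (P (Suc n))"
      unfolding k_def by (rule lhom_combine[OF PD(2) PD(2) gh lhom_compose[OF PD(2) PD(3) hh]])
    have "k n h ` carrier (P (Suc n)) \<subseteq> d (Suc n) ` carrier (P (Suc (Suc n)))"
      using PD(7)[OF lhomD(2)[OF kh]] h by (auto simp: good_def)
    from projective_lift[OF PD(1) PD(2) PD(2) kh PD(3) this]
    obtain h' where h': "h' \<in> lhom R (P (Suc n)) (P (Suc (Suc n)))"
      and eq: "\<And>x. x \<in> carrier (P (Suc n)) \<Longrightarrow> d (Suc n) (h' x) = k n h x" by blast
    have "d (Suc n) (k (Suc n) h' x) = \<zero>\<^bsub>P (Suc n)\<^esub>" if x: "x \<in> carrier (P (Suc (Suc n)))" for x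
    proof -
      have "k n h (d (Suc n) x) = g (Suc n) (d (Suc n) x) \<ominus>\<^bsub>P (Suc n)\<^esub> \<zero>\<^bsub>P (Suc n)\<^esub>"
        using dP[OF x] by (simp add: k_def resolution_d_d[OF P x] lhom_zero[OF PD(2) PD(2) hh])
      also have "\<dots> = g (Suc n) (d (Suc n) x)"
        by (rule abelian_group.a_minus_zero[OF left_moduleD(2)[OF PD(2)] lhomD(2)[OF gh dP[OF x]]])
      finally show ?thesis
        using dP[OF x] by (simp add: dk[OF h' x] eq mz lhomD(2)[OF gh])
    qed
    then show ?thesis using h' eq by (auto simp: good_def)
  qed
  obtain h where h: "\<And>n. good n (h n)" "h 0 = h0"
    "\<And>n. \<forall>x\<in>carrier (P (Suc n)). d (Suc n) (h (Suc n) x) = k n (h n) x"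
    using dependent_nat_choice[of "\<lambda>n h. good n h \<and> (n = 0 \<longrightarrow> h = h0)"
        "\<lambda>n h h'. \<forall>x\<in>carrier (P (Suc n)). d (Suc n) (h' x) = k n h x"] base step
    by (metis nat.simps(3))
  then show ?thesis
    by (intro exI[of _ h]) (auto simp: good_def k_def g_def d0)
qed

subsection \<open>Submodules and quotients\<close>

lemma (in abelian_group) minus_eq_zero_iff:
  assumes "x \<in> carrier G" "y \<in> carrier G"
  shows "x \<ominus> y = \<zero> \<longleftrightarrow> x = y"
  using assms minus_equality[of x "\<ominus> y"] by (auto simp: a_minus_def r_neg)

definition submod :: "('a, 'r) ring_scheme \<Rightarrow> ('a, 'b, 's) module_scheme \<Rightarrow> 'b set \<Rightarrow> bool"
  where "submod R M B \<longleftrightarrow> B \<subseteq> carrier M \<and> \<zero>\<^bsub>M\<^esub> \<in> B \<and>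
    (\<forall>x\<in>B. \<forall>y\<in>B. x \<oplus>\<^bsub>M\<^esub> y \<in> B) \<and> (\<forall>a\<in>carrier R. \<forall>x\<in>B. a \<odot>\<^bsub>M\<^esub> x \<in> B)"

text \<open>Closure under scalars already contains closure under negatives, because -x = (-1)
  x.\<close>

lemma submod_neg:
  assumes "left_module R M" "submod R M B" "x \<in> B"
  shows "\<ominus>\<^bsub>M\<^esub> x \<in> B"
proof -
  interpret left_module R M by fact
  have x: "x \<in> carrier M" using assms by (auto simp: submod_def)
  have "((\<ominus>\<^bsub>R\<^esub> \<one>\<^bsub>R\<^esub>) \<odot>\<^bsub>M\<^esub> x) \<oplus>\<^bsub>M\<^esub> (\<one>\<^bsub>R\<^esub> \<odot>\<^bsub>M\<^esub> x) = \<zero>\<^bsub>M\<^esub>"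
    using x by (simp add: R.l_neg smult_l_null flip: smult_l_distr)
  then have "\<ominus>\<^bsub>M\<^esub> x = (\<ominus>\<^bsub>R\<^esub> \<one>\<^bsub>R\<^esub>) \<odot>\<^bsub>M\<^esub> x"
    using x by (intro M.minus_equality) (simp_all add: smult_one smult_closed)
  then show ?thesis using assms(2,3) by (simp add: submod_def)
qed

lemma submod_minus:
  assumes "left_module R M" "submod R M B" "x \<in> B" "y \<in> B"
  shows "x \<ominus>\<^bsub>M\<^esub> y \<in> B"
  using submod_neg[OF assms(1,2,4)] assms(2,3) by (simp add: submod_def a_minus_def)

lemma left_module_submod:
  assumes "left_module R M" "submod R M B"
  shows "left_module R (M\<lparr>carrier := B\<rparr>)"
proof -
  interpret left_module R M by fact
  have cl: "x \<in> carrier M" if "x \<in> B" for x using assms(2) that by (auto simp: submod_def)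
  have "abelian_group (M\<lparr>carrier := B\<rparr>)"
  proof (rule abelian_groupI)
    fix x assume x: "x \<in> carrier (M\<lparr>carrier := B\<rparr>)"
    then show "\<exists>y\<in>carrier (M\<lparr>carrier := B\<rparr>). y \<oplus>\<^bsub>M\<lparr>carrier := B\<rparr>\<^esub> x = \<zero>\<^bsub>M\<lparr>carrier := B\<rparr>\<^esub>"
      using submod_neg[OF assms] cl by (intro bexI[of _ "\<ominus>\<^bsub>M\<^esub> x"]) (auto simp: M.l_neg)
  qed (use assms(2) cl in \<open>auto simp: submod_def M.a_ac\<close>)
  then show ?thesis
    using assms cl R.ring_axioms unfolding left_module_def left_module_axioms_def submod_def
    by auto
qed

lemma abelian_subgroup_submod:
  assumes "left_module R M" "submod R M B"
  shows "abelian_subgroup B M"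
proof -
  interpret left_module R M by fact
  show ?thesis
  proof (rule abelian_subgroupI3)
    show "additive_subgroup B M"
      using assms(2) submod_neg[OF assms] unfolding submod_def
      by (intro additive_subgroup.intro M.add.subgroupI) (auto simp: a_inv_def)
  qed (rule M.abelian_group_axioms)
qed

lemma quot_module_simps:
  assumes "left_module R M" "submod R M B"
  shows "carrier (quot_module M B) = (\<lambda>x. B +>\<^bsub>M\<^esub> x) ` carrier M"
    and "\<zero>\<^bsub>quot_module M B\<^esub> = B"
    and "x \<in> carrier M \<Longrightarrow> y \<in> carrier M \<Longrightarrow>
      (B +>\<^bsub>M\<^esub> x) \<oplus>\<^bsub>quot_module M B\<^esub> (B +>\<^bsub>M\<^esub> y) = B +>\<^bsub>M\<^esub> (x \<oplus>\<^bsub>M\<^esub> y)"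
    and "a \<in> carrier R \<Longrightarrow> x \<in> carrier M \<Longrightarrow>
      a \<odot>\<^bsub>quot_module M B\<^esub> (B +>\<^bsub>M\<^esub> x) = B +>\<^bsub>M\<^esub> (a \<odot>\<^bsub>M\<^esub> x)"
    and "x \<in> carrier M \<Longrightarrow> y \<in> carrier M \<Longrightarrow> B +>\<^bsub>M\<^esub> x = B +>\<^bsub>M\<^esub> y \<longleftrightarrow> x \<ominus>\<^bsub>M\<^esub> y \<in> B"
proof -
  interpret left_module R M by fact
  interpret abelian_subgroup B M by (rule abelian_subgroup_submod) fact+
  show "carrier (quot_module M B) = (\<lambda>x. B +>\<^bsub>M\<^esub> x) ` carrier M"
    by (auto simp: quot_module_def A_RCOSETS_def RCOSETS_def a_r_coset_def)
  show "\<zero>\<^bsub>quot_module M B\<^esub> = B" by (simp add: quot_module_def)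
  show "(B +>\<^bsub>M\<^esub> x) \<oplus>\<^bsub>quot_module M B\<^esub> (B +>\<^bsub>M\<^esub> y) = B +>\<^bsub>M\<^esub> (x \<oplus>\<^bsub>M\<^esub> y)"
    if "x \<in> carrier M" "y \<in> carrier M"
    using that by (simp add: quot_module_def a_rcos_sum)
  show eq: "B +>\<^bsub>M\<^esub> x = B +>\<^bsub>M\<^esub> y \<longleftrightarrow> x \<ominus>\<^bsub>M\<^esub> y \<in> B"
    if "x \<in> carrier M" "y \<in> carrier M" for x y
    using that a_rcos_module[of y x] a_repr_independence'[of x y] a_rcos_self[of x]
    by (auto simp: a_minus_def is_additive_subgroup)
  show "a \<odot>\<^bsub>quot_module M B\<^esub> (B +>\<^bsub>M\<^esub> x) = B +>\<^bsub>M\<^esub> (a \<odot>\<^bsub>M\<^esub> x)"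
    if a: "a \<in> carrier R" and x: "x \<in> carrier M"
  proof -
    \<comment> \<open>Scalar multiplication on the quotient is a union over all representatives; it
      collapses to a single coset because a (y - x) stays in \<open>B\<close>.\<close>
    have "B +>\<^bsub>M\<^esub> (a \<odot>\<^bsub>M\<^esub> y) = B +>\<^bsub>M\<^esub> (a \<odot>\<^bsub>M\<^esub> x)" if y: "y \<in> B +>\<^bsub>M\<^esub> x" for y
    proof -
      have yc: "y \<in> carrier M" using y x a_elemrcos_carrier by blast
      have "y \<ominus>\<^bsub>M\<^esub> x \<in> B" using a_rcos_module[OF x yc] y by (simp add: a_minus_def)
      then have "a \<odot>\<^bsub>M\<^esub> (y \<ominus>\<^bsub>M\<^esub> x) \<in> B" using assms(2) a by (simp add: submod_def)
      then show ?thesis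
        using a x yc by (simp add: eq smult_closed a_minus_def smult_r_distr smult_r_minus)
    qed
    moreover have "B +>\<^bsub>M\<^esub> x \<noteq> {}" using a_rcos_self[OF x] by blast
    ultimately show ?thesis by (auto simp: quot_module_def)
  qed
qed

lemma quot_module_trivial_iff:
  assumes "left_module R M" "submod R M B"
  shows "carrier (quot_module M B) = {\<zero>\<^bsub>quot_module M B\<^esub>} \<longleftrightarrow> carrier M \<subseteq> B"
proof -
  interpret left_module R M by fact
  interpret abelian_subgroup B M by (rule abelian_subgroup_submod) fact+
  note q = quot_module_simps[OF assms]
  have B0: "B +>\<^bsub>M\<^esub> \<zero>\<^bsub>M\<^esub> = B"
    using assms(2) by (intro M.a_coset_add_zero) (simp add: submod_def)
  have *: "B +>\<^bsub>M\<^esub> x = B \<longleftrightarrow> x \<in> B" if "x \<in> carrier M" for x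
    using q(5)[OF that M.zero_closed] that by (simp add: B0 M.a_minus_zero)
  show ?thesis unfolding q(1,2) using * by auto
qed

text \<open>The first isomorphism theorem as an equivalence. It replaces maps on cosets of cochains
  by maps on cocycles whose kernel consists of the coboundaries.\<close>

lemma quot_module_isomorphic_iff:
  assumes "left_module R M" "submod R M B" "left_module R N"
  shows "isomorphic_modules R (quot_module M B) N \<longleftrightarrow>
    (\<exists>f\<in>lhom R M N. f ` carrier M = carrier N \<and> (\<forall>x\<in>carrier M. f x = \<zero>\<^bsub>N\<^esub> \<longleftrightarrow> x \<in> B))"
proof -
  interpret left_module R M by fact
  interpret N: left_module R N by fact
  interpret abelian_subgroup B M by (rule abelian_subgroup_submod) fact+
  note q = quot_module_simps[OF assms(1,2)]
  let ?Q = "quot_module M B"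
  have B0: "B +>\<^bsub>M\<^esub> \<zero>\<^bsub>M\<^esub> = B"
    using assms(2) by (intro M.a_coset_add_zero) (simp add: submod_def)
  have *: "B +>\<^bsub>M\<^esub> x = B \<longleftrightarrow> x \<in> B" if "x \<in> carrier M" for x
    using q(5)[OF that M.zero_closed] that by (simp add: B0 M.a_minus_zero)
  show ?thesis
  proof
    assume "isomorphic_modules R ?Q N"
    then obtain F where F: "F \<in> lhom R ?Q N" and bij: "bij_betw F (carrier ?Q) (carrier N)"
      by (auto simp: isomorphic_modules_def)
    have cl: "B +>\<^bsub>M\<^esub> x \<in> carrier ?Q" if "x \<in> carrier M" for x using that by (auto simp: q(1))
    have Bc: "B \<in> carrier ?Q" using cl[OF M.zero_closed] by (simp add: B0)
    have F0: "F B = \<zero>\<^bsub>N\<^esub>"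
    proof -
      have "F (B +>\<^bsub>M\<^esub> (\<zero>\<^bsub>M\<^esub> \<oplus>\<^bsub>M\<^esub> \<zero>\<^bsub>M\<^esub>)) = F B \<oplus>\<^bsub>N\<^esub> F B"
        using lhomD(3)[OF F Bc Bc] q(3)[OF M.zero_closed M.zero_closed] by (simp add: B0)
      then show ?thesis using lhomD(2)[OF F Bc] by (simp add: B0)
    qed
    have "(\<lambda>x\<in>carrier M. F (B +>\<^bsub>M\<^esub> x)) \<in> lhom R M N"
      using lhomD(2-4)[OF F] cl
      by (intro lhom_restrictI assms(1)) (simp_all flip: q(3,4))
    moreover have "(\<lambda>x\<in>carrier M. F (B +>\<^bsub>M\<^esub> x)) ` carrier M = carrier N"
      using bij by (auto simp: bij_betw_def q(1))
    moreover have "F (B +>\<^bsub>M\<^esub> x) = \<zero>\<^bsub>N\<^esub> \<longleftrightarrow> x \<in> B" if "x \<in> carrier M" for x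
      using bij_betw_imp_inj_on[OF bij] cl[OF that] Bc F0 *[OF that] inj_onD by metis
    ultimately show "\<exists>f\<in>lhom R M N. f ` carrier M = carrier N \<and>
        (\<forall>x\<in>carrier M. f x = \<zero>\<^bsub>N\<^esub> \<longleftrightarrow> x \<in> B)"
      by (intro bexI[of _ "\<lambda>x\<in>carrier M. F (B +>\<^bsub>M\<^esub> x)"]) simp_all
  next
    assume "\<exists>f\<in>lhom R M N. f ` carrier M = carrier N \<and> (\<forall>x\<in>carrier M. f x = \<zero>\<^bsub>N\<^esub> \<longleftrightarrow> x \<in> B)"
    then obtain f where f: "f \<in> lhom R M N" and surj: "f ` carrier M = carrier N"
      and ker: "\<And>x. x \<in> carrier M \<Longrightarrow> f x = \<zero>\<^bsub>N\<^esub> \<longleftrightarrow> x \<in> B" by blast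
    \<comment> \<open>An arbitrary representative of the coset is evaluated; by \<open>eq\<close>
      below the value does not depend on it.\<close>
    define F where "F = (\<lambda>Y\<in>carrier ?Q. f (SOME x. x \<in> Y))"
    have eq: "f x = f y \<longleftrightarrow> x \<ominus>\<^bsub>M\<^esub> y \<in> B" if "x \<in> carrier M" "y \<in> carrier M" for x y
    proof -
      have "x \<ominus>\<^bsub>M\<^esub> y \<in> B \<longleftrightarrow> f x \<ominus>\<^bsub>N\<^esub> f y = \<zero>\<^bsub>N\<^esub>"
        using that by (simp add: lhom_minus[OF assms(1,3) f] flip: ker)
      then show ?thesis using N.M.minus_eq_zero_iff[OF lhomD(2)[OF f] lhomD(2)[OF f]] that by simp
    qed
    have F: "F (B +>\<^bsub>M\<^esub> x) = f x" if x: "x \<in> carrier M" for x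
    proof -
      have s: "(SOME y. y \<in> B +>\<^bsub>M\<^esub> x) \<in> B +>\<^bsub>M\<^esub> x"
        by (rule someI) (rule a_rcos_self[OF x])
      then have sc: "(SOME y. y \<in> B +>\<^bsub>M\<^esub> x) \<in> carrier M" using a_elemrcos_carrier x by blast
      have "(SOME y. y \<in> B +>\<^bsub>M\<^esub> x) \<ominus>\<^bsub>M\<^esub> x \<in> B"
        using a_rcos_module[OF x sc] s by (simp add: a_minus_def)
      then show ?thesis using x eq[OF sc x] by (simp add: F_def q(1))
    qed
    have "F \<in> lhom R ?Q N"
    proof (rule lhomI)
      show "F \<in> carrier ?Q \<rightarrow>\<^sub>E carrier N"
        using F lhomD(2)[OF f] by (auto simp: q(1)) (auto simp: F_def q(1))
    qed (auto simp: q(1,3,4) F lhomD(3,4)[OF f] smult_closed)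
    moreover have "bij_betw F (carrier ?Q) (carrier N)"
      unfolding bij_betw_def
    proof
      show "inj_on F (carrier ?Q)" unfolding q(1) by (rule inj_onI) (elim imageE, simp add: F eq q(5))
      show "F ` carrier ?Q = carrier N" using surj F by (auto simp: q(1) image_image)
    qed
    ultimately show "isomorphic_modules R ?Q N" by (auto simp: isomorphic_modules_def)
  qed
qed

subsection \<open>Independence of cohomology from the resolution\<close>

lemma field_ring_simps [simp]:
  "carrier field_ring = UNIV" "monoid.mult field_ring = (*)" "one field_ring = 1"
  "ring.zero field_ring = 0" "add field_ring = (+)"
  by (simp_all add: field_ring_def)

lemma regular_module_simps [simp]:
  "carrier (regular_module R) = carrier R" "ring.zero (regular_module R) = \<zero>\<^bsub>R\<^esub>"
  "add (regular_module R) = add R" "module.smult (regular_module R) = monoid.mult R"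
  by (simp_all add: regular_module_def)

lemma ring_field_ring: "ring (field_ring :: 'k::field ring)"
proof (rule ringI)
  show "abelian_group (field_ring :: 'k ring)"
    by (rule abelian_groupI) (auto simp: add.assoc add.commute intro: exI[of _ "- _"] left_minus)
  show "monoid (field_ring :: 'k ring)"
    by (rule monoidI) (auto simp: mult.assoc)
qed (auto simp: distrib_left distrib_right)

lemma left_module_regular:
  assumes "ring R" shows "left_module R (regular_module R)"
proof -
  interpret ring R by fact
  have "abelian_group (regular_module R)"
    by (rule abelian_groupI) (auto simp: a_ac intro: add.l_inv_ex)
  then show ?thesis
    unfolding left_module_def left_module_axioms_def
    by (simp add: ring_axioms l_distr r_distr m_assoc)
qed

text \<open>The ground field acts on Hom through the elements c 1. That they are central is what
  keeps \<open>c \<odot> f\<close> linear over a noncommutative \<open>A\<close>.\<close>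

locale field_algebra = ring A for A :: "('k::field, 'a) module" (structure) +
  assumes scal_closed: "c \<odot> \<one> \<in> carrier A"
    and scal_add: "(c + d) \<odot> \<one> = (c \<odot> \<one>) \<oplus> (d \<odot> \<one>)"
    and scal_mult: "(c * d) \<odot> \<one> = (c \<odot> \<one>) \<otimes> (d \<odot> \<one>)"
    and scal_one: "1 \<odot> \<one> = \<one>"
    and scal_central: "a \<in> carrier A \<Longrightarrow> (c \<odot> \<one>) \<otimes> a = a \<otimes> (c \<odot> \<one>)"
begin

lemma hom_module_simps [simp]:
  "carrier (hom_module A M N) = lhom A M N"
  "\<zero>\<^bsub>hom_module A M N\<^esub> = (\<lambda>x\<in>carrier M. \<zero>\<^bsub>N\<^esub>)"
  "f \<oplus>\<^bsub>hom_module A M N\<^esub> g = (\<lambda>x\<in>carrier M. f x \<oplus>\<^bsub>N\<^esub> g x)"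
  "c \<odot>\<^bsub>hom_module A M N\<^esub> f = (\<lambda>x\<in>carrier M. (c \<odot> \<one>) \<odot>\<^bsub>N\<^esub> f x)"
  by (simp_all add: hom_module_def)

lemma lhom_zero_map:
  assumes "left_module A M" "left_module A N"
  shows "(\<lambda>x\<in>carrier M. \<zero>\<^bsub>N\<^esub>) \<in> lhom A M N"
proof -
  interpret N: left_module A N by fact
  show ?thesis by (rule lhom_restrictI[OF assms(1)]) (simp_all add: N.smult_r_null)
qed

lemma lhom_lincomb:
  assumes "left_module A M" "left_module A N" "f \<in> lhom A M N"
  shows "g \<in> lhom A M N \<Longrightarrow> (\<lambda>x\<in>carrier M. f x \<oplus>\<^bsub>N\<^esub> g x) \<in> lhom A M N"
    and "(\<lambda>x\<in>carrier M. \<ominus>\<^bsub>N\<^esub> f x) \<in> lhom A M N"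
    and "(\<lambda>x\<in>carrier M. (c \<odot> \<one>) \<odot>\<^bsub>N\<^esub> f x) \<in> lhom A M N"
proof -
  interpret N: left_module A N by fact
  note f = lhomD[OF assms(3)]
  show "(\<lambda>x\<in>carrier M. f x \<oplus>\<^bsub>N\<^esub> g x) \<in> lhom A M N" if "g \<in> lhom A M N"
    using lhomD[OF that]
    by (intro lhom_restrictI[OF assms(1)]) (simp_all add: f N.smult_r_distr N.M.a_ac)
  show "(\<lambda>x\<in>carrier M. \<ominus>\<^bsub>N\<^esub> f x) \<in> lhom A M N"
    by (rule lhom_restrictI[OF assms(1)]) (simp_all add: f N.smult_r_minus N.M.minus_add)
  show "(\<lambda>x\<in>carrier M. (c \<odot> \<one>) \<odot>\<^bsub>N\<^esub> f x) \<in> lhom A M N"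
    by (rule lhom_restrictI[OF assms(1)])
      (simp_all add: f N.smult_r_distr N.smult_closed scal_closed scal_central flip: N.smult_assoc)
qed

lemma left_module_hom:
  assumes "left_module A M" "left_module A N"
  shows "left_module field_ring (hom_module A M N)"
proof -
  interpret N: left_module A N by fact
  note lc = lhom_lincomb[OF assms] lhom_zero_map[OF assms]
  have "abelian_group (hom_module A M N)"
  proof (rule abelian_groupI)
    fix f g h assume "f \<in> carrier (hom_module A M N)" "g \<in> carrier (hom_module A M N)"
      "h \<in> carrier (hom_module A M N)"
    then show "(f \<oplus>\<^bsub>hom_module A M N\<^esub> g) \<oplus>\<^bsub>hom_module A M N\<^esub> h =
        f \<oplus>\<^bsub>hom_module A M N\<^esub> (g \<oplus>\<^bsub>hom_module A M N\<^esub> h)"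
      by (auto simp: lhomD(2) N.M.a_assoc)
  next
    fix f assume f: "f \<in> carrier (hom_module A M N)"
    then have "(\<lambda>x\<in>carrier M. \<zero>\<^bsub>N\<^esub> \<oplus>\<^bsub>N\<^esub> f x) = f"
      using lhomD(1,2)[of f A M N] by (intro PiE_ext[of _ _ "\<lambda>_. carrier N"]) auto
    then show "\<zero>\<^bsub>hom_module A M N\<^esub> \<oplus>\<^bsub>hom_module A M N\<^esub> f = f"
      by (simp cong: restrict_cong)
    show "\<exists>g\<in>carrier (hom_module A M N). g \<oplus>\<^bsub>hom_module A M N\<^esub> f = \<zero>\<^bsub>hom_module A M N\<^esub>"
      using f by (intro bexI[of _ "\<lambda>x\<in>carrier M. \<ominus>\<^bsub>N\<^esub> f x"]) (auto simp: lc lhomD(2) N.M.l_neg)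
  qed (auto simp: lc lhomD(2) intro!: restrict_ext N.M.a_comm)
  moreover have "(\<lambda>x\<in>carrier M. (1 \<odot> \<one>) \<odot>\<^bsub>N\<^esub> f x) = f" if "f \<in> lhom A M N" for f
    using that by (intro lhom_ext[OF lc(3)[OF that] that]) (simp add: scal_one N.smult_one lhomD(2))
  ultimately show ?thesis
    unfolding left_module_def left_module_axioms_def
    by (auto simp: ring_field_ring lc lhomD(2) scal_closed scal_add scal_mult N.smult_l_distr
        N.smult_r_distr N.smult_assoc N.smult_closed)
qed

lemma hom_module_minus:
  assumes "left_module A M" "left_module A N" "f \<in> lhom A M N" "g \<in> lhom A M N"
  shows "f \<ominus>\<^bsub>hom_module A M N\<^esub> g = (\<lambda>x\<in>carrier M. f x \<ominus>\<^bsub>N\<^esub> g x)"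
proof -
  interpret N: left_module A N by fact
  interpret H: left_module field_ring "hom_module A M N" by (rule left_module_hom) fact+
  have "\<ominus>\<^bsub>hom_module A M N\<^esub> g = (\<lambda>x\<in>carrier M. \<ominus>\<^bsub>N\<^esub> g x)"
    using assms by (intro H.M.minus_equality) (auto simp: lhom_lincomb lhomD(2) N.M.l_neg)
  then show ?thesis by (auto simp: a_minus_def)
qed

end

locale hom_complex = field_algebra A for A :: "('k::field, 'a) module" (structure) +
  fixes M :: "('a, 'm) module" and P :: "nat \<Rightarrow> ('a, 'p) module" and d e
    and N :: "('a, 'c) module"
  assumes res: "projective_resolution A M P d e" and N: "left_module A N"
begin

abbreviation "Z n \<equiv> hom_cocycles A P d N n"
abbreviation "B n \<equiv> hom_coboundaries A P d N n"
abbreviation "H n \<equiv> hom_module A (P n) N"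

lemmas PD = projective_resolutionD[OF res]

sublocale N: left_module A N by (rule N)

lemma d_closed: "x \<in> carrier (P (Suc n)) \<Longrightarrow> d n x \<in> carrier (P n)"
  by (rule lhomD(2)[OF PD(3)])

lemma left_module_H: "left_module field_ring (H n)"
  by (rule left_module_hom[OF PD(2) N])

lemma Z_iff: "f \<in> Z n \<longleftrightarrow> f \<in> lhom A (P n) N \<and> (\<forall>x\<in>carrier (P (Suc n)). f (d n x) = \<zero>\<^bsub>N\<^esub>)"
  by (simp add: hom_cocycles_def)

lemma submod_Z: "submod field_ring (H n) (Z n)"
  unfolding submod_def
  using lhom_lincomb(1,3)[OF PD(2) N] lhom_zero_map[OF PD(2) N]
  by (auto simp: Z_iff d_closed N.smult_r_null scal_closed)

lemma submod_B: "submod field_ring (H n) (B n)"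
proof (cases n)
  case 0
  then show ?thesis
    using lhom_zero_map[OF PD(2) N]
    by (auto simp: submod_def N.smult_r_null scal_closed intro!: restrict_ext)
next
  case (Suc m)
  note lc = lhom_lincomb(1,3)[OF PD(2) N]
  show ?thesis
    unfolding submod_def Suc hom_coboundaries.simps hom_module_simps
  proof (intro conjI ballI)
    let ?b = "\<lambda>g. \<lambda>x\<in>carrier (P (Suc m)). g (d m x)"
    show "?b ` lhom A (P m) N \<subseteq> lhom A (P (Suc m)) N"
      using lhom_compose[OF PD(2) PD(3)] by auto
    show "(\<lambda>x\<in>carrier (P (Suc m)). \<zero>\<^bsub>N\<^esub>) \<in> ?b ` lhom A (P m) N"
      by (rule image_eqI[OF _ lhom_zero_map[OF PD(2) N]]) (auto simp: d_closed)
    fix u assume "u \<in> ?b ` lhom A (P m) N"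
    then obtain f where f: "f \<in> lhom A (P m) N" "u = ?b f" by blast
    show "(\<lambda>x\<in>carrier (P (Suc m)). (c \<odot> \<one>) \<odot>\<^bsub>N\<^esub> u x) \<in> ?b ` lhom A (P m) N" for c
      by (rule image_eqI[OF _ lc(2)[OF f(1), of c]]) (auto simp: f(2) d_closed)
    fix v assume "v \<in> ?b ` lhom A (P m) N"
    then obtain g where g: "g \<in> lhom A (P m) N" "v = ?b g" by blast
    show "(\<lambda>x\<in>carrier (P (Suc m)). u x \<oplus>\<^bsub>N\<^esub> v x) \<in> ?b ` lhom A (P m) N"
      by (rule image_eqI[OF _ lc(1)[OF f(1) g(1)]]) (auto simp: f(2) g(2) d_closed)
  qed
qed

lemma B_SucI:
  assumes "g \<in> lhom A (P m) N" "\<And>x. x \<in> carrier (P (Suc m)) \<Longrightarrow> w x = g (d m x)"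
  shows "(\<lambda>x\<in>carrier (P (Suc m)). w x) \<in> B (Suc m)"
  using assms by (auto intro!: image_eqI[of _ _ g] restrict_ext)

lemma B_subset_Z: "B n \<subseteq> Z n"
proof (cases n)
  case 0
  then show ?thesis using submod_Z[of 0] by (simp add: submod_def)
next
  case (Suc m)
  then show ?thesis
    using lhom_compose[OF PD(2) PD(3)] resolution_d_d[OF res] lhom_zero[OF PD(2) N]
    by (auto simp: Z_iff d_closed)
qed

abbreviation "HZ n \<equiv> (H n)\<lparr>carrier := Z n\<rparr>"

lemma left_module_HZ: "left_module field_ring (HZ n)"
  by (rule left_module_submod[OF left_module_H submod_Z])

lemma submod_HZ_B: "submod field_ring (HZ n) (B n)"
  using submod_B B_subset_Z by (auto simp: submod_def)

lemma cohomology_trivial_iff: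
  "carrier (hom_cohomology A P d N n) = {\<zero>\<^bsub>hom_cohomology A P d N n\<^esub>} \<longleftrightarrow> Z n \<subseteq> B n"
  unfolding hom_cohomology_def
  using quot_module_trivial_iff[OF left_module_HZ submod_HZ_B] by simp

lemma cohomology_isomorphic_iff:
  assumes "left_module field_ring V"
  shows "isomorphic_modules field_ring (hom_cohomology A P d N n) V \<longleftrightarrow>
    (\<exists>f\<in>lhom field_ring (HZ n) V. f ` Z n = carrier V \<and> (\<forall>x\<in>Z n. f x = \<zero>\<^bsub>V\<^esub> \<longleftrightarrow> x \<in> B n))"
  unfolding hom_cohomology_def
  using quot_module_isomorphic_iff[OF left_module_HZ submod_HZ_B assms] by simp

lemma HZ_minus: "f \<in> Z n \<Longrightarrow> g \<in> Z n \<Longrightarrow> f \<ominus>\<^bsub>HZ n\<^esub> g = (\<lambda>x\<in>carrier (P n). f x \<ominus>\<^bsub>N\<^esub> g x)"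
proof -
  assume fg: "f \<in> Z n" "g \<in> Z n"
  interpret HZ: left_module field_ring "HZ n" by (rule left_module_HZ)
  have g: "g \<in> lhom A (P n) N" using fg by (simp add: Z_iff)
  have "(\<lambda>x\<in>carrier (P n). \<ominus>\<^bsub>N\<^esub> g x) \<in> Z n"
    using fg lhom_lincomb(2)[OF PD(2) N g] by (auto simp: Z_iff d_closed)
  then have "\<ominus>\<^bsub>HZ n\<^esub> g = (\<lambda>x\<in>carrier (P n). \<ominus>\<^bsub>N\<^esub> g x)"
    using fg g by (intro HZ.M.minus_equality) (auto simp: lhomD(2) N.M.l_neg)
  then show ?thesis by (auto simp: a_minus_def)
qed

text \<open>With f - id = d h + h d, a cocycle \<open>z\<close> annihilates the d h term, and what
  remains is z h composed with d, a coboundary. In degree 0 only the first term exists and the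
  difference is zero.\<close>

lemma chain_map_homotopic_B:
  assumes M: "left_module A M" and f: "chain_map A P d e P d e f" and z: "z \<in> Z n"
  shows "(\<lambda>x\<in>carrier (P n). z (f n x) \<ominus>\<^bsub>N\<^esub> z x) \<in> B n"
proof -
  obtain h where h: "\<And>n. h n \<in> lhom A (P n) (P (Suc n))"
    and h0: "\<And>x. x \<in> carrier (P 0) \<Longrightarrow> d 0 (h 0 x) = f 0 x \<ominus>\<^bsub>P 0\<^esub> x"
    and hS: "\<And>n x. x \<in> carrier (P (Suc n)) \<Longrightarrow>
      d (Suc n) (h (Suc n) x) = (f (Suc n) x \<ominus>\<^bsub>P (Suc n)\<^esub> x) \<ominus>\<^bsub>P (Suc n)\<^esub> h n (d n x)"
    using chain_map_homotopy[OF res M f] by blast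
  have zl: "z \<in> lhom A (P n) N" and zd: "\<And>x. x \<in> carrier (P (Suc n)) \<Longrightarrow> z (d n x) = \<zero>\<^bsub>N\<^esub>"
    using z by (auto simp: Z_iff)
  note zm = lhom_minus[OF PD(2) N zl] and fc = lhomD(2)[OF chain_mapD(1)[OF f]] and hc = lhomD(2)[OF h]
  have mc: "x \<ominus>\<^bsub>P n\<^esub> y \<in> carrier (P n)" if "x \<in> carrier (P n)" "y \<in> carrier (P n)" for x y n
    using abelian_group.minus_closed[OF left_moduleD(2)[OF PD(2)] that] .
  show ?thesis
  proof (cases n)
    case 0
    have "z (f n x) \<ominus>\<^bsub>N\<^esub> z x = \<zero>\<^bsub>N\<^esub>" if "x \<in> carrier (P n)" for x
      using zm[OF fc that] that zd[OF hc] h0[of x] 0 by force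
    then show ?thesis using 0 by auto
  next
    case (Suc m)
    have "z (f n x) \<ominus>\<^bsub>N\<^esub> z x = z (h m (d m x))" if x: "x \<in> carrier (P (Suc m))" for x
    proof -
      have x': "x \<in> carrier (P n)" using x Suc by simp
      have hd: "h m (d m x) \<in> carrier (P n)" using hc[OF d_closed[OF x]] Suc by simp
      have "\<zero>\<^bsub>N\<^esub> = z ((f n x \<ominus>\<^bsub>P n\<^esub> x) \<ominus>\<^bsub>P n\<^esub> h m (d m x))"
        using zd[OF hc[OF x']] hS[OF x] Suc by simp
      also have "\<dots> = (z (f n x) \<ominus>\<^bsub>N\<^esub> z x) \<ominus>\<^bsub>N\<^esub> z (h m (d m x))"
        using x' hd fc[OF x'] by (simp add: zm mc)
      finally show ?thesis
        using N.M.minus_eq_zero_iff[of "z (f n x) \<ominus>\<^bsub>N\<^esub> z x" "z (h m (d m x))"]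
          lhomD(2)[OF zl] x' hd fc[OF x'] by (metis N.M.minus_closed)
    qed
    moreover have "(\<lambda>x\<in>carrier (P m). z (h m x)) \<in> lhom A (P m) N"
      using lhom_compose[OF PD(2) h] zl Suc by blast
    ultimately show ?thesis
      using B_SucI[of "\<lambda>x\<in>carrier (P m). z (h m x)" m "\<lambda>x. z (f n x) \<ominus>\<^bsub>N\<^esub> z x"]
      by (simp add: d_closed Suc)
  qed
qed

end

lemma pullback_cocycles:
  assumes P: "hom_complex A M P d e N" and Q: "hom_complex A M Q d' e' N"
    and g: "chain_map A Q d' e' P d e g"
  shows "z \<in> hom_cocycles A P d N n \<Longrightarrow>
      (\<lambda>y\<in>carrier (Q n). z (g n y)) \<in> hom_cocycles A Q d' N n"
    and "z \<in> hom_coboundaries A P d N n \<Longrightarrow>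
      (\<lambda>y\<in>carrier (Q n). z (g n y)) \<in> hom_coboundaries A Q d' N n"
proof -
  interpret P: hom_complex A M P d e N by fact
  interpret Q: hom_complex A M Q d' e' N by fact
  note gD = chain_mapD[OF g] and gc = lhomD(2)[OF chain_mapD(1)[OF g]]
  show "(\<lambda>y\<in>carrier (Q n). z (g n y)) \<in> hom_cocycles A Q d' N n"
    if "z \<in> hom_cocycles A P d N n"
    using that lhom_compose[OF Q.PD(2) gD(1)] gc
    by (auto simp: P.Z_iff Q.Z_iff Q.d_closed simp flip: gD(3))
  show "(\<lambda>y\<in>carrier (Q n). z (g n y)) \<in> hom_coboundaries A Q d' N n"
    if "z \<in> hom_coboundaries A P d N n"
  proof (cases n)
    case 0
    then show ?thesis using that gc by auto
  next
    case (Suc m)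
    with that obtain w where w: "w \<in> lhom A (P m) N" and z: "z = (\<lambda>x\<in>carrier (P n). w (d m x))"
      by auto
    show ?thesis
      unfolding Suc
    proof (rule Q.B_SucI[OF lhom_compose[OF Q.PD(2) gD(1) w]])
      fix y assume y: "y \<in> carrier (Q (Suc m))"
      then show "z (g (Suc m) y) = (\<lambda>y\<in>carrier (Q m). w (g m y)) (d' m y)"
        using gc[OF y] gD(3)[OF y] Q.d_closed[OF y] Suc by (simp add: z)
    qed
  qed
qed

text \<open>\<open>G\<close> is precomposition with a chain map. Being an isomorphism on cohomology
  is expressed on cocycles: coboundaries are preserved and reflected, and every cocycle of the
  target is hit up to a coboundary.\<close>

lemma cohomology_comparison:
  assumes P: "hom_complex A M P d e N" and Q: "hom_complex A M Q d' e' N" and M: "left_module A M"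
  shows "\<exists>G\<in>lhom field_ring ((hom_module A (P n) N)\<lparr>carrier := hom_cocycles A P d N n\<rparr>)
      ((hom_module A (Q n) N)\<lparr>carrier := hom_cocycles A Q d' N n\<rparr>).
    (\<forall>z\<in>hom_cocycles A P d N n.
      z \<in> hom_coboundaries A P d N n \<longleftrightarrow> G z \<in> hom_coboundaries A Q d' N n) \<and>
    (\<forall>w\<in>hom_cocycles A Q d' N n. \<exists>z\<in>hom_cocycles A P d N n.
      (\<lambda>y\<in>carrier (Q n). G z y \<ominus>\<^bsub>N\<^esub> w y) \<in> hom_coboundaries A Q d' N n)"
proof -
  interpret P: hom_complex A M P d e N by fact
  interpret Q: hom_complex A M Q d' e' N by fact
  obtain f where f: "chain_map A P d e Q d' e' f" using chain_map_exists[OF P.res Q.res M] ..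
  obtain g where g: "chain_map A Q d' e' P d e g" using chain_map_exists[OF Q.res P.res M] ..
  note gc = lhomD(2)[OF chain_mapD(1)[OF g]] and fc = lhomD(2)[OF chain_mapD(1)[OF f]]
  define G where "G = (\<lambda>z\<in>P.Z n. \<lambda>y\<in>carrier (Q n). z (g n y))"
  have zc: "z x \<in> carrier N" if "z \<in> P.Z n" "x \<in> carrier (P n)" for z x
    using that by (auto simp: P.Z_iff lhomD(2))
  have G: "G \<in> lhom field_ring (P.HZ n) (Q.HZ n)"
  proof -
    have "(\<lambda>z\<in>carrier (P.HZ n). \<lambda>y\<in>carrier (Q n). z (g n y)) \<in> lhom field_ring (P.HZ n) (Q.HZ n)"
      by (rule lhom_restrictI[OF P.left_module_HZ])
        (auto simp: gc pullback_cocycles(1)[OF P Q g] intro!: restrict_ext)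
    then show ?thesis by (simp add: G_def)
  qed
  have "z \<in> P.B n" if z: "z \<in> P.Z n" "G z \<in> Q.B n" for z
  proof -
    have 1: "(\<lambda>x\<in>carrier (P n). G z (f n x)) \<in> P.B n"
      by (rule pullback_cocycles(2)[OF Q P f z(2)])
    have 2: "(\<lambda>x\<in>carrier (P n). z (g n (f n x)) \<ominus>\<^bsub>N\<^esub> z x) \<in> P.B n"
    proof -
      have "(\<lambda>x\<in>carrier (P n). z ((\<lambda>x\<in>carrier (P n). g n (f n x)) x) \<ominus>\<^bsub>N\<^esub> z x) \<in> P.B n"
        by (rule P.chain_map_homotopic_B[OF M chain_map_compose[OF f g P.res] z(1)])
      then show ?thesis by (simp cong: restrict_cong)
    qed
    \<comment> \<open>The cocycle \<open>z\<close> is recovered as z g f - (z g f - z). The first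
      term is the pullback of a coboundary, the second is a coboundary by homotopy.\<close>
    have "(\<lambda>x\<in>carrier (P n). G z (f n x)) \<ominus>\<^bsub>P.H n\<^esub> (\<lambda>x\<in>carrier (P n). z (g n (f n x)) \<ominus>\<^bsub>N\<^esub> z x) \<in> P.B n"
      by (rule submod_minus[OF P.left_module_H P.submod_B 1 2])
    moreover have "(\<lambda>x\<in>carrier (P n). G z (f n x)) \<ominus>\<^bsub>P.H n\<^esub> (\<lambda>x\<in>carrier (P n). z (g n (f n x)) \<ominus>\<^bsub>N\<^esub> z x) =
        (\<lambda>x\<in>carrier (P n). G z (f n x) \<ominus>\<^bsub>N\<^esub> (z (g n (f n x)) \<ominus>\<^bsub>N\<^esub> z x))"
      using 1 2 P.submod_B[of n]
      by (subst P.hom_module_minus[OF P.PD(2) P.N]) (auto simp: submod_def)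
    moreover have "\<dots> = z"
    proof (rule PiE_ext)
      show "z \<in> carrier (P n) \<rightarrow>\<^sub>E carrier N" using z(1) lhomD(1) unfolding P.Z_iff by blast
      show "(\<lambda>x\<in>carrier (P n). G z (f n x) \<ominus>\<^bsub>N\<^esub> (z (g n (f n x)) \<ominus>\<^bsub>N\<^esub> z x)) \<in>
          carrier (P n) \<rightarrow>\<^sub>E carrier N"
        using z(1) by (auto simp: G_def fc gc zc)
    next
      fix x assume x: "x \<in> carrier (P n)"
      have "a \<ominus>\<^bsub>N\<^esub> (a \<ominus>\<^bsub>N\<^esub> b) = b" if "a \<in> carrier N" "b \<in> carrier N" for a b
        using that by (simp add: a_minus_def P.N.M.minus_add P.N.M.r_neg flip: P.N.M.a_assoc)
      then show "(\<lambda>x\<in>carrier (P n). G z (f n x) \<ominus>\<^bsub>N\<^esub> (z (g n (f n x)) \<ominus>\<^bsub>N\<^esub> z x)) x = z x"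
        using x z(1) by (simp add: G_def fc gc zc)
    qed
    ultimately show ?thesis by simp
  qed
  moreover have "G z \<in> Q.B n" if "z \<in> P.B n" for z
    using that pullback_cocycles(2)[OF P Q g that] P.B_subset_Z by (auto simp: G_def)
  moreover have "\<exists>z\<in>P.Z n. (\<lambda>y\<in>carrier (Q n). G z y \<ominus>\<^bsub>N\<^esub> w y) \<in> Q.B n" if w: "w \<in> Q.Z n" for w
  proof
    let ?z = "\<lambda>x\<in>carrier (P n). w (f n x)"
    show z: "?z \<in> P.Z n" by (rule pullback_cocycles(1)[OF Q P f w])
    have "(\<lambda>y\<in>carrier (Q n). w ((\<lambda>x\<in>carrier (Q n). f n (g n x)) y) \<ominus>\<^bsub>N\<^esub> w y) \<in> Q.B n"
      by (rule Q.chain_map_homotopic_B[OF M chain_map_compose[OF g f Q.res] w])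
    then show "(\<lambda>y\<in>carrier (Q n). G ?z y \<ominus>\<^bsub>N\<^esub> w y) \<in> Q.B n"
      using z by (simp add: G_def gc cong: restrict_cong)
  qed
  ultimately show ?thesis using G by blast
qed

lemma cohomology_trivial_transfer:
  assumes P: "hom_complex A M P d e N" and Q: "hom_complex A M Q d' e' N" and M: "left_module A M"
    and "hom_cocycles A Q d' N n \<subseteq> hom_coboundaries A Q d' N n"
  shows "hom_cocycles A P d N n \<subseteq> hom_coboundaries A P d N n"
proof (rule subsetI)
  fix z assume z: "z \<in> hom_cocycles A P d N n"
  obtain G where G: "G \<in> lhom field_ring ((hom_module A (P n) N)\<lparr>carrier := hom_cocycles A P d N n\<rparr>)
      ((hom_module A (Q n) N)\<lparr>carrier := hom_cocycles A Q d' N n\<rparr>)"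
    and GB: "\<forall>z\<in>hom_cocycles A P d N n.
      z \<in> hom_coboundaries A P d N n \<longleftrightarrow> G z \<in> hom_coboundaries A Q d' N n"
    using cohomology_comparison[OF P Q M, of n] by (elim bexE conjE) (rule that; assumption)
  have "G z \<in> hom_cocycles A Q d' N n" using lhomD(2)[OF G, of z] z by simp
  then have "G z \<in> hom_coboundaries A Q d' N n" by (rule subsetD[OF assms(4)])
  then show "z \<in> hom_coboundaries A P d N n" using bspec[OF GB z] by simp
qed

lemma cohomology_isomorphic_transfer:
  assumes P: "hom_complex A M P d e N" and Q: "hom_complex A M Q d' e' N" and M: "left_module A M"
    and V: "left_module field_ring V"
    and iso: "isomorphic_modules field_ring (hom_cohomology A Q d' N n) V"
  shows "isomorphic_modules field_ring (hom_cohomology A P d N n) V"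
proof -
  interpret P: hom_complex A M P d e N by fact
  interpret Q: hom_complex A M Q d' e' N by fact
  interpret V: left_module field_ring V by fact
  obtain f where f: "f \<in> lhom field_ring (Q.HZ n) V" "f ` Q.Z n = carrier V"
    and fk: "\<forall>x\<in>Q.Z n. f x = \<zero>\<^bsub>V\<^esub> \<longleftrightarrow> x \<in> Q.B n"
    using iso[unfolded Q.cohomology_isomorphic_iff[OF V]] by (elim bexE conjE) (rule that; assumption)
  obtain G where G: "G \<in> lhom field_ring (P.HZ n) (Q.HZ n)"
    and GB: "\<forall>z\<in>P.Z n. z \<in> P.B n \<longleftrightarrow> G z \<in> Q.B n"
    and Gs: "\<forall>w\<in>Q.Z n. \<exists>z\<in>P.Z n. (\<lambda>y\<in>carrier (Q n). G z y \<ominus>\<^bsub>N\<^esub> w y) \<in> Q.B n"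
    using cohomology_comparison[OF P Q M, of n] by (elim bexE conjE) (rule that; assumption)
  have Gc: "G z \<in> Q.Z n" if "z \<in> P.Z n" for z using lhomD(2)[OF G, of z] that by simp
  have fc: "f w \<in> carrier V" if "w \<in> Q.Z n" for w using lhomD(2)[OF f(1), of w] that by simp
  have "carrier V \<subseteq> (\<lambda>z\<in>P.Z n. f (G z)) ` P.Z n"
  proof (rule subsetI)
    fix v assume "v \<in> carrier V"
    then obtain w where w: "w \<in> Q.Z n" "v = f w" using f(2) by auto
    obtain z where z: "z \<in> P.Z n" "(\<lambda>y\<in>carrier (Q n). G z y \<ominus>\<^bsub>N\<^esub> w y) \<in> Q.B n"
      using bspec[OF Gs w(1)] by (rule bexE)
    then have "f (G z \<ominus>\<^bsub>Q.HZ n\<^esub> w) = \<zero>\<^bsub>V\<^esub>"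
      using fk subsetD[OF Q.B_subset_Z z(2)] by (simp add: Q.HZ_minus[OF Gc w(1)])
    then have "f (G z) \<ominus>\<^bsub>V\<^esub> f w = \<zero>\<^bsub>V\<^esub>"
      using lhom_minus[OF Q.left_module_HZ V f(1), of "G z" w] Gc[OF z(1)] w(1) by simp
    then have "f (G z) = f w" using V.M.minus_eq_zero_iff fc Gc z(1) w(1) by simp
    then show "v \<in> (\<lambda>z\<in>P.Z n. f (G z)) ` P.Z n"
      using w(2) z(1) by (intro image_eqI[OF _ z(1)]) simp
  qed
  moreover have "(\<lambda>z\<in>P.Z n. f (G z)) \<in> lhom field_ring (P.HZ n) V"
    using lhom_compose[OF P.left_module_HZ G f(1)] by simp
  moreover have "f (G z) = \<zero>\<^bsub>V\<^esub> \<longleftrightarrow> z \<in> P.B n" if "z \<in> P.Z n" for z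
    using fk Gc[OF that] GB that by simp
  moreover have "(\<lambda>z\<in>P.Z n. f (G z)) ` P.Z n \<subseteq> carrier V" using fc Gc by auto
  ultimately show ?thesis
    unfolding P.cohomology_isomorphic_iff[OF V]
    by (intro bexI[of _ "\<lambda>z\<in>P.Z n. f (G z)"] conjI) simp_all
qed

text \<open>One resolution on the type \<open>'p\<close> is enough to know that the choice operator
  in \<open>Ext\<close> returns a genuine resolution, though an unknown one.\<close>

lemma (in field_algebra) Ext_eq_cohomology:
  fixes P :: "nat \<Rightarrow> ('a, 'p) module"
  assumes "projective_resolution A M P d e" "left_module A N"
  obtains Q :: "nat \<Rightarrow> ('a, 'p) module" and d' e' where "hom_complex A M Q d' e' N"
    "\<And>n. Ext TYPE('p) A M N n = hom_cohomology A Q d' N n"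
proof -
  define T where "T = (SOME (P :: nat \<Rightarrow> ('a, 'p) module, d, e). projective_resolution A M P d e)"
  obtain Q d' e' where T: "T = (Q, d', e')" by (cases T)
  have "case T of (P, d, e) \<Rightarrow> projective_resolution A M P d e"
    unfolding T_def by (rule someI[of _ "(P, d, e)"]) (simp add: assms(1))
  then have "hom_complex A M Q d' e' N"
    using assms(2) by (intro hom_complex.intro field_algebra_axioms hom_complex_axioms.intro)
      (simp_all add: T)
  moreover have "Ext TYPE('p) A M N n = hom_cohomology A Q d' N n" for n
    unfolding Ext_def T_def[symmetric] by (simp add: T)
  ultimately show ?thesis by (rule that)
qed

lemma (in hom_complex) Ext_trivial_iff:
  assumes "left_module A M"
  shows "carrier (Ext TYPE('p) A M N n) = {\<zero>\<^bsub>Ext TYPE('p) A M N n\<^esub>} \<longleftrightarrow> Z n \<subseteq> B n"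
proof -
  obtain Q :: "nat \<Rightarrow> ('a, 'p) module" and d' e' where Q: "hom_complex A M Q d' e' N"
    and E: "\<And>n. Ext TYPE('p) A M N n = hom_cohomology A Q d' N n"
    using Ext_eq_cohomology[OF res N] by blast
  show ?thesis
    unfolding E hom_complex.cohomology_trivial_iff[OF Q]
    using cohomology_trivial_transfer[OF Q hom_complex_axioms assms]
      cohomology_trivial_transfer[OF hom_complex_axioms Q assms] by blast
qed

lemma (in hom_complex) Ext_isomorphic_iff:
  assumes "left_module A M" "left_module field_ring V"
  shows "isomorphic_modules field_ring (Ext TYPE('p) A M N n) V \<longleftrightarrow>
    (\<exists>f\<in>lhom field_ring (HZ n) V. f ` Z n = carrier V \<and> (\<forall>x\<in>Z n. f x = \<zero>\<^bsub>V\<^esub> \<longleftrightarrow> x \<in> B n))"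
proof -
  obtain Q :: "nat \<Rightarrow> ('a, 'p) module" and d' e' where Q: "hom_complex A M Q d' e' N"
    and E: "\<And>n. Ext TYPE('p) A M N n = hom_cohomology A Q d' N n"
    using Ext_eq_cohomology[OF res N] by blast
  show ?thesis
    unfolding E cohomology_isomorphic_iff[OF assms(2), symmetric]
    using cohomology_isomorphic_transfer[OF Q hom_complex_axioms assms]
      cohomology_isomorphic_transfer[OF hom_complex_axioms Q assms] by blast
qed

section \<open>The Koszul resolution\<close>

lemma finite_words [simp]: "finite {w :: 'n::finite list. length w = n}"
  using finite_lists_length_eq[of "UNIV :: 'n set" n] by simp

lemma tens_power_expand:
  fixes t :: "('k::field, 'n::finite) tens"
  assumes "t \<in> tens_power n"
  shows "t = (\<Sum>v | length v = n. tens_scale (coef t v) (mon v 1))"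
  using assms by (intro poly_mapping_eqI) (auto simp: lookup_sum coef_mon tens_power_iff)

lemma koszul_space_subspace:
  assumes "relation_space R" shows "tens_subspace (koszul_space R n)"
  unfolding koszul_space_def
  by (auto simp: subspace_tens_power intro!: tens.subspace_Inter tens.subspace_span)

lemma koszul_space_subset:
  fixes R :: "('k::field, 'n) tens set"
  assumes "relation_space R" shows "koszul_space R n \<subseteq> tens_power n"
proof (cases "n < 2")
  case False
  let ?S = "{u * v * w | u v w. u \<in> tens_power 0 \<and> v \<in> R \<and> w \<in> tens_power (n - 2)}"
  have "koszul_space R n \<subseteq> tens_span ?S"
    using False by (auto simp: koszul_space_def)
  also have "\<dots> \<subseteq> tens_power n"
  proof (rule tens.span_minimal[OF _ subspace_tens_power])
    show "?S \<subseteq> tens_power n"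
    proof (clarify)
      fix u v w :: "('k, 'n) tens"
      assume uvw: "u \<in> tens_power 0" "v \<in> R" "w \<in> tens_power (n - 2)"
      then have "v \<in> tens_power 2" using assms by (auto simp: relation_space_def)
      then have "u * v * w \<in> tens_power (0 + 2 + (n - 2))" using uvw by (intro tens_power_mult)
      moreover have "0 + 2 + (n - 2) = n" using False by simp
      ultimately show "u * v * w \<in> tens_power n" by (simp only:)
    qed
  qed
  finally show ?thesis .
qed (simp add: koszul_space_def)

text \<open>K_(n+1) lies in K_n \<otimes> E: the last letter is taken from the right factor, so the
  condition with exponents (r, s + 1) for n + 1 yields the one with (r, s) for n.\<close>

lemma koszul_space_rdiv:
  fixes R :: "('k::field, 'n::finite) tens set"
  assumes "2 \<le> n" "x \<in> koszul_space R (Suc n)"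
  shows "rdiv l x \<in> koszul_space R n"
proof -
  have "rdiv l x \<in> tens_span {u * v * w | u v w. u \<in> tens_power r \<and> v \<in> R \<and> w \<in> tens_power s}"
    (is "_ \<in> tens_span ?S") if rs: "r + s = n - 2" for r s
  proof (rule tens_span_linear_image[where f = "rdiv l"])
    have "r + Suc s = Suc n - 2" using rs assms(1) by simp
    then show "x \<in> tens_span {u * v * w | u v w. u \<in> tens_power r \<and> v \<in> R \<and> w \<in> tens_power (Suc s)}"
      using assms by (auto simp: koszul_space_def)
  next
    fix y assume "y \<in> {u * v * w | u v w. u \<in> tens_power r \<and> v \<in> R \<and> w \<in> tens_power (Suc s)}"
    then obtain u v w where y: "y = u * v * w" "u \<in> tens_power r" "v \<in> R" "w \<in> tens_power (Suc s)"
      by blast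
    then have "rdiv l y = u * v * rdiv l w" by (simp add: rdiv_mult tens_power_iff)
    moreover have "rdiv l w \<in> tens_power s" using y(4) by (simp add: tens_power_iff)
    ultimately show "rdiv l y \<in> tens_span ?S" using y by (intro tens.span_base) blast
  qed simp_all
  then show ?thesis using assms by (auto simp: koszul_space_def)
qed

lemma koszul_space_ldiv:
  fixes R :: "('k::field, 'n::finite) tens set"
  assumes "2 \<le> n" "x \<in> koszul_space R (Suc n)"
  shows "ldiv l x \<in> koszul_space R n"
proof -
  have "ldiv l x \<in> tens_span {u * v * w | u v w. u \<in> tens_power r \<and> v \<in> R \<and> w \<in> tens_power s}"
    (is "_ \<in> tens_span ?S") if rs: "r + s = n - 2" for r s
  proof (rule tens_span_linear_image[where f = "ldiv l"])
    have "Suc r + s = Suc n - 2" using rs assms(1) by simp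
    then show "x \<in> tens_span {u * v * w | u v w. u \<in> tens_power (Suc r) \<and> v \<in> R \<and> w \<in> tens_power s}"
      using assms by (auto simp: koszul_space_def)
  next
    fix y assume "y \<in> {u * v * w | u v w. u \<in> tens_power (Suc r) \<and> v \<in> R \<and> w \<in> tens_power s}"
    then obtain u v w where y: "y = u * v * w" "u \<in> tens_power (Suc r)" "v \<in> R" "w \<in> tens_power s"
      by blast
    then have "ldiv l y = ldiv l u * v * w" by (simp add: ldiv_mult tens_power_iff mult.assoc)
    moreover have "ldiv l u \<in> tens_power r" using y(2) by (simp add: tens_power_iff)
    ultimately show "ldiv l y \<in> tens_span ?S" using y by (intro tens.span_base) blast
  qed simp_all
  then show ?thesis using assms by (auto simp: koszul_space_def)
qed

text \<open>For n = 2 the intersection has the single term r = s = 0, where the outer factors are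
  constants that \<open>R\<close> absorbs.\<close>

lemma koszul_space_2:
  fixes R :: "('k::field, 'n) tens set"
  assumes "relation_space R" shows "koszul_space R 2 = R"
proof
  have sub: "tens_subspace R" using assms by (simp add: relation_space_def)
  let ?S = "{u * v * w | u v w. u \<in> tens_power 0 \<and> v \<in> R \<and> w \<in> tens_power 0}"
  have K: "koszul_space R 2 = tens_span ?S" by (simp add: koszul_space_def)
  have "u * v * w \<in> R" if "u \<in> tens_power 0" "v \<in> R" "w \<in> tens_power 0" for u v w
  proof -
    have 0: "tens_scale (coef t []) 1 = t" if "t \<in> tens_power 0" for t :: "('k, 'n) tens"
      using tens_power_0[OF that] by (metis mon_Nil_1 mult_1_right tens_scale_mon)
    have "tens_scale a 1 * v * tens_scale b 1 = tens_scale (a * b) v" for a b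
      by (simp add: mult.commute flip: tens_scale_mult_left tens_scale_mult_right)
    from this[of "coef u []" "coef w []"]
    have "u * v * w = tens_scale (coef u [] * coef w []) v" by (simp add: 0 that)
    then show ?thesis using tens.subspace_scale[OF sub that(2)] by simp
  qed
  then have "?S \<subseteq> R" by blast
  then show "koszul_space R 2 \<subseteq> R" unfolding K by (rule tens.span_minimal[OF _ sub])
  show "R \<subseteq> koszul_space R 2"
  proof
    fix r assume "r \<in> R"
    moreover have "(1 :: ('k, 'n) tens) \<in> tens_power 0"
      using mon_in_tens_power[of "[]" 0 1] by simp
    ultimately have "1 * r * 1 \<in> ?S" by blast
    then have "1 * r * 1 \<in> tens_span ?S" by (rule tens.span_base)
    then show "r \<in> koszul_space R 2" unfolding K by (simp only: mult_1_left mult_1_right)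
  qed
qed

text \<open>A complement of \<open>V\<close> gives a linear retraction onto it. Applied to K_n it
  stands in for a basis.\<close>

lemma tens_subspace_projection:
  fixes V :: "('k::field, 'n) tens set"
  assumes "tens_subspace V"
  obtains p where "\<And>t. p t \<in> V" "\<And>s t. p (s + t) = p s + p t"
    "\<And>c t. p (tens_scale c t) = tens_scale c (p t)" "\<And>v. v \<in> V \<Longrightarrow> p v = v"
proof -
  interpret vector_space_pair "tens_scale :: 'k \<Rightarrow> ('k, 'n) tens \<Rightarrow> _" "tens_scale :: 'k \<Rightarrow> ('k, 'n) tens \<Rightarrow> _"
    by unfold_locales
  have "Vector_Spaces.linear tens_scale tens_scale (\<lambda>t :: ('k, 'n) tens. t)"
    by unfold_locales auto
  from linear_exists_left_inverse_on[OF this assms[unfolded tens_subspace_def]]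
  obtain p where p: "p ` UNIV \<subseteq> V" "Vector_Spaces.linear tens_scale tens_scale p" "\<forall>v\<in>V. p v = v"
    by auto
  show ?thesis
    by (rule that[of p]) (use p in \<open>auto simp: linear_add linear_scale\<close>)
qed

section \<open>The modules A \<otimes> K_n\<close>

locale quadratic =
  fixes R :: "('k::field, 'n::finite) tens set"
  assumes rel: "relation_space R"
begin

abbreviation "A \<equiv> quad_algebra R"
abbreviation "K n \<equiv> koszul_module R n"
abbreviation "W n \<equiv> {w :: 'n list. length w = n}"

lemma rel_subset: "R \<subseteq> tens_power 2" and rel_subspace: "tens_subspace R"
  using rel by (simp_all add: relation_space_def)

sublocale field_algebra "quad_algebra R"
proof (intro field_algebra.intro ring_quad_algebra field_algebra_axioms.intro)
  have 1: "tens_scale c 1 * t = tens_scale c t" "t * tens_scale c 1 = tens_scale c t" for c and t :: "('k, 'n) tens"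
    by (simp_all flip: tens_scale_mult_left tens_scale_mult_right)
  show "(c \<odot>\<^bsub>A\<^esub> \<one>\<^bsub>A\<^esub>) \<otimes>\<^bsub>A\<^esub> a = a \<otimes>\<^bsub>A\<^esub> (c \<odot>\<^bsub>A\<^esub> \<one>\<^bsub>A\<^esub>)" if "a \<in> carrier A" for a c
    using that by (auto simp: quad_algebra_simps 1 elim!: quad_carrierE)
qed (auto simp: quad_algebra_simps tens.scale_left_distrib simp flip: tens_scale_mult_left)

lemma aug_cls [simp]: "augmentation (cls R t) = coef t []"
  by (rule augmentation_cls[OF rel_subset])

lemma trivial_module_simps [simp]:
  "carrier trivial_module = UNIV" "\<zero>\<^bsub>trivial_module\<^esub> = 0" "add trivial_module = (+)"
  "a \<odot>\<^bsub>trivial_module\<^esub> c = augmentation a * c"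
  by (simp_all add: trivial_module_def)

lemma left_module_trivial: "left_module A trivial_module"
proof -
  have "abelian_group trivial_module"
    by (rule abelian_groupI) (auto simp: add.assoc add.commute intro: exI[of _ "- _"] left_minus)
  then show ?thesis
    unfolding left_module_def left_module_axioms_def
    by (auto simp: ring_axioms quad_algebra_simps lookup_add coef_mult_Nil algebra_simps lookup_one
        zero_list_def elim!: quad_carrierE)
qed

lemma koszul_module_simps:
  "\<zero>\<^bsub>K n\<^esub> = (\<lambda>_. cls R 0)"
  "f \<oplus>\<^bsub>K n\<^esub> g = (\<lambda>w. f w \<oplus>\<^bsub>A\<^esub> g w)"
  "a \<odot>\<^bsub>K n\<^esub> f = (\<lambda>w. a \<otimes>\<^bsub>A\<^esub> f w)"
  by (simp_all add: koszul_module_def Let_def free_module_def quad_algebra_simps)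

text \<open>This is the sum of the \<open>t v \<otimes> \<kappa> v\<close> over the words
  \<open>v\<close> of length \<open>n\<close>, written in word coordinates.\<close>

definition kelt :: "nat \<Rightarrow> ('n list \<Rightarrow> ('k, 'n) tens) \<Rightarrow> ('n list \<Rightarrow> ('k, 'n) tens) \<Rightarrow> ('k, 'n) word_fun"
  where "kelt n \<kappa> t = (\<lambda>w. cls R (\<Sum>v\<in>W n. tens_scale (coef (\<kappa> v) w) (t v)))"

definition koszul_gens :: "nat \<Rightarrow> ('k, 'n) word_fun set"
  where "koszul_gens n =
    {\<lambda>w. coef k w \<odot>\<^bsub>A\<^esub> a | a k. a \<in> carrier A \<and> k \<in> koszul_space R n}"

lemma koszul_carrier: "carrier (K n) = generate (add_monoid (free_module A (W n))) (koszul_gens n)"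
  by (simp add: koszul_module_def Let_def koszul_gens_def)

lemma koszul_gensI: "k \<in> koszul_space R n \<Longrightarrow> (\<lambda>w. cls R (tens_scale (coef k w) t)) \<in> koszul_gens n"
  unfolding koszul_gens_def
  by (rule CollectI, rule exI[of _ "cls R t"], rule exI[of _ k]) (simp add: quad_algebra_simps)

lemma free_memI:
  assumes "\<And>w. length w \<noteq> n \<Longrightarrow> t w \<in> rel_ideal R"
  shows "(\<lambda>w. cls R (t w)) \<in> carrier (free_module A (W n))"
proof -
  have "{w. cls R (t w) \<noteq> cls R 0} \<subseteq> W n" using assms by (auto simp: cls_eq_zero_iff)
  then have "finite {w. cls R (t w) \<noteq> cls R 0}" by (rule finite_subset) simp
  then show ?thesis using assms by (auto simp: free_module_simps quad_algebra_simps cls_eq_zero_iff)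
qed

lemma free_memE:
  assumes "f \<in> carrier (free_module A (W n))"
  obtains t where "f = (\<lambda>w. cls R (t w))" "\<And>w. length w \<noteq> n \<Longrightarrow> t w = 0"
proof -
  have "\<forall>w. \<exists>t. f w = cls R t \<and> (length w \<noteq> n \<longrightarrow> t = 0)"
    using assms by (auto simp: free_module_simps quad_algebra_simps) blast
  then obtain t where "\<forall>w. f w = cls R (t w) \<and> (length w \<noteq> n \<longrightarrow> t w = 0)" by metis
  then show ?thesis by (intro that[of t]) auto
qed

lemma koszul_gens_free: "koszul_gens n \<subseteq> carrier (free_module A (W n))"
proof
  fix f assume "f \<in> koszul_gens n"
  then obtain t k where k: "k \<in> koszul_space R n" and f: "f = (\<lambda>w. cls R (tens_scale (coef k w) t))"
    by (auto simp: koszul_gens_def quad_algebra_simps)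
  have "k \<in> tens_power n" using k koszul_space_subset[OF rel] by blast
  then show "f \<in> carrier (free_module A (W n))"
    unfolding f by (intro free_memI) (auto simp: tens_power_iff rel_ideal_memI)
qed

lemma left_module_F: "left_module A (free_module A (W n))"
  by (rule left_module_free[OF ring_axioms])

lemma koszul_zero_in: "(\<lambda>_. cls R 0) \<in> carrier (K n)"
  and koszul_add_in: "f \<in> carrier (K n) \<Longrightarrow> g \<in> carrier (K n) \<Longrightarrow> (\<lambda>w. f w \<oplus>\<^bsub>A\<^esub> g w) \<in> carrier (K n)"
  unfolding koszul_carrier
  using generate.one[of "add_monoid (free_module A (W n))" "koszul_gens n"]
    generate.eng[of f "add_monoid (free_module A (W n))" "koszul_gens n" g]
  by (simp_all add: free_module_simps quad_algebra_simps(4))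

lemma kelt_in:
  assumes "\<And>v. length v = n \<Longrightarrow> \<kappa> v \<in> koszul_space R n"
  shows "kelt n \<kappa> t \<in> carrier (K n)"
proof -
  have "finite S \<Longrightarrow> S \<subseteq> W n \<Longrightarrow>
      (\<lambda>w. cls R (\<Sum>v\<in>S. tens_scale (coef (\<kappa> v) w) (t v))) \<in> carrier (K n)" for S
  proof (induction S rule: finite_induct)
    case (insert v S)
    have "(\<lambda>w. cls R (tens_scale (coef (\<kappa> v) w) (t v))) \<in> carrier (K n)"
      unfolding koszul_carrier using insert.prems assms by (intro generate.incl koszul_gensI) auto
    from koszul_add_in[OF this insert.IH] insert show ?case by (simp add: quad_algebra_simps)
  qed (simp add: koszul_zero_in)
  from this[of "W n"] show ?thesis by (simp add: kelt_def)
qed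

lemma kelt_add: "(\<lambda>w. kelt n \<kappa> s w \<oplus>\<^bsub>A\<^esub> kelt n \<kappa> t w) = kelt n \<kappa> (\<lambda>v. s v + t v)"
  by (simp add: kelt_def quad_algebra_simps tens.scale_right_distrib sum.distrib)

lemma kelt_smult: "(\<lambda>w. cls R s \<otimes>\<^bsub>A\<^esub> kelt n \<kappa> t w) = kelt n \<kappa> (\<lambda>v. s * t v)"
  by (simp add: kelt_def quad_algebra_simps sum_distrib_left tens_scale_mult_right)

text \<open>Take for \<open>\<kappa> v\<close> the projection of the word \<open>v\<close> to K_n.
  These elements span K_n, and each k in K_n is reproduced with its own word coefficients because
  the projection fixes it. The generated subgroup thereby becomes the image of an explicit linear
  map.\<close>

lemma koszul_carrier_kelt:
  obtains \<kappa> where "\<forall>v. \<kappa> v \<in> koszul_space R n"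
    "\<forall>k\<in>koszul_space R n. k = (\<Sum>v\<in>W n. tens_scale (coef k v) (\<kappa> v))"
    "carrier (K n) = range (kelt n \<kappa>)"
proof -
  obtain p where pV: "\<And>t. p t \<in> koszul_space R n" and padd: "\<And>s t. p (s + t) = p s + p t"
    and pscale: "\<And>c t. p (tens_scale c t) = tens_scale c (p t)"
    and pid: "\<And>v. v \<in> koszul_space R n \<Longrightarrow> p v = v"
    using tens_subspace_projection[OF koszul_space_subspace[OF rel, of n]] by blast
  define \<kappa> where "\<kappa> v = p (mon v 1)" for v
  have p0: "p 0 = 0" using pscale[of 0 0] by simp
  have psum: "p (\<Sum>v\<in>S. g v) = (\<Sum>v\<in>S. p (g v))" if "finite S" for S :: "'n list set" and g
    using that by (induction S rule: finite_induct) (auto simp: p0 padd)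
  have rep: "k = (\<Sum>v\<in>W n. tens_scale (coef k v) (\<kappa> v))" if "k \<in> koszul_space R n" for k
  proof -
    have "k \<in> tens_power n" using that koszul_space_subset[OF rel] by blast
    then have "p k = (\<Sum>v\<in>W n. tens_scale (coef k v) (\<kappa> v))"
      by (subst tens_power_expand) (simp_all add: psum pscale \<kappa>_def del: tens_scale_mon)
    then show ?thesis using pid[OF that] by simp
  qed
  have "f \<in> range (kelt n \<kappa>)" if "f \<in> carrier (K n)" for f
    using that unfolding koszul_carrier
  proof (induction rule: generate.induct)
    case one
    have "kelt n \<kappa> (\<lambda>_. 0) = (\<lambda>_. cls R 0)" by (simp add: kelt_def)
    then show ?case by (auto simp: free_module_simps quad_algebra_simps intro: range_eqI[OF sym])
  next
    case (incl f)
    then obtain t k where k: "k \<in> koszul_space R n" and f: "f = (\<lambda>w. cls R (tens_scale (coef k w) t))"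
      by (auto simp: koszul_gens_def quad_algebra_simps)
    have "f = kelt n \<kappa> (\<lambda>v. tens_scale (coef k v) t)"
      unfolding f kelt_def
      by (subst rep[OF k]) (simp add: lookup_sum tens.scale_sum_left mult.commute)
    then show ?case by blast
  next
    case (inv f)
    then obtain t k where k: "k \<in> koszul_space R n" and f: "f = (\<lambda>w. cls R (tens_scale (coef k w) t))"
      by (auto simp: koszul_gens_def quad_algebra_simps)
    \<comment> \<open>The inverse of a generator is again a generator: -(a \<otimes> k) = (-a)
      \<otimes> k.\<close>
    have "(\<lambda>w. cls R (tens_scale (coef k w) (- t))) \<in> carrier (free_module A (W n))"
      using koszul_gens_free koszul_gensI[OF k] by blast
    moreover have "f \<in> carrier (free_module A (W n))" using inv koszul_gens_free by blast
    ultimately have "\<ominus>\<^bsub>free_module A (W n)\<^esub> f = (\<lambda>w. cls R (tens_scale (coef k w) (- t)))"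
      by (intro abelian_group.minus_equality[OF left_moduleD(2)[OF left_module_F]])
        (simp_all add: free_module_simps quad_algebra_simps f flip: tens.scale_right_distrib)
    also have "\<dots> = kelt n \<kappa> (\<lambda>v. tens_scale (coef k v) (- t))"
      unfolding kelt_def
      by (subst rep[OF k]) (simp add: lookup_sum tens.scale_sum_left mult.commute sum_negf)
    finally show ?case by (simp add: a_inv_def)
  next
    case (eng f g)
    then obtain s t where "f = kelt n \<kappa> s" "g = kelt n \<kappa> t" by blast
    then show ?case using kelt_add[of n \<kappa> s t] by (simp add: free_module_simps)
  qed
  moreover have "range (kelt n \<kappa>) \<subseteq> carrier (K n)"
    using kelt_in pV by (auto simp: \<kappa>_def)
  ultimately show ?thesis
    using rep by (intro that[of \<kappa>] ballI) (auto simp: \<kappa>_def pV)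
qed

lemma koszul_carrier_subset: "carrier (K n) \<subseteq> carrier (free_module A (W n))"
proof -
  obtain \<kappa> where k: "\<forall>v. \<kappa> v \<in> koszul_space R n" and c: "carrier (K n) = range (kelt n \<kappa>)"
    using koszul_carrier_kelt[of n] by metis
  have "\<kappa> v \<in> tens_power n" for v using k koszul_space_subset[OF rel] by blast
  then show ?thesis unfolding c kelt_def by (auto intro!: free_memI simp: tens_power_iff rel_ideal_memI)
qed

lemma koszul_memE:
  assumes "f \<in> carrier (K n)"
  obtains t where "f = (\<lambda>w. cls R (t w))" "\<And>w. length w \<noteq> n \<Longrightarrow> t w = 0"
  using free_memE assms koszul_carrier_subset by blast

lemma submod_koszul: "submod A (free_module A (W n)) (carrier (K n))"
proof -
  obtain \<kappa> where c: "carrier (K n) = range (kelt n \<kappa>)"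
    using koszul_carrier_kelt[of n] by metis
  have "a \<odot>\<^bsub>free_module A (W n)\<^esub> f \<in> carrier (K n)" if "a \<in> carrier A" "f \<in> carrier (K n)" for a f
    using that unfolding c by (auto simp: free_module_simps kelt_smult elim!: quad_carrierE)
  then show ?thesis
    unfolding submod_def using koszul_carrier_subset koszul_zero_in koszul_add_in
    by (auto simp: free_module_simps quad_algebra_simps(4))
qed

lemma left_module_koszul: "left_module A (K n)"
proof -
  have "K n = (free_module A (W n))\<lparr>carrier := carrier (K n)\<rparr>"
    by (simp add: koszul_module_def Let_def)
  then show ?thesis using left_module_submod[OF left_module_F submod_koszul] by metis
qed

lemma koszul_carrier_low:
  assumes "n < 2" shows "carrier (K n) = carrier (free_module A (W n))"
proof (intro equalityI koszul_carrier_subset subsetI)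
  fix f assume "f \<in> carrier (free_module A (W n))"
  then obtain t where f: "f = (\<lambda>w. cls R (t w))" "\<And>w. length w \<noteq> n \<Longrightarrow> t w = 0"
    by (rule free_memE) blast
  have "(\<Sum>v\<in>W n. tens_scale (coef (mon v 1) w) (t v)) = t w" for w
    using f(2) by (auto simp: coef_mon if_distrib[of "\<lambda>c. tens_scale c _"] cong: if_cong)
  then have "f = kelt n (\<lambda>v. mon v 1) t" using f by (simp add: kelt_def)
  moreover have "kelt n (\<lambda>v. mon v 1) t \<in> carrier (K n)"
    using assms by (intro kelt_in) (simp add: koszul_space_def mon_in_tens_power)
  ultimately show "f \<in> carrier (K n)" by simp
qed

end

lemma (in hom_complex) Z_subset_B_zero_module:
  assumes "carrier (P n) = {\<zero>\<^bsub>P n\<^esub>}"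
  shows "Z n \<subseteq> B n"
proof
  fix z assume "z \<in> Z n"
  then have z: "z \<in> lhom A (P n) N" by (simp add: Z_iff)
  have "z = (\<lambda>x\<in>carrier (P n). \<zero>\<^bsub>N\<^esub>)"
    using assms lhom_zero[OF PD(2) N z]
    by (intro lhom_ext[OF z lhom_zero_map[OF PD(2) N]]) simp
  then show "z \<in> B n" using submod_B[of n] by (simp add: submod_def)
qed

section \<open>The Koszul complex as a projective resolution of the trivial module\<close>

context quadratic
begin

lemma koszul_diff_cls:
  "koszul_diff R (\<lambda>w. cls R (t w)) = (\<lambda>w. cls R (\<Sum>l\<in>UNIV. t (l # w) * gen l))"
  by (simp add: koszul_diff_def Let_def quad_algebra_simps finsum_cls flip: cls_def rel_ideal_def)

text \<open>The differential is restricted to the carrier because \<open>lhom\<close> consists of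
  extensional functions.\<close>

definition dK :: "nat \<Rightarrow> ('k, 'n) word_fun \<Rightarrow> ('k, 'n) word_fun"
  where "dK n = (\<lambda>f\<in>carrier (K (Suc n)). koszul_diff R f)"

definition eK :: "('k, 'n) word_fun \<Rightarrow> 'k"
  where "eK = (\<lambda>f\<in>carrier (K 0). augmentation (f []))"

text \<open>For \<open>n < 2\<close> the target is the full free module and only word lengths
  matter. In higher degrees the same closure is extracted from the exactness equations in
  \<open>koszul\<close>.\<close>

lemma koszul_diff_closed_low:
  assumes "n < 2" "f \<in> carrier (K (Suc n))"
  shows "koszul_diff R f \<in> carrier (K n)"
proof -
  obtain t where f: "f = (\<lambda>w. cls R (t w))" and t: "\<And>w. length w \<noteq> Suc n \<Longrightarrow> t w = 0"
    using koszul_memE[OF assms(2)] by blast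
  show ?thesis
    unfolding koszul_carrier_low[OF assms(1)] f koszul_diff_cls
    by (rule free_memI) (simp add: t rel_ideal_memI)
qed

lemma dK_lhom:
  assumes "koszul_diff R ` carrier (K (Suc n)) \<subseteq> carrier (K n)"
  shows "dK n \<in> lhom A (K (Suc n)) (K n)"
  unfolding dK_def
proof (rule lhom_restrictI[OF left_module_koszul])
  fix f assume f: "f \<in> carrier (K (Suc n))"
  then show "koszul_diff R f \<in> carrier (K n)" using assms by blast
  obtain s where s: "f = (\<lambda>w. cls R (s w))" using koszul_memE[OF f] by blast
  show "koszul_diff R (f \<oplus>\<^bsub>K (Suc n)\<^esub> g) = koszul_diff R f \<oplus>\<^bsub>K n\<^esub> koszul_diff R g"
    if g: "g \<in> carrier (K (Suc n))" for g
  proof -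
    obtain t where t: "g = (\<lambda>w. cls R (t w))" using koszul_memE[OF g] by blast
    show ?thesis
      by (simp add: s t koszul_module_simps quad_algebra_simps koszul_diff_cls distrib_right sum.distrib)
  qed
  show "koszul_diff R (a \<odot>\<^bsub>K (Suc n)\<^esub> f) = a \<odot>\<^bsub>K n\<^esub> koszul_diff R f" if "a \<in> carrier A" for a
    using that by (auto simp: s koszul_module_simps quad_algebra_simps koszul_diff_cls
        sum_distrib_left mult.assoc elim!: quad_carrierE)
qed

text \<open>The definition of projectivity asks for a basis indexed by elements of the type of the
  module, so the words are encoded as functions on words.\<close>

lemma projective_koszul: "projective_module A (K n)"
proof -
  define J :: "'n list \<Rightarrow> ('k, 'n) word_fun" where "J v = (\<lambda>w. if w = v then UNIV else {})" for v
  have "inj J" by (rule injI) (metis J_def empty_not_UNIV)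
  then have J: "inv_into UNIV J (J v) = v" for v by simp
  obtain \<kappa> where \<kappa>: "\<forall>v. \<kappa> v \<in> koszul_space R n"
    and rep: "\<forall>k\<in>koszul_space R n. k = (\<Sum>v\<in>W n. tens_scale (coef k v) (\<kappa> v))"
    and c: "carrier (K n) = range (kelt n \<kappa>)"
    by (rule koszul_carrier_kelt[of n])
  let ?F = "free_module A (J ` W n)"
  define S where "S f = (\<lambda>y. if y \<in> J ` W n then f (inv_into UNIV J y) else cls R 0)" for f :: "('k, 'n) word_fun"
  define p where "p g = (\<lambda>w. \<Oplus>\<^bsub>A\<^esub>v\<in>W n. coef (\<kappa> v) w \<odot>\<^bsub>A\<^esub> g (J v))" for g
  have p: "p (\<lambda>y. cls R (t y)) = kelt n \<kappa> (t \<circ> J)" for t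
    by (simp add: p_def kelt_def quad_algebra_simps finsum_cls)
  have F: "\<exists>t. g = (\<lambda>y. cls R (t y))" if "g \<in> carrier ?F" for g
  proof -
    have "\<forall>y. \<exists>t. g y = cls R t"
      using that unfolding free_module_simps quad_algebra_simps(1) by blast
    then show ?thesis by metis
  qed
  have lF: "left_module A ?F" by (rule left_module_free[OF ring_axioms])
  have s: "restrict S (carrier (K n)) \<in> lhom A (K n) ?F"
  proof (rule lhom_restrictI[OF left_module_koszul])
    fix f assume f: "f \<in> carrier (K n)"
    then obtain t where t: "f = (\<lambda>w. cls R (t w))" using koszul_memE by blast
    have "{y. S f y \<noteq> \<zero>\<^bsub>A\<^esub>} \<subseteq> J ` W n" by (auto simp: S_def quad_algebra_simps)
    then have "finite {y. S f y \<noteq> \<zero>\<^bsub>A\<^esub>}" by (rule finite_subset) simp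
    then show "S f \<in> carrier ?F" by (simp add: free_module_simps S_def t quad_algebra_simps)
  qed (auto simp: S_def koszul_module_simps free_module_simps quad_algebra_simps
      elim!: quad_carrierE intro!: ext)
  have p': "restrict p (carrier ?F) \<in> lhom A ?F (K n)"
  proof (rule lhom_restrictI[OF lF])
    fix f assume f: "f \<in> carrier ?F"
    obtain s where s: "f = (\<lambda>w. cls R (s w))" using F[OF f] by blast
    show "p f \<in> carrier (K n)" by (simp add: s p c)
    show "p (f \<oplus>\<^bsub>?F\<^esub> g) = p f \<oplus>\<^bsub>K n\<^esub> p g" if g: "g \<in> carrier ?F" for g
    proof -
      obtain t where t: "g = (\<lambda>w. cls R (t w))" using F[OF g] by blast
      have "p (f \<oplus>\<^bsub>?F\<^esub> g) = p (\<lambda>w. cls R (s w + t w))"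
        by (simp add: s t free_module_simps quad_algebra_simps)
      then show ?thesis by (simp add: s t p koszul_module_simps kelt_add comp_def)
    qed
    show "p (a \<odot>\<^bsub>?F\<^esub> f) = a \<odot>\<^bsub>K n\<^esub> p f" if a: "a \<in> carrier A" for a
    proof -
      obtain u where u: "a = cls R u" using a by (rule quad_carrierE)
      have "p (a \<odot>\<^bsub>?F\<^esub> f) = p (\<lambda>w. cls R (u * s w))"
        by (simp add: s u free_module_simps quad_algebra_simps)
      then show ?thesis by (simp add: s u p koszul_module_simps kelt_smult comp_def)
    qed
  qed
  have "p (S f) = f" if f: "f \<in> carrier (K n)" for f
  proof -
    obtain t where t: "f = kelt n \<kappa> t" using f by (auto simp: c)
    have "p (S f) w = f w" for w
    proof -
      have "p (S f) w = (\<Oplus>\<^bsub>A\<^esub>v\<in>W n. coef (\<kappa> v) w \<odot>\<^bsub>A\<^esub> f v)"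
        unfolding p_def by (rule finsum_cong') (auto simp: S_def J t kelt_def quad_algebra_simps)
      also have "\<dots> = cls R (\<Sum>v\<in>W n. \<Sum>u\<in>W n. tens_scale (coef (\<kappa> v) w * coef (\<kappa> u) v) (t u))"
        by (simp add: t kelt_def quad_algebra_simps finsum_cls tens.scale_sum_right)
      also have "(\<Sum>v\<in>W n. \<Sum>u\<in>W n. tens_scale (coef (\<kappa> v) w * coef (\<kappa> u) v) (t u)) =
          (\<Sum>u\<in>W n. tens_scale (coef (\<Sum>v\<in>W n. tens_scale (coef (\<kappa> u) v) (\<kappa> v)) w) (t u))"
        by (subst sum.swap) (simp add: lookup_sum tens.scale_sum_left mult.commute)
      \<comment> \<open>Each \<open>\<kappa> u\<close> lies in K_n and is therefore reproduced by
        its own coefficients: the matrix of the \<open>\<kappa>\<close> is idempotent.\<close>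
      also have "\<dots> = (\<Sum>u\<in>W n. tens_scale (coef (\<kappa> u) w) (t u))"
        by (rule sum.cong) (simp_all flip: bspec[OF rep spec[OF \<kappa>]])
      finally show ?thesis by (simp add: t kelt_def)
    qed
    then show ?thesis by (rule ext)
  qed
  then show ?thesis
    unfolding projective_module_def using left_module_koszul s p' lhomD(2)[OF s]
    by (intro conjI exI[of _ "J ` W n"] bexI[OF _ s] bexI[OF _ p']) auto
qed

lemma eK_lhom: "eK \<in> lhom A (K 0) trivial_module"
  unfolding eK_def
proof (rule lhom_restrictI[OF left_module_koszul])
  fix f assume f: "f \<in> carrier (K 0)"
  obtain s where s: "f = (\<lambda>w. cls R (s w))" using koszul_memE[OF f] by blast
  show "augmentation ((f \<oplus>\<^bsub>K 0\<^esub> g) []) =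
      augmentation (f []) \<oplus>\<^bsub>trivial_module\<^esub> augmentation (g [])"
    if g: "g \<in> carrier (K 0)" for g
  proof -
    obtain t where t: "g = (\<lambda>w. cls R (t w))" using koszul_memE[OF g] by blast
    show ?thesis by (simp add: s t koszul_module_simps quad_algebra_simps lookup_add)
  qed
  show "augmentation ((a \<odot>\<^bsub>K 0\<^esub> f) []) = a \<odot>\<^bsub>trivial_module\<^esub> augmentation (f [])"
    if "a \<in> carrier A" for a
    using that by (auto simp: s koszul_module_simps quad_algebra_simps coef_mult_Nil
        elim!: quad_carrierE)
qed simp

text \<open>\<open>koszul\<close> speaks of degrees at least one. Exactness at A itself holds for
  every quadratic algebra, since a tensor without constant term is a combination of the
  generators.\<close>

lemma koszul_projective_resolution:
  assumes "koszul R"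
  shows "projective_resolution A trivial_module K dK eK"
proof -
  have ex: "{f \<in> carrier (K (Suc n)). koszul_diff R f = \<zero>\<^bsub>K n\<^esub>} =
      koszul_diff R ` carrier (K (Suc (Suc n)))" for n
    using assms[unfolded koszul_def, rule_format, of "Suc n"] by simp
  \<comment> \<open>For n >= 1 the image equals a kernel inside \<open>carrier (K n)\<close>, hence
    the shift by one in \<open>ex\<close>.\<close>
  have "koszul_diff R ` carrier (K (Suc n)) \<subseteq> carrier (K n)" for n
    using ex[of "n - 1"] koszul_diff_closed_low[of 0] by (cases n) auto
  then have d: "dK n \<in> lhom A (K (Suc n)) (K n)" for n by (rule dK_lhom)
  have K0: "(\<lambda>w. cls R (if w = [] then t else 0)) \<in> carrier (K 0)" for t
    by (subst koszul_carrier_low, simp) (rule free_memI, simp add: rel_ideal_memI)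
  have "c \<in> eK ` carrier (K 0)" for c
    by (rule image_eqI[OF _ K0[of "mon [] c"]]) (simp add: eK_def K0 coef_mon)
  then have e: "eK ` carrier (K 0) = carrier trivial_module" by auto
  have "{x \<in> carrier (K 0). eK x = \<zero>\<^bsub>trivial_module\<^esub>} = dK 0 ` carrier (K 1)"
  proof (intro equalityI subsetI)
    fix x assume x: "x \<in> {x \<in> carrier (K 0). eK x = \<zero>\<^bsub>trivial_module\<^esub>}"
    then obtain t where t: "x = (\<lambda>w. cls R (t w))" and t0: "\<And>w. length w \<noteq> 0 \<Longrightarrow> t w = 0"
      using koszul_memE[of x 0] by blast
    \<comment> \<open>The preimage has the right quotient of the representative by the letter l as
      its coordinate at the word [l].\<close>
    define f where "f = (\<lambda>w. cls R (if length w = 1 then rdiv (hd w) (t []) else 0))"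
    have f: "f \<in> carrier (K 1)"
      unfolding f_def by (subst koszul_carrier_low, simp) (rule free_memI, simp add: rel_ideal_memI)
    have "coef (t []) [] = 0" using x by (auto simp: eK_def t)
    then have "(\<Sum>l\<in>UNIV. rdiv l (t []) * gen l) = t []" using right_expand[of "t []"] by simp
    then have "(\<Sum>l\<in>UNIV. (if length (l # w) = 1 then rdiv (hd (l # w)) (t []) else 0) * gen l) = t w" for w
      using t0 by (cases w) simp_all
    then have "koszul_diff R f = x"
      unfolding f_def koszul_diff_cls t by presburger
    then show "x \<in> dK 0 ` carrier (K 1)" using f by (auto simp: dK_def intro!: image_eqI[of _ _ f])
  next
    fix x assume "x \<in> dK 0 ` carrier (K 1)"
    then obtain f where f: "f \<in> carrier (K 1)" and x: "x = koszul_diff R f" by (auto simp: dK_def)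
    obtain t where t: "f = (\<lambda>w. cls R (t w))" using koszul_memE[OF f] by blast
    have "x \<in> carrier (K 0)" using koszul_diff_closed_low[of 0] f x by simp
    moreover have "augmentation (x []) = 0"
      by (simp add: x t koszul_diff_cls lookup_sum coef_mult_Nil coef_gen)
    ultimately show "x \<in> {x \<in> carrier (K 0). eK x = \<zero>\<^bsub>trivial_module\<^esub>}" by (simp add: eK_def)
  qed
  moreover have "{x \<in> carrier (K (Suc n)). dK n x = \<zero>\<^bsub>K n\<^esub>} = dK (Suc n) ` carrier (K (Suc (Suc n)))" for n
    using ex[of n] by (auto simp: dK_def)
  ultimately show ?thesis
    unfolding projective_resolution_def by (intro conjI allI projective_koszul d e eK_lhom)
qed

lemma hom_complex_koszul:
  assumes "koszul R" "left_module A N"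
  shows "hom_complex A trivial_module K dK eK N"
  using assms koszul_projective_resolution
  by (intro hom_complex.intro field_algebra_axioms hom_complex_axioms.intro)

end

section \<open>Cochains with values in the regular module\<close>

context quadratic
begin

lemma K_lowI:
  assumes "n < 2" "\<And>w. length w \<noteq> n \<Longrightarrow> t w = 0"
  shows "(\<lambda>w. cls R (t w)) \<in> carrier (K n)"
  unfolding koszul_carrier_low[OF assms(1)] by (rule free_memI) (simp add: assms(2) rel_ideal_memI)

lemma left_module_reg: "left_module A (regular_module A)"
  by (rule left_module_regular[OF ring_axioms])

text \<open>Left linear maps from a free module to \<open>A\<close> are right multiplications on the
  coordinates; \<open>s v\<close> is the multiplier at the word \<open>v\<close>. On A \<otimes> K_n
  this is the restriction of such a map.\<close>

definition evm :: "nat \<Rightarrow> ('n list \<Rightarrow> ('k, 'n) tens) \<Rightarrow> ('k, 'n) word_fun \<Rightarrow> ('k, 'n) tens set"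
  where "evm n s = (\<lambda>f\<in>carrier (K n). \<Oplus>\<^bsub>A\<^esub>v\<in>W n. f v \<otimes>\<^bsub>A\<^esub> cls R (s v))"

lemma evm_cls:
  assumes "(\<lambda>w. cls R (t w)) \<in> carrier (K n)"
  shows "evm n s (\<lambda>w. cls R (t w)) = cls R (\<Sum>v\<in>W n. t v * s v)"
  using assms by (simp add: evm_def quad_algebra_simps finsum_cls)

lemma evm_lhom: "evm n s \<in> lhom A (K n) (regular_module A)"
  unfolding evm_def
proof (rule lhom_restrictI[OF left_module_koszul])
  fix f assume f: "f \<in> carrier (K n)"
  obtain t where t: "f = (\<lambda>w. cls R (t w))" using koszul_memE[OF f] by blast
  show "(\<Oplus>\<^bsub>A\<^esub>v\<in>W n. f v \<otimes>\<^bsub>A\<^esub> cls R (s v)) \<in> carrier (regular_module A)"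
    by (simp add: t quad_algebra_simps finsum_cls)
  show "(\<Oplus>\<^bsub>A\<^esub>v\<in>W n. (f \<oplus>\<^bsub>K n\<^esub> g) v \<otimes>\<^bsub>A\<^esub> cls R (s v)) =
      (\<Oplus>\<^bsub>A\<^esub>v\<in>W n. f v \<otimes>\<^bsub>A\<^esub> cls R (s v)) \<oplus>\<^bsub>regular_module A\<^esub>
      (\<Oplus>\<^bsub>A\<^esub>v\<in>W n. g v \<otimes>\<^bsub>A\<^esub> cls R (s v))"
    if g: "g \<in> carrier (K n)" for g
  proof -
    obtain t' where t': "g = (\<lambda>w. cls R (t' w))" using koszul_memE[OF g] by blast
    show ?thesis
      by (simp add: t t' koszul_module_simps quad_algebra_simps finsum_cls distrib_right sum.distrib)
  qed
  show "(\<Oplus>\<^bsub>A\<^esub>v\<in>W n. (a \<odot>\<^bsub>K n\<^esub> f) v \<otimes>\<^bsub>A\<^esub> cls R (s v)) =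
      a \<odot>\<^bsub>regular_module A\<^esub> (\<Oplus>\<^bsub>A\<^esub>v\<in>W n. f v \<otimes>\<^bsub>A\<^esub> cls R (s v))"
    if "a \<in> carrier A" for a
    using that by (auto simp: t koszul_module_simps quad_algebra_simps finsum_cls sum_distrib_left
        mult.assoc elim!: quad_carrierE)
qed

lemma koszul_low_free: "n < 2 \<Longrightarrow> K n = free_module A (W n)"
  using koszul_carrier_low[of n] by (simp add: koszul_module_def Let_def)

text \<open>In degrees 0 and 1 the module is free on the words, so the multipliers are the values on
  the basis vectors.\<close>

lemma lhom_low_evm:
  assumes "n < 2" and z: "z \<in> lhom A (K n) (regular_module A)"
  obtains s where "z = evm n s"
proof -
  have "\<exists>t. length v = n \<longrightarrow> z (free_basis A v) = cls R t" for v
  proof (cases "length v = n")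
    case True
    then have "free_basis A v \<in> carrier (K n)"
      unfolding koszul_carrier_low[OF assms(1)] by (intro free_basis_closed ring_axioms) simp
    then have "z (free_basis A v) \<in> carrier A" using lhomD(2)[OF z] by simp
    then obtain t where "z (free_basis A v) = cls R t" by (rule quad_carrierE)
    then show ?thesis by blast
  qed simp
  then obtain s where s: "\<And>v. length v = n \<Longrightarrow> z (free_basis A v) = cls R (s v)" by metis
  have "z f = evm n s f" if f: "f \<in> carrier (K n)" for f
  proof (rule free_lhom_eq[OF ring_axioms left_module_reg,
        of _ "W n", folded koszul_low_free[OF assms(1)], OF z evm_lhom _ f])
    fix v assume v: "v \<in> W n"
    have b: "free_basis A v = (\<lambda>w. cls R (if w = v then 1 else 0))"
      by (rule ext) (simp add: free_basis_def quad_algebra_simps)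
    have "(\<lambda>w. cls R (if w = v then 1 else 0)) \<in> carrier (K n)"
      using v by (intro K_lowI assms(1)) auto
    then have "evm n s (free_basis A v) = cls R (\<Sum>w\<in>W n. (if w = v then 1 else 0) * s w)"
      unfolding b by (rule evm_cls)
    also have "\<dots> = cls R (s v)"
      using v by (simp add: if_distrib[of "\<lambda>x. x * _"] cong: if_cong)
    finally show "z (free_basis A v) = evm n s (free_basis A v)" using s v by simp
  qed
  then show ?thesis by (intro that[of s] lhom_ext[OF z evm_lhom])
qed

lemma words_1: "W (Suc 0) = range (\<lambda>m. [m])"
  by (auto simp: length_Suc_conv)

lemma sum_words_1: "(\<Sum>v\<in>W (Suc 0). g v) = (\<Sum>m\<in>UNIV. g [m])"
  unfolding words_1 by (subst sum.reindex) (auto simp: inj_def)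

lemma koszul_zero_space:
  assumes "koszul_space R n = {0}"
  shows "carrier (K n) = {\<lambda>_. cls R 0}"
proof -
  obtain \<kappa> where k: "\<forall>v. \<kappa> v \<in> koszul_space R n" and c: "carrier (K n) = range (kelt n \<kappa>)"
    using koszul_carrier_kelt[of n] by metis
  show ?thesis using k unfolding c assms by (auto simp: kelt_def)
qed

lemma koszul_diff_zero: "koszul_diff R (\<lambda>_. cls R 0) = (\<lambda>_. cls R 0)"
  by (simp add: koszul_diff_cls)

text \<open>By \<open>koszul_space_rdiv\<close> an element of K_(n+1) has all its right quotients in
  K_n, and it has no constant term.\<close>

lemma koszul_space_zero_mono:
  assumes "koszul_space R m = {0}" "2 \<le> m" "m \<le> n"
  shows "koszul_space R n = {0}"
  using assms(3)
proof (induction n rule: dec_induct)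
  case (step n)
  have "x = 0" if x: "x \<in> koszul_space R (Suc n)" for x
  proof -
    have "rdiv l x = 0" for l
      using koszul_space_rdiv[OF _ x] step assms(2) by simp
    moreover have "x \<in> tens_power (Suc n)" using subsetD[OF koszul_space_subset[OF rel] x] .
    then have "coef x [] = 0" by (simp add: tens_power_iff)
    ultimately show ?thesis using right_expand[of x] by simp
  qed
  then show ?case using tens.subspace_0[OF koszul_space_subspace[OF rel]] by blast
qed (rule assms(1))

end

section \<open>Nondegenerate forms\<close>

text \<open>A linear functional on a space of dimension at least two has a nontrivial kernel. The
  bound on the number of generators is exploited through this fact.\<close>

lemma exists_orthogonal:
  fixes c :: "'n::finite \<Rightarrow> 'k::field"
  assumes "2 \<le> CARD('n)"
  obtains a where "(\<Sum>l\<in>UNIV. a l * c l) = 0" "\<exists>l. a l \<noteq> 0"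
proof (cases "\<forall>l. c l = 0")
  case True
  then show ?thesis by (intro that[of "\<lambda>_. 1"]) auto
next
  case False
  then obtain i where i: "c i \<noteq> 0" by blast
  have "\<exists>j. j \<noteq> i"
  proof (rule ccontr)
    assume "\<not> (\<exists>j. j \<noteq> i)"
    then have "(UNIV :: 'n set) = {i}" by auto
    then have "CARD('n) = card {i}" by (rule arg_cong)
    then show False using assms by simp
  qed
  then obtain j where j: "j \<noteq> i" by blast
  \<comment> \<open>The witness is c_i e_j - c_j e_i, nonzero because c_i is.\<close>
  have "(\<Sum>l\<in>UNIV. (if l = j then c i else if l = i then - c j else 0) * c l) =
      (\<Sum>l\<in>{i, j}. (if l = j then c i else if l = i then - c j else 0) * c l)"
    by (rule sum.mono_neutral_right) auto
  also have "\<dots> = 0" using j by simp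
  finally show ?thesis
    using i by (intro that[of "\<lambda>l. if l = j then c i else if l = i then - c j else 0"]) auto
qed

text \<open>Reversal is an anti-automorphism, so u r v becomes a two-sided multiple of the reversed
  relation.\<close>

lemma reversal_rel_ideal:
  assumes "t \<in> rel_ideal (tens_span {b})"
  shows "reversal t \<in> rel_ideal (tens_span {reversal b})"
  using assms unfolding rel_ideal_eq[of "tens_span {b}"]
proof (rule tens_span_linear_image)
  fix s assume "s \<in> rel_gens (tens_span {b})"
  then obtain u r v where s: "s = mon u 1 * r * mon v 1" "r \<in> tens_span {b}" by (rule rel_gensE)
  have "reversal r \<in> tens_span {reversal b}"
    using s(2) by (rule tens_span_linear_image) (auto intro: tens.span_base tens.subspace_span)
  then have "reversal r \<in> rel_ideal (tens_span {reversal b})" by (rule rel_ideal_base)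
  then show "reversal s \<in> rel_ideal (tens_span {reversal b})"
    by (simp add: s reversal_mult rel_ideal_mult mult.assoc)
qed (simp_all add: subspace_rel_ideal)

text \<open>Nondegeneracy is stored as a two-sided inverse \<open>g\<close> of the coefficient
  matrix of the relation. In this form the locale is stable under reversal and the inverse can be
  used in explicit cochains.\<close>

locale form_tensor =
  fixes b :: "('k::field, 'n::finite) tens" and g :: "'n \<Rightarrow> 'n \<Rightarrow> 'k"
  assumes b2: "b \<in> tens_power 2"
    and g_left: "(\<Sum>m\<in>UNIV. g i m * coef b [m, j]) = (if i = j then 1 else 0)"
    and g_right: "(\<Sum>m\<in>UNIV. coef b [i, m] * g m j) = (if i = j then 1 else 0)"
    and card2: "2 \<le> CARD('n)"
begin

abbreviation "S \<equiv> tens_span {b}"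
abbreviation "I \<equiv> rel_ideal S"

sublocale quadratic S
proof
  have "S \<subseteq> tens_power 2" using b2 by (intro tens.span_minimal subspace_tens_power) simp
  then show "relation_space S" by (simp only: relation_space_def tens.subspace_span simp_thms)
qed

text \<open>Reversing the relation transposes its matrix, and the inverse is transposed along.
  Interpreting the locale at the reversed relation turns statements on right multiples into
  statements on left multiples.\<close>

lemma reversed: "form_tensor (reversal b) (\<lambda>i j. g j i)"
proof
  show "reversal b \<in> tens_power 2" using b2 by (simp add: tens_power_iff)
  show "(\<Sum>m\<in>UNIV. g m i * coef (reversal b) [m, j]) = (if i = j then 1 else 0)" for i j
    using g_right[of j i] by (simp add: mult.commute)
  show "(\<Sum>m\<in>UNIV. coef (reversal b) [i, m] * g j m) = (if i = j then 1 else 0)" for i j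
    using g_left[of j i] by (simp add: mult.commute)
qed (rule card2)

lemma b_low: "coef b [] = 0" "coef b [l] = 0"
  using b2 by (simp_all add: tens_power_iff)

lemma rdiv_b_power: "rdiv l b \<in> tens_power 1" and ldiv_b_power: "ldiv l b \<in> tens_power 1"
  using b2 by (simp_all add: tens_power_iff)

lemma rdiv_b: "rdiv n b = (\<Sum>m\<in>UNIV. tens_scale (coef b [m, n]) (gen m))"
  using tens_power_1[OF rdiv_b_power] by simp

lemma ldiv_b: "ldiv m b = (\<Sum>n\<in>UNIV. tens_scale (coef b [m, n]) (gen n))"
  using tens_power_1[OF ldiv_b_power] by simp

lemma b_right: "b = (\<Sum>l\<in>UNIV. rdiv l b * gen l)"
  using right_expand[of b] by (simp add: b_low)

lemma b_inject:
  assumes "\<And>m. (\<Sum>n\<in>UNIV. coef b [m, n] * a n) = 0"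
  shows "a l = 0"
proof -
  have "a l = (\<Sum>n\<in>UNIV. (\<Sum>m\<in>UNIV. g l m * coef b [m, n]) * a n)"
    by (simp add: g_left if_distrib[of "\<lambda>x. x * _"] cong: if_cong)
  also have "\<dots> = (\<Sum>m\<in>UNIV. g l m * (\<Sum>n\<in>UNIV. coef b [m, n] * a n))"
    by (simp add: sum_distrib_left sum_distrib_right mult.assoc) (rule sum.swap)
  finally show ?thesis by (simp add: assms)
qed

lemma sum_rdiv_b:
  "(\<Sum>n\<in>UNIV. tens_scale (a n) (rdiv n b)) =
    (\<Sum>m\<in>UNIV. tens_scale (\<Sum>n\<in>UNIV. coef b [m, n] * a n) (gen m))"
  unfolding rdiv_b
  by (simp add: tens.scale_sum_right tens.scale_sum_left mult.commute) (rule sum.swap)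

text \<open>In a spanning element u b v either v is empty, which gives a left multiple of b, or its
  last letter can be split off and the rest is still in the ideal.\<close>

lemma ideal_decomp:
  assumes "i \<in> I"
  obtains u j where "\<forall>l. j l \<in> I" "i = u * b + (\<Sum>l\<in>UNIV. j l * gen l)"
proof -
  let ?V = "{i. \<exists>u j. (\<forall>l. j l \<in> I) \<and> i = u * b + (\<Sum>l\<in>UNIV. j l * gen l)}"
  have "i \<in> tens_span (rel_gens S)" using assms by (simp only: rel_ideal_eq)
  then have "i \<in> ?V"
  proof (rule tens_span_linear_image[where f = "\<lambda>t. t"])
    fix s assume "s \<in> rel_gens S"
    then obtain u r v where s: "s = mon u 1 * r * mon v 1" "r \<in> S" by (rule rel_gensE)
    obtain c where c: "r = tens_scale c b" using s(2) by (auto simp: tens.span_singleton)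
    show "s \<in> ?V"
    proof (cases v rule: rev_cases)
      case Nil
      have "s = mon u c * b + (\<Sum>l\<in>UNIV. 0 * gen l)"
        by (simp add: s Nil c flip: tens_scale_mult_right) (simp add: tens_scale_mult_left)
      then show ?thesis
        by (intro CollectI exI[of _ "mon u c"] exI[of _ "\<lambda>_. 0"] conjI allI rel_ideal_memI(1))
    next
      case (snoc v' l)
      have "mon u 1 * r * mon v' 1 \<in> I"
        using s(2) by (intro rel_ideal_mult rel_ideal_base)
      moreover have "s = 0 * b + (\<Sum>m\<in>UNIV. (if m = l then mon u 1 * r * mon v' 1 else 0) * gen m)"
        by (simp add: s snoc if_distrib[of "\<lambda>x. x * _"] gen_def mon_mult mult.assoc cong: if_cong)
      ultimately show ?thesis
        by (intro CollectI exI[of _ 0]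
            exI[of _ "\<lambda>m. if m = l then mon u 1 * r * mon v' 1 else 0"] conjI)
          (simp_all add: rel_ideal_memI)
    qed
  next
    show "tens_subspace ?V"
      unfolding tens.subspace_def
    proof (intro conjI ballI allI)
      show "0 \<in> ?V"
        by (intro CollectI exI[of _ 0] exI[of _ "\<lambda>_. 0"]) (simp add: rel_ideal_memI)
      fix s assume "s \<in> ?V"
      then obtain u j where s: "\<forall>l. j l \<in> I" "s = u * b + (\<Sum>l\<in>UNIV. j l * gen l)" by blast
      show "tens_scale c s \<in> ?V" for c
        using s by (intro CollectI exI[of _ "tens_scale c u"] exI[of _ "\<lambda>l. tens_scale c (j l)"])
          (simp add: rel_ideal_memI tens.scale_right_distrib tens.scale_sum_right tens_scale_mult_left)
      fix t assume "t \<in> ?V"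
      then obtain v k where "\<forall>l. k l \<in> I" "t = v * b + (\<Sum>l\<in>UNIV. k l * gen l)" by blast
      then show "s + t \<in> ?V"
        using s by (intro CollectI exI[of _ "u + v"] exI[of _ "\<lambda>l. j l + k l"])
          (simp add: rel_ideal_memI distrib_right sum.distrib)
    qed
  qed simp_all
  then show ?thesis using that by blast
qed

text \<open>Comparing the last letters in \<open>t v = u b + \<Sum> j\<^sub>l x\<^sup>l\<close> gives \<open>v\<^sub>l t \<equiv> u y\<^sub>l\<close> modulo the ideal,
  where the \<open>y\<^sub>l\<close> are linearly independent. As there are at least two generators, some nontrivial
  combination of the \<open>v\<^sub>l\<close> vanishes, so \<open>u\<close> kills a nonzero vector and induction on the degree applies.\<close>

lemma regular_right_homogeneous:
  assumes "t \<in> tens_power n" "t * (\<Sum>l\<in>UNIV. tens_scale (c l) (gen l)) \<in> I" "\<exists>l. c l \<noteq> 0"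
  shows "t \<in> I"
  using assms
proof (induction n arbitrary: t c)
  case 0
  then obtain l where l: "c l \<noteq> 0" by blast
  have "0 = coef (t * (\<Sum>l\<in>UNIV. tens_scale (c l) (gen l))) [l]"
    using rel_ideal_low_coef(2)[OF rel_subset 0(2)] by simp
  also have "\<dots> = coef t [] * c l"
    by (simp add: coef_mult_single lookup_sum coef_gen if_distrib[of "\<lambda>x. _ * x"] cong: if_cong)
  finally have "coef t [] = 0" using l by simp
  then have "t = 0" using tens_power_0[OF 0(1)] by simp
  then show ?case by (simp add: rel_ideal_memI)
next
  case (Suc n)
  obtain u0 j where j: "\<forall>l. j l \<in> I"
    and e: "t * (\<Sum>l\<in>UNIV. tens_scale (c l) (gen l)) = u0 * b + (\<Sum>l\<in>UNIV. j l * gen l)"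
    using ideal_decomp[OF Suc.prems(2)] by blast
  \<comment> \<open>The factor from \<open>ideal_decomp\<close> need not be homogeneous. Comparing
    components of degree n + 2 allows it to be replaced by its component of degree n, to which the
    induction hypothesis applies.\<close>
  define u where "u = hom_part n u0"
  have v1: "(\<Sum>l\<in>UNIV. tens_scale (c l) (gen l)) \<in> tens_power 1"
    by (intro tens_subspace_sum subspace_tens_power tens_subspace_memI(5) gen_in_tens_power)
  have hs: "hom_part m (\<Sum>l\<in>(UNIV :: 'n set). f l) = (\<Sum>l\<in>UNIV. hom_part m (f l))" for m f
    by (rule poly_mapping_eqI) (simp add: lookup_sum)
  have "t * (\<Sum>l\<in>UNIV. tens_scale (c l) (gen l)) = hom_part (Suc n + 1) (t * (\<Sum>l\<in>UNIV. tens_scale (c l) (gen l)))"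
    using hom_part_mult[OF v1, of "Suc n" t] hom_part_id[OF Suc.prems(1)] by simp
  also have "\<dots> = hom_part (n + 2) (u0 * b) + (\<Sum>l\<in>UNIV. hom_part (Suc n + 1) (j l * gen l))"
    unfolding e by (simp add: hs)
  also have "\<dots> = u * b + (\<Sum>l\<in>UNIV. hom_part (Suc n) (j l) * gen l)"
    by (simp only: hom_part_mult[OF b2] hom_part_mult[OF gen_in_tens_power] u_def)
  finally have e': "t * (\<Sum>l\<in>UNIV. tens_scale (c l) (gen l)) =
      u * b + (\<Sum>l\<in>UNIV. hom_part (Suc n) (j l) * gen l)" .
  have key: "tens_scale (c l) t - u * rdiv l b \<in> I" for l
  proof -
    have "tens_scale (c l) t = rdiv l (t * (\<Sum>l\<in>UNIV. tens_scale (c l) (gen l)))"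
      by (simp add: sum_distrib_left rdiv_sum rdiv_mult_gen if_distrib[of "tens_scale _"]
          flip: tens_scale_mult_right cong: if_cong)
    also have "\<dots> = u * rdiv l b + hom_part (Suc n) (j l)"
      unfolding e' by (simp add: rdiv_mult b_low rdiv_sum rdiv_mult_gen)
    finally show ?thesis using rel_ideal_hom_part[OF rel_subset] j by simp
  qed
  obtain a where a: "(\<Sum>l\<in>UNIV. a l * c l) = 0" "\<exists>l. a l \<noteq> 0"
    using exists_orthogonal[OF card2] by blast
  have "(\<Sum>l\<in>UNIV. tens_scale (a l) (tens_scale (c l) t - u * rdiv l b)) \<in> I"
    by (intro tens_subspace_sum subspace_rel_ideal rel_ideal_memI(5) key)
  also have "(\<Sum>l\<in>UNIV. tens_scale (a l) (tens_scale (c l) t - u * rdiv l b)) =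
      tens_scale (\<Sum>l\<in>UNIV. a l * c l) t - u * (\<Sum>l\<in>UNIV. tens_scale (a l) (rdiv l b))"
    by (simp add: tens.scale_right_diff_distrib sum_subtractf tens.scale_sum_left sum_distrib_left
        tens_scale_mult_right)
  finally have "u * (\<Sum>l\<in>UNIV. tens_scale (a l) (rdiv l b)) \<in> I"
    using rel_ideal_memI(4) a(1) by fastforce
  moreover have "\<exists>m. (\<Sum>n\<in>UNIV. coef b [m, n] * a n) \<noteq> 0"
    using b_inject a(2) by blast
  ultimately have "u \<in> I"
    unfolding sum_rdiv_b by (intro Suc.IH[of u]) (simp_all add: u_def hom_part_in)
  obtain l where l: "c l \<noteq> 0" using Suc.prems(3) by blast
  have "tens_scale (c l) t \<in> I"
    using rel_ideal_memI(2)[OF key[of l] rel_ideal_mult(2)[OF \<open>u \<in> I\<close>, of "rdiv l b"]] by simp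
  then have "tens_scale (1 / c l) (tens_scale (c l) t) \<in> I" by (rule rel_ideal_memI)
  then show ?case using l by simp
qed

text \<open>The ideal is graded and the factor has degree one, so the homogeneous case applies to
  every component of \<open>t\<close>.\<close>

lemma regular_right:
  assumes "t * (\<Sum>l\<in>UNIV. tens_scale (c l) (gen l)) \<in> I" "\<exists>l. c l \<noteq> 0"
  shows "t \<in> I"
proof -
  have v1: "(\<Sum>l\<in>UNIV. tens_scale (c l) (gen l)) \<in> tens_power 1"
    by (intro tens_subspace_sum subspace_tens_power tens_subspace_memI(5) gen_in_tens_power)
  have "hom_part n t \<in> I" for n
    using rel_ideal_hom_part[OF rel_subset assms(1), of "n + 1"] assms(2)
    by (intro regular_right_homogeneous[OF hom_part_in]) (simp_all only: hom_part_mult[OF v1])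
  then show ?thesis
    using hom_part_expand[of t] tens_subspace_sum[OF subspace_rel_ideal] by metis
qed

lemma regular_left:
  assumes "(\<Sum>l\<in>UNIV. tens_scale (c l) (gen l)) * t \<in> I" "\<exists>l. c l \<noteq> 0"
  shows "t \<in> I"
proof -
  interpret rv: form_tensor "reversal b" "\<lambda>i j. g j i" by (rule reversed)
  have "reversal t * (\<Sum>l\<in>UNIV. tens_scale (c l) (gen l)) \<in> rv.I"
    using reversal_rel_ideal[OF assms(1)] by (simp add: reversal_mult reversal_sum)
  from reversal_rel_ideal[OF rv.regular_right[OF this assms(2)]] show ?thesis by simp
qed

lemma ideal_decomp_left:
  assumes "i \<in> I"
  obtains u j where "\<forall>l. j l \<in> I" "i = b * u + (\<Sum>l\<in>UNIV. gen l * j l)"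
proof -
  interpret rv: form_tensor "reversal b" "\<lambda>i j. g j i" by (rule reversed)
  obtain u j where j: "\<forall>l. j l \<in> rv.I" "reversal i = u * reversal b + (\<Sum>l\<in>UNIV. j l * gen l)"
    using rv.ideal_decomp[OF reversal_rel_ideal[OF assms]] by blast
  have "i = reversal (u * reversal b + (\<Sum>l\<in>UNIV. j l * gen l))" by (simp flip: j(2))
  then have "i = b * reversal u + (\<Sum>l\<in>UNIV. gen l * reversal (j l))"
    by (simp add: reversal_mult reversal_sum)
  moreover have "\<forall>l. reversal (j l) \<in> I" using j(1) reversal_rel_ideal[of _ "reversal b"] by simp
  ultimately show ?thesis by (intro that[of "\<lambda>l. reversal (j l)" "reversal u"])
qed

text \<open>Membership in R \<otimes> E gives x = b w with w in E, and membership in E \<otimes> R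
  makes each z_l w a multiple d_l b, where z_l is the left quotient of b by l. But z_l w has rank at
  most one while b has rank q >= 2.\<close>

lemma koszul_space_3: "koszul_space S 3 = {0}"
proof -
  have "x = 0" if x: "x \<in> koszul_space S 3" for x
  proof -
    have rs: "x \<in> tens_span {u * v * w | u v w. u \<in> tens_power r \<and> v \<in> S \<and> w \<in> tens_power s}"
      if "r + s = 1" for r s
      using x that by (auto simp: koszul_space_def)
    have sc: "tens_scale (coef t []) 1 = t" if "t \<in> tens_power 0" for t :: "('k, 'n) tens"
      using tens_power_0[OF that] by (metis mon_Nil_1 mult_1_right tens_scale_mon)
    have "x \<in> {b * w | w. w \<in> tens_power 1}"
      using rs[of 0 1, simplified]
    proof (rule tens_span_linear_image[where f = "\<lambda>t. t"])
      fix s assume "s \<in> {u * v * w | u v w. u \<in> tens_power 0 \<and> v \<in> S \<and> w \<in> tens_power (Suc 0)}"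
      then obtain u v w c where s: "s = u * v * w" "u \<in> tens_power 0" "v = tens_scale c b" "w \<in> tens_power 1"
        by (auto simp: tens.span_singleton)
      have "tens_scale d 1 * tens_scale c b * w = b * tens_scale (d * c) w" for d
        by (simp add: mult.commute flip: tens_scale_mult_left tens_scale_mult_right)
      from this[of "coef u []"] have "s = b * tens_scale (coef u [] * c) w" by (simp add: s sc)
      then show "s \<in> {b * w | w. w \<in> tens_power 1}"
        using s(4) subspace_tens_power tens_subspace_memI(5) by blast
    next
      show "tens_subspace {b * w | w. w \<in> tens_power 1}"
        unfolding tens.subspace_def
      proof (intro conjI ballI allI)
        show "0 \<in> {b * w | w. w \<in> tens_power 1}"
          using tens_subspace_memI(1)[OF subspace_tens_power] by (intro CollectI exI[of _ 0]) simp
        fix s assume "s \<in> {b * w | w. w \<in> tens_power 1}"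
        then obtain w where w: "s = b * w" "w \<in> tens_power 1" by blast
        show "tens_scale c s \<in> {b * w | w. w \<in> tens_power 1}" for c
          using w tens_subspace_memI(5)[OF subspace_tens_power]
          by (intro CollectI exI[of _ "tens_scale c w"]) (simp add: tens_scale_mult_right)
        fix t assume "t \<in> {b * w | w. w \<in> tens_power 1}"
        then obtain v where "t = b * v" "v \<in> tens_power 1" by blast
        then show "s + t \<in> {b * w | w. w \<in> tens_power 1}"
          using w tens_subspace_memI(2)[OF subspace_tens_power]
          by (intro CollectI exI[of _ "w + v"]) (simp add: distrib_left)
      qed
    qed simp_all
    then obtain w where w: "x = b * w" "w \<in> tens_power 1" by blast
    have "ldiv l x \<in> S" for l
      using koszul_space_ldiv[of 2 x S l] koszul_space_2[OF rel] x by simp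
    then have "\<forall>l. \<exists>d. ldiv l b * w = tens_scale d b"
      by (auto simp: w ldiv_mult b_low tens.span_singleton)
    then obtain d where d: "\<And>l. ldiv l b * w = tens_scale (d l) b" by metis
    obtain a where a: "(\<Sum>l\<in>UNIV. a l * d l) = 0" "\<exists>l. a l \<noteq> 0"
      using exists_orthogonal[OF card2] by blast
    have lw: "coef (ldiv l b * w) [m, n] = coef b [l, m] * coef w [n]" for l m n
    proof -
      have "rdiv n w = tens_scale (coef w [n]) 1"
        using w(2) sc[of "rdiv n w"] by (simp add: tens_power_iff)
      then have "rdiv n (ldiv l b * w) = tens_scale (coef w [n]) (ldiv l b)"
        using w(2) by (simp add: rdiv_mult tens_power_iff flip: tens_scale_mult_right)
      then have "coef (rdiv n (ldiv l b * w)) [m] = coef (tens_scale (coef w [n]) (ldiv l b)) [m]" by simp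
      then show ?thesis by (simp add: mult.commute)
    qed
    interpret rv: form_tensor "reversal b" "\<lambda>i j. g j i" by (rule reversed)
    \<comment> \<open>As \<open>a\<close> is nonzero, the combination of the z_l with coefficients
      \<open>a\<close> is a nonzero vector, by injectivity of the transposed matrix. Since
      \<open>a\<close> is orthogonal to \<open>d\<close>, its product with \<open>w\<close> is zero,
      so \<open>w\<close> is.\<close>
    obtain m where m: "(\<Sum>l\<in>UNIV. coef b [l, m] * a l) \<noteq> 0"
      using rv.b_inject[of a] a(2) by auto
    have "coef w [n] = 0" for n
    proof -
      have "(\<Sum>l\<in>UNIV. coef b [l, m] * a l) * coef w [n] = (\<Sum>l\<in>UNIV. a l * coef (ldiv l b * w) [m, n])"
        by (simp add: lw sum_distrib_left sum_distrib_right mult_ac)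
      also have "\<dots> = (\<Sum>l\<in>UNIV. a l * d l) * coef b [m, n]"
        by (simp add: d sum_distrib_right mult.assoc)
      finally show ?thesis using m a(1) by simp
    qed
    then have "w = 0" using tens_power_1[OF w(2)] by simp
    then show ?thesis by (simp add: w)
  qed
  then show ?thesis using tens.subspace_0[OF koszul_space_subspace[OF rel]] by blast
qed

end

lemma (in quadratic) cocycles_2_eq:
  assumes "koszul R" "koszul_space R 3 = {0}"
  shows "hom_cocycles A K dK (regular_module A) 2 = lhom A (K 2) (regular_module A)"
proof -
  interpret hc: hom_complex A trivial_module K dK eK "regular_module A"
    by (rule hom_complex_koszul[OF assms(1) left_module_reg])
  have "z (dK 2 x) = \<zero>\<^bsub>A\<^esub>" if "z \<in> lhom A (K 2) (regular_module A)" "x \<in> carrier (K (Suc 2))" for z x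
  proof -
    have "x = \<zero>\<^bsub>K (Suc 2)\<^esub>"
      using that(2) koszul_zero_space[of "Suc 2"] assms(2) by (simp add: koszul_module_simps)
    then have "dK 2 x = \<zero>\<^bsub>K 2\<^esub>"
      using lhom_zero[OF left_module_koszul left_module_koszul hc.PD(3)] by (simp only:)
    then show ?thesis using lhom_zero[OF left_module_koszul left_module_reg that(1)] by simp
  qed
  then show ?thesis by (auto simp: hc.Z_iff)
qed

section \<open>Koszulness, Ext and global dimension for a nondegenerate relation\<close>

context form_tensor
begin

text \<open>The element u \<otimes> b. As K_2 is the line spanned by b, these exhaust A \<otimes>
  K_2, which is free of rank one on \<open>bten 1\<close>.\<close>

definition bten :: "('k, 'n) tens \<Rightarrow> ('k, 'n) word_fun"
  where "bten u = (\<lambda>w. cls S (tens_scale (coef b w) u))"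

lemma b_nonzero: obtains i j where "coef b [i, j] \<noteq> 0"
proof -
  have "\<exists>m j. coef b [m, j] \<noteq> 0"
  proof (rule ccontr)
    assume "\<nexists>m j. coef b [m, j] \<noteq> 0"
    then have "(\<Sum>m\<in>UNIV. g i m * coef b [m, i]) = 0" for i by simp
    then show False using g_left by (metis zero_neq_one)
  qed
  then show ?thesis using that by blast
qed

lemma koszul_2_carrier: "carrier (K 2) = range bten"
proof (intro equalityI subsetI)
  fix f assume f: "f \<in> carrier (K 2)"
  obtain \<kappa> where k: "\<forall>v. \<kappa> v \<in> koszul_space S 2"
    and c: "carrier (K 2) = range (kelt 2 \<kappa>)"
    using koszul_carrier_kelt[of 2] by (metis (no_types))
  have "\<forall>v. \<exists>a. \<kappa> v = tens_scale a b"
    using k unfolding koszul_space_2[OF rel] by (auto simp: tens.span_singleton)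
  then obtain a where a: "\<And>v. \<kappa> v = tens_scale (a v) b" by metis
  obtain t where t: "f = kelt 2 \<kappa> t" using f c by blast
  have "f = bten (\<Sum>v\<in>W 2. tens_scale (a v) (t v))"
    by (simp add: t kelt_def bten_def a tens.scale_sum_right mult.commute)
  then show "f \<in> range bten" by blast
next
  fix f assume "f \<in> range bten"
  then obtain u where f: "f = bten u" by blast
  have "b \<in> koszul_space S 2" unfolding koszul_space_2[OF rel] by (rule tens.span_base) simp
  then have "f \<in> koszul_gens 2" unfolding f bten_def by (rule koszul_gensI)
  then show "f \<in> carrier (K 2)" unfolding koszul_carrier by (rule generate.incl)
qed

lemma bten_in [simp]: "bten u \<in> carrier (K 2)"
  by (simp add: koszul_2_carrier)

lemma bten_smult: "bten u = cls S u \<odot>\<^bsub>K 2\<^esub> bten 1"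
  by (simp add: bten_def koszul_module_simps quad_algebra_simps flip: tens_scale_mult_right)

lemma diff_bten:
  "koszul_diff S (bten u) = (\<lambda>w. cls S (if length w = 1 then u * rdiv (hd w) b else 0))"
proof -
  have "(\<Sum>l\<in>UNIV. tens_scale (coef b (l # w)) u * gen l) =
      (if length w = 1 then u * rdiv (hd w) b else 0)" for w
  proof (cases "length w = 1")
    case True
    then obtain m where m: "w = [m]" by (auto simp: length_Suc_conv)
    show ?thesis
      by (simp add: m rdiv_b sum_distrib_left flip: tens_scale_mult_left tens_scale_mult_right)
  next
    case False
    then have "coef b (l # w) = 0" for l using b2 by (simp add: tens_power_iff)
    then show ?thesis using False by simp
  qed
  then show ?thesis by (simp add: bten_def koszul_diff_cls)
qed

lemma koszul_high: "3 \<le> n \<Longrightarrow> carrier (K n) = {\<lambda>_. cls S 0}"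
  by (intro koszul_zero_space koszul_space_zero_mono[OF koszul_space_3]) simp_all

lemma koszul_form: "koszul S"
  unfolding koszul_def
proof (intro allI impI)
  fix n :: nat assume "1 \<le> n"
  then consider "n = 1" | "n = 2" | "3 \<le> n" by linarith
  then show "{f \<in> carrier (K n). koszul_diff S f = \<zero>\<^bsub>K (n - 1)\<^esub>} = koszul_diff S ` carrier (K (Suc n))"
  proof cases
    case 1
    have "koszul_diff S ` carrier (K 2) = {f \<in> carrier (K 1). koszul_diff S f = (\<lambda>_. cls S 0)}"
    proof (intro equalityI subsetI)
      fix f assume "f \<in> koszul_diff S ` carrier (K 2)"
      then obtain u where f: "f = koszul_diff S (bten u)" by (auto simp: koszul_2_carrier)
      have ub: "u * b = (\<Sum>l\<in>UNIV. u * rdiv l b * gen l)"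
        using arg_cong[OF b_right, of "(*) u"] by (simp only: sum_distrib_left mult.assoc)
      have 0: "(\<Sum>l\<in>UNIV. (if length (l # w) = 1 then u * rdiv (hd (l # w)) b else 0) * gen l) =
          (if w = [] then u * b else 0)" for w
        by (cases w) (simp_all flip: ub)
      have "u * b \<in> I" by (intro rel_ideal_mult rel_ideal_base tens.span_base) simp
      then have "koszul_diff S f = (\<lambda>_. cls S 0)"
        unfolding f diff_bten koszul_diff_cls 0 by (intro ext) (simp add: cls_eq_zero_iff rel_ideal_memI)
      moreover have "f \<in> carrier (K 1)"
        unfolding f using koszul_diff_closed_low[of 1 "bten u"] bten_in[of u] by (simp add: numeral_2_eq_2)
      ultimately show "f \<in> {f \<in> carrier (K 1). koszul_diff S f = (\<lambda>_. cls S 0)}" by simp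
    next
      fix f assume "f \<in> {f \<in> carrier (K 1). koszul_diff S f = (\<lambda>_. cls S 0)}"
      then have fK: "f \<in> carrier (K 1)" and fd: "koszul_diff S f = (\<lambda>_. cls S 0)" by auto
      obtain t where f: "f = (\<lambda>w. cls S (t w))" and t: "\<And>w. length w \<noteq> 1 \<Longrightarrow> t w = 0"
        using koszul_memE[OF fK] by blast
      have "cls S (\<Sum>l\<in>UNIV. t [l] * gen l) = cls S 0"
        using fun_cong[OF fd, of "[]"] by (simp add: f koszul_diff_cls)
      then have "(\<Sum>l\<in>UNIV. t [l] * gen l) \<in> I" by (simp add: cls_eq_zero_iff)
      then obtain u j where j: "\<forall>l. j l \<in> I"
        and e: "(\<Sum>l\<in>UNIV. t [l] * gen l) = u * b + (\<Sum>l\<in>UNIV. j l * gen l)" by (rule ideal_decomp)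
      \<comment> \<open>Last letters in the two expressions are compared; modulo the ideal the cycle
        has the coordinates of d(u \<otimes> b).\<close>
      have *: "t [m] = u * rdiv m b + j m" for m
        using arg_cong[OF e, of "rdiv m"] by (simp add: rdiv_sum rdiv_mult_gen rdiv_mult b_low)
      have "f w = koszul_diff S (bten u) w" for w
      proof (cases "length w = 1")
        case True
        then obtain m where m: "w = [m]" by (auto simp: length_Suc_conv)
        show ?thesis using j by (simp add: m f diff_bten * cls_eq_iff)
      qed (simp add: f diff_bten t)
      then have "f = koszul_diff S (bten u)" by (rule ext)
      then show "f \<in> koszul_diff S ` carrier (K 2)"
        using imageI[OF bten_in[of u], of "koszul_diff S"] by (simp only:)
    qed
    then show ?thesis using 1 by (simp add: koszul_module_simps numeral_2_eq_2)
  next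
    case 2
    \<comment> \<open>A nonzero entry in column m makes the linear tensor \<open>rdiv m b\<close>
      nonzero, so multiplication by it is injective on the quotient.\<close>
    obtain i m where im: "coef b [i, m] \<noteq> 0" by (rule b_nonzero)
    have uI: "u \<in> I" if u: "koszul_diff S (bten u) = (\<lambda>_. cls S 0)" for u
    proof (rule regular_right)
      have "cls S (u * rdiv m b) = cls S 0"
        using fun_cong[OF u, of "[m]"] by (simp add: diff_bten)
      then show "u * (\<Sum>l\<in>UNIV. tens_scale (coef b [l, m]) (gen l)) \<in> I"
        by (simp add: cls_eq_zero_iff flip: rdiv_b)
      show "\<exists>l. coef b [l, m] \<noteq> 0" using im by blast
    qed
    have "bten u = (\<lambda>_. cls S 0)" if "koszul_diff S (bten u) = (\<lambda>_. cls S 0)" for u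
      using uI[OF that] unfolding bten_def by (intro ext) (simp add: cls_eq_zero_iff rel_ideal_memI)
    then have "f = (\<lambda>_. cls S 0)" if "f \<in> carrier (K 2)" "koszul_diff S f = (\<lambda>_. cls S 0)" for f
      using that unfolding koszul_2_carrier by blast
    then have "{f \<in> carrier (K 2). koszul_diff S f = (\<lambda>_. cls S 0)} = {\<lambda>_. cls S 0}"
      using koszul_zero_in[of 2] koszul_diff_zero by blast
    then show ?thesis
      using 2 koszul_high[of 3] by (simp add: koszul_module_simps koszul_diff_zero numeral_3_eq_3 numeral_2_eq_2)
  next
    case 3
    show ?thesis
      unfolding koszul_high[OF 3] koszul_high[OF le_SucI[OF 3]] koszul_module_simps
      by (auto simp only: koszul_diff_zero image_insert image_empty mem_Collect_eq insert_iff empty_iff)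
  qed
qed

lemma hom_complex_regular: "hom_complex A trivial_module K dK eK (regular_module A)"
  by (rule hom_complex_koszul[OF koszul_form left_module_reg])

sublocale hc: hom_complex A trivial_module K dK eK "regular_module A"
  by (rule hom_complex_regular)

lemma d_cls:
  assumes "(\<lambda>w. cls S (t w)) \<in> carrier (K (Suc n))"
  shows "dK n (\<lambda>w. cls S (t w)) = (\<lambda>w. cls S (\<Sum>l\<in>UNIV. t (l # w) * gen l))"
  using assms by (simp add: dK_def koszul_diff_cls)

lemma evm_d:
  assumes "(\<lambda>w. cls S (t w)) \<in> carrier (K (Suc n))"
  shows "evm n s (dK n (\<lambda>w. cls S (t w))) = cls S (\<Sum>v\<in>W n. \<Sum>l\<in>UNIV. t (l # v) * gen l * s v)"
proof -
  have "(\<lambda>w. cls S (\<Sum>l\<in>UNIV. t (l # w) * gen l)) \<in> carrier (K n)"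
    using hc.d_closed[OF assms] by (simp add: d_cls[OF assms])
  then show ?thesis by (simp add: d_cls[OF assms] evm_cls sum_distrib_right)
qed

text \<open>A 0-cocycle is right multiplication by some s with x^l s = 0 in A for every l, and
  generators are regular from the left.\<close>

lemma Z0_trivial: "hc.Z 0 \<subseteq> hc.B 0"
proof
  fix z assume z: "z \<in> hc.Z 0"
  then obtain s where s: "z = evm 0 s"
    using lhom_low_evm[of 0 z] by (auto simp: hc.Z_iff)
  have e: "(\<lambda>w. cls S (if w = [l] then 1 else 0)) \<in> carrier (K (Suc 0))" for l
    by (rule K_lowI) auto
  have "cls S (gen l * s []) = cls S 0" for l
    using z evm_d[OF e, of s l] e[of l] by (simp add: hc.Z_iff s quad_algebra_simps
        if_distrib[of "\<lambda>x. x * _"] cong: if_cong)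
  then have "gen l * s [] \<in> I" for l by (simp add: cls_eq_zero_iff)
  moreover have "(\<Sum>i\<in>UNIV. tens_scale (if i = l then 1 else 0) (gen i)) = (gen l :: ('k, 'n) tens)" for l
    by (simp add: if_distrib[of "\<lambda>c. tens_scale c _"] cong: if_cong)
  \<comment> \<open>Here \<open>undefined\<close> is simply some letter; any one generator would
    do.\<close>
  ultimately have "(\<Sum>i\<in>UNIV. tens_scale (if i = undefined then 1 else 0) (gen i)) * s [] \<in> I"
    by (simp only:)
  then have s0: "s [] \<in> I" by (rule regular_left) (rule exI[of _ undefined], simp)
  have "evm 0 s f = \<zero>\<^bsub>A\<^esub>" if f: "f \<in> carrier (K 0)" for f
  proof -
    obtain t where t: "f = (\<lambda>w. cls S (t w))" using koszul_memE[OF f] by blast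
    show ?thesis
      using f evm_cls[of t 0 s] rel_ideal_mult(1)[OF s0] by (simp add: t quad_algebra_simps cls_eq_zero_iff)
  qed
  then have "z = (\<lambda>x\<in>carrier (K 0). \<zero>\<^bsub>regular_module A\<^esub>)"
    unfolding s by (intro lhom_ext[OF evm_lhom lhom_zero_map[OF left_module_koszul left_module_reg]]) simp
  then show "z \<in> hc.B 0" by simp
qed

text \<open>The right quotients of b form another basis of E, and \<open>g\<close> is the matrix of
  the change of basis back to the generators.\<close>

lemma sum_gen_g: "(\<Sum>n\<in>UNIV. tens_scale (g n l) (rdiv n b)) = gen l"
proof -
  have "(\<Sum>n\<in>UNIV. tens_scale (g n l) (rdiv n b)) = (\<Sum>m\<in>UNIV. tens_scale (if m = l then 1 else 0) (gen m))"
    unfolding sum_rdiv_b by (simp add: g_right)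
  then show ?thesis by (simp add: if_distrib[of "\<lambda>c. tens_scale c _"] cong: if_cong)
qed

lemma evm_d_bten: "evm 1 s (dK 1 (bten u)) = cls S (u * (\<Sum>m\<in>UNIV. rdiv m b * s [m]))"
proof -
  have d: "dK 1 (bten u) = (\<lambda>w. cls S (if length w = 1 then u * rdiv (hd w) b else 0))"
    using bten_in[of u] by (simp add: dK_def diff_bten numeral_2_eq_2)
  have "dK 1 (bten u) \<in> carrier (K 1)"
    using hc.d_closed[of "bten u" 1] bten_in[of u] by (simp add: numeral_2_eq_2)
  then show ?thesis
    unfolding d using evm_cls[of _ 1 s] by (simp add: sum_words_1 sum_distrib_left mult.assoc)
qed

text \<open>The cocycle condition says that the sum of y_m s_m lies in the ideal, with y_m the right
  quotients of b. Comparison of first letters with \<open>b * u\<close> gives B s = B (x u) modulo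
  the ideal, hence s_m = x^m u in A, and this is the coboundary of right multiplication by
  u.\<close>

lemma Z1_trivial: "hc.Z 1 \<subseteq> hc.B 1"
proof
  fix z assume z: "z \<in> hc.Z 1"
  then obtain s where s: "z = evm 1 s"
    using lhom_low_evm[of 1 z] by (auto simp: hc.Z_iff)
  have "z (dK 1 (bten 1)) = \<zero>\<^bsub>A\<^esub>"
    using z bten_in[of 1] by (simp add: hc.Z_iff numeral_2_eq_2)
  then have "cls S (\<Sum>m\<in>UNIV. rdiv m b * s [m]) = cls S 0"
    using evm_d_bten[of s 1] by (simp add: s quad_algebra_simps)
  then have "(\<Sum>m\<in>UNIV. rdiv m b * s [m]) \<in> I" by (simp only: cls_eq_zero_iff)
  then obtain u j where j: "\<forall>l. j l \<in> I"
    and e: "(\<Sum>m\<in>UNIV. rdiv m b * s [m]) = b * u + (\<Sum>l\<in>UNIV. gen l * j l)" by (rule ideal_decomp_left)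
  have y: "ldiv l (rdiv m b * t) = tens_scale (coef b [l, m]) t" for l m t
    by (simp add: rdiv_b sum_distrib_right ldiv_sum ldiv_gen_mult if_distrib[of "tens_scale _"]
        flip: tens_scale_mult_left cong: if_cong)
  have eq: "(\<Sum>m\<in>UNIV. tens_scale (coef b [l, m]) (s [m])) = ldiv l b * u + j l" for l
    using arg_cong[OF e, of "ldiv l"] by (simp add: ldiv_sum y ldiv_mult b_low ldiv_gen_mult)
  have "(\<Sum>m\<in>UNIV. tens_scale (coef b [l, m]) (s [m] - gen m * u)) = j l" for l
    using eq[of l] by (simp add: tens.scale_right_diff_distrib sum_subtractf ldiv_b sum_distrib_right
        tens_scale_mult_left)
  then have jl: "(\<Sum>m\<in>UNIV. tens_scale (coef b [l, m]) (s [m] - gen m * u)) \<in> I" for l using j by simp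
  \<comment> \<open>The matrix \<open>g\<close> is applied to the relations \<open>jl\<close> to
    isolate a single multiplier.\<close>
  have sm: "s [i] - gen i * u \<in> I" for i
  proof -
    have "(\<Sum>l\<in>UNIV. tens_scale (g i l) (\<Sum>m\<in>UNIV. tens_scale (coef b [l, m]) (s [m] - gen m * u))) =
        (\<Sum>m\<in>UNIV. tens_scale (\<Sum>l\<in>UNIV. g i l * coef b [l, m]) (s [m] - gen m * u))"
      by (simp add: tens.scale_sum_right tens.scale_sum_left) (rule sum.swap)
    also have "\<dots> = s [i] - gen i * u"
      by (simp add: g_left if_distrib[of "\<lambda>c. tens_scale c _"] cong: if_cong)
    finally have "s [i] - gen i * u =
        (\<Sum>l\<in>UNIV. tens_scale (g i l) (\<Sum>m\<in>UNIV. tens_scale (coef b [l, m]) (s [m] - gen m * u)))" ..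
    then show ?thesis
      by (simp only:) (intro tens_subspace_sum[OF subspace_rel_ideal] rel_ideal_memI(5) jl)
  qed
  have "evm 1 s f = evm 0 (\<lambda>_. u) (dK 0 f)" if f: "f \<in> carrier (K (Suc 0))" for f
  proof -
    obtain t where t: "f = (\<lambda>w. cls S (t w))" using koszul_memE[OF f] by blast
    have "(\<Sum>m\<in>UNIV. t [m] * s [m]) - (\<Sum>m\<in>UNIV. t [m] * gen m * u) = (\<Sum>m\<in>UNIV. t [m] * (s [m] - gen m * u))"
      by (simp add: right_diff_distrib sum_subtractf mult.assoc)
    also have "\<dots> \<in> I"
      by (intro tens_subspace_sum[OF subspace_rel_ideal] rel_ideal_mult sm)
    finally show ?thesis
      using f evm_d[of t 0 "\<lambda>_. u"] evm_cls[of t "Suc 0" s] by (simp add: t sum_words_1 cls_eq_iff)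
  qed
  from hc.B_SucI[OF evm_lhom this] have "(\<lambda>f\<in>carrier (K (Suc 0)). evm 1 s f) \<in> hc.B (Suc 0)" .
  then show "z \<in> hc.B 1" by (simp add: s evm_def cong: restrict_cong)
qed

lemma Z2_eq: "hc.Z 2 = lhom A (K 2) (regular_module A)"
  by (rule cocycles_2_eq[OF koszul_form koszul_space_3])

text \<open>A coboundary takes at 1 \<otimes> b a value of the form sum of y_m s_m, without constant
  term since the y_m are linear. Conversely the y_m generate all of E, so every element of the
  augmentation ideal has this form.\<close>

lemma B2_iff:
  assumes z: "z \<in> hc.Z 2"
  shows "z \<in> hc.B 2 \<longleftrightarrow> augmentation (z (bten 1)) = 0"
proof -
  have zl: "z \<in> lhom A (K 2) (regular_module A)" using z by (simp add: Z2_eq)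
  have zb: "z (bten u) = cls S u \<otimes>\<^bsub>A\<^esub> z (bten 1)" for u
    using lhomD(4)[OF zl, of "cls S u" "bten 1"] by (simp flip: bten_smult)
  show ?thesis
  proof
    assume "z \<in> hc.B 2"
    then obtain h where h: "h \<in> lhom A (K 1) (regular_module A)" "z = (\<lambda>x\<in>carrier (K 2). h (dK 1 x))"
      by (auto simp: numeral_2_eq_2)
    obtain s where s: "h = evm 1 s" using lhom_low_evm[OF _ h(1)] by auto
    have "z (bten 1) = cls S (\<Sum>m\<in>UNIV. rdiv m b * s [m])" using evm_d_bten[of s 1] by (simp add: h(2) s)
    then show "augmentation (z (bten 1)) = 0"
      using b2 by (simp add: lookup_sum coef_mult_Nil tens_power_iff)
  next
    assume a: "augmentation (z (bten 1)) = 0"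
    have "z (bten 1) \<in> carrier A" using lhomD(2)[OF zl bten_in] by simp
    then obtain r where r: "z (bten 1) = cls S r" by (rule quad_carrierE)
    then have r0: "coef r [] = 0" using a by simp
    \<comment> \<open>Write r as the sum of x^l times its left quotients and express x^l in the
      basis y_n by \<open>sum_gen_g\<close>. The multiplier is indexed by words of length one,
      whence \<open>hd v\<close>.\<close>
    define s where "s v = (\<Sum>l\<in>UNIV. tens_scale (g (hd v) l) (ldiv l r))" for v
    have "(\<Sum>n\<in>UNIV. rdiv n b * s [n]) = (\<Sum>l\<in>UNIV. (\<Sum>n\<in>UNIV. tens_scale (g n l) (rdiv n b)) * ldiv l r)"
      by (simp add: s_def sum_distrib_left sum_distrib_right flip: tens_scale_mult_left tens_scale_mult_right)
        (rule sum.swap)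
    also have "\<dots> = r" using left_expand[of r] by (simp add: sum_gen_g r0)
    finally have sr: "(\<Sum>n\<in>UNIV. rdiv n b * s [n]) = r" .
    have "z f = evm 1 s (dK 1 f)" if f: "f \<in> carrier (K (Suc 1))" for f
    proof -
      obtain u where u: "f = bten u" using f koszul_2_carrier by (auto simp: numeral_2_eq_2)
      show ?thesis unfolding u evm_d_bten sr zb[of u] r by (simp add: quad_algebra_simps)
    qed
    from hc.B_SucI[OF evm_lhom this] have "(\<lambda>f\<in>carrier (K 2). z f) \<in> hc.B 2"
      by (simp add: numeral_2_eq_2)
    moreover have "(\<lambda>f\<in>carrier (K 2). z f) = z"
      using lhomD(1)[OF zl] by (simp add: PiE_def extensional_restrict)
    ultimately show "z \<in> hc.B 2" by simp
  qed
qed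

lemma Z2_surj: obtains z where "z \<in> hc.Z 2" "augmentation (z (bten 1)) = c"
proof -
  obtain i j where ij: "coef b [i, j] \<noteq> 0" by (rule b_nonzero)
  \<comment> \<open>Reading off one nonvanishing coordinate of b and rescaling gives any prescribed
    constant term.\<close>
  let ?z = "evm 2 (\<lambda>v. if v = [i, j] then mon [] (c / coef b [i, j]) else 0)"
  have "?z (bten 1) = cls S (tens_scale (coef b [i, j]) (mon [] (c / coef b [i, j])))"
    using evm_cls[of "\<lambda>w. tens_scale (coef b w) 1" 2] bten_in[of 1]
    by (simp add: bten_def if_distrib[of "tens_scale _"] numeral_2_eq_2 cong: if_cong
        flip: tens_scale_mult_left)
  then show ?thesis
    using ij by (intro that[of ?z]) (simp_all add: Z2_eq evm_lhom coef_mon)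
qed

lemma left_module_k: "left_module field_ring (regular_module (field_ring :: 'k ring))"
  by (rule left_module_regular[OF ring_field_ring])

text \<open>The isomorphism is induced by evaluation at 1 \<otimes> b followed by the augmentation;
  \<open>B2_iff\<close> identifies its kernel and \<open>Z2_surj\<close> gives surjectivity.\<close>

lemma Ext_2_isomorphic:
  "isomorphic_modules field_ring (Ext TYPE(('k, 'n) word_fun) A trivial_module (regular_module A) 2)
    (regular_module field_ring)"
  unfolding hc.Ext_isomorphic_iff[OF left_module_trivial left_module_k]
proof (intro bexI conjI ballI)
  let ?f = "\<lambda>z\<in>carrier (hc.HZ 2). augmentation (z (bten 1))"
  have zc: "\<exists>r. z (bten 1) = cls S r" if "z \<in> hc.Z 2" for z
    using lhomD(2)[of z A "K 2" "regular_module A" "bten 1"] that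
    by (auto simp: Z2_eq quad_algebra_simps)
  show "?f \<in> lhom field_ring (hc.HZ 2) (regular_module field_ring)"
  proof (rule lhom_restrictI[OF hc.left_module_HZ])
    fix z assume z: "z \<in> carrier (hc.HZ 2)"
    then obtain r where r: "z (bten 1) = cls S r" using zc by auto
    show "augmentation ((z \<oplus>\<^bsub>hc.HZ 2\<^esub> y) (bten 1)) =
        augmentation (z (bten 1)) \<oplus>\<^bsub>regular_module field_ring\<^esub> augmentation (y (bten 1))"
      if y: "y \<in> carrier (hc.HZ 2)" for y
    proof -
      obtain q where "y (bten 1) = cls S q" using zc y by auto
      then show ?thesis by (simp add: r quad_algebra_simps lookup_add)
    qed
    show "augmentation ((c \<odot>\<^bsub>hc.HZ 2\<^esub> z) (bten 1)) =
        c \<odot>\<^bsub>regular_module field_ring\<^esub> augmentation (z (bten 1))" for c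
      by (simp add: r quad_algebra_simps flip: tens_scale_mult_left)
  qed simp
  show "?f ` hc.Z 2 = carrier (regular_module field_ring)"
  proof -
    have "c \<in> ?f ` hc.Z 2" for c
      using Z2_surj[of c] by (auto intro: image_eqI[of _ _ z for z])
    then show ?thesis by auto
  qed
  show "?f z = \<zero>\<^bsub>regular_module field_ring\<^esub> \<longleftrightarrow> z \<in> hc.B 2" if "z \<in> hc.Z 2" for z
    using B2_iff[OF that] that by simp
qed

lemma Z_high_trivial: "3 \<le> n \<Longrightarrow> hc.Z n \<subseteq> hc.B n"
  by (rule hc.Z_subset_B_zero_module) (simp add: koszul_high koszul_module_simps)

lemma not_Z2_trivial: "\<not> hc.Z 2 \<subseteq> hc.B 2"
proof
  assume sub: "hc.Z 2 \<subseteq> hc.B 2"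
  obtain z where z: "z \<in> hc.Z 2" "augmentation (z (bten 1)) = 1" by (rule Z2_surj)
  show False using B2_iff[OF z(1)] subsetD[OF sub z(1)] z(2) by simp
qed

text \<open>The Koszul resolution bounds the dimension from above. A shorter resolution has zero
  module in degree 2, so by comparison every 2-cocycle of the Koszul complex would be a
  coboundary.\<close>

lemma global_dim_form: "global_dim A = 2"
proof -
  let ?D = "{enat D | D. \<exists>(P :: nat \<Rightarrow> (('k, 'n) tens set, ('k, 'n) word_fun) module) d e.
    projective_resolution A trivial_module P d e \<and> (\<forall>n>D. carrier (P n) = {\<zero>\<^bsub>P n\<^esub>})}"
  have "carrier (K n) = {\<zero>\<^bsub>K n\<^esub>}" if "n > 2" for n
    using that by (simp add: koszul_high koszul_module_simps)
  then have "enat 2 \<in> ?D" using hc.res by blast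
  moreover have "enat 2 \<le> D" if "D \<in> ?D" for D
  proof (rule ccontr)
    assume D2: "\<not> enat 2 \<le> D"
    from that obtain D' and P :: "nat \<Rightarrow> (('k, 'n) tens set, ('k, 'n) word_fun) module" and d e
      where D': "D = enat D'" and P: "projective_resolution A trivial_module P d e"
        and z: "\<forall>n>D'. carrier (P n) = {\<zero>\<^bsub>P n\<^esub>}" by blast
    interpret P: hom_complex A trivial_module P d e "regular_module A"
      by (intro hom_complex.intro field_algebra_axioms hom_complex_axioms.intro P left_module_reg)
    have "P.Z 2 \<subseteq> P.B 2" using D2 D' z by (intro P.Z_subset_B_zero_module) simp
    then have "hc.Z 2 \<subseteq> hc.B 2"
      by (rule cohomology_trivial_transfer[OF hom_complex_regular P.hom_complex_axioms left_module_trivial])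
    then show False using not_Z2_trivial by blast
  qed
  ultimately have "Inf ?D = enat 2" by (intro antisym Inf_lower Inf_greatest)
  then show ?thesis by (simp add: global_dim_def proj_dim_def numeral_eq_enat)
qed

lemma gorenstein_form: "gorenstein A"
proof -
  have "hc.Z n \<subseteq> hc.B n" if "n \<noteq> 2" for n
  proof -
    have "n = 0 \<or> n = 1 \<or> 3 \<le> n" using that by arith
    then show ?thesis using Z0_trivial Z1_trivial Z_high_trivial[of n] by (elim disjE) (simp_all only:)
  qed
  then show ?thesis
    unfolding gorenstein_def Let_def
    using global_dim_form Ext_2_isomorphic hc.Ext_trivial_iff[OF left_module_trivial]
    by (intro exI[of _ 2]) (simp add: numeral_eq_enat)
qed

end

section \<open>Koszul Gorenstein algebras of global dimension two\<close>

lemma matrix_right_inverse_left: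
  fixes f h :: "'n::finite \<Rightarrow> 'n \<Rightarrow> 'k::field"
  assumes "\<And>i j. (\<Sum>m\<in>UNIV. f i m * h m j) = (if i = j then 1 else 0)"
  shows "(\<Sum>m\<in>UNIV. h i m * f m j) = (if i = j then 1 else 0)"
proof -
  let ?F = "(\<chi> i j. f i j) :: 'k ^ 'n ^ 'n" and ?H = "(\<chi> i j. h i j) :: 'k ^ 'n ^ 'n"
  have "?F ** ?H = mat 1" using assms by (simp add: matrix_matrix_mult_def mat_def vec_eq_iff)
  then have "?H ** ?F = mat 1" by (simp add: matrix_left_right_inverse)
  then show ?thesis by (simp add: matrix_matrix_mult_def mat_def vec_eq_iff)
qed

text \<open>The infimum over a nonempty set is attained, so a global dimension of two supplies an
  actual resolution of length two.\<close>

lemma Inf_enat_in: "V \<noteq> {} \<Longrightarrow> Inf V \<in> V" for V :: "enat set"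
  by (auto simp: Inf_enat_def intro: LeastI)

locale gorenstein2 = quadratic R for R :: "('k::field, 'n::finite) tens set" +
  assumes kos: "koszul R" and gd: "global_dim (quad_algebra R) = 2"
    and gor: "gorenstein (quad_algebra R)"
begin

lemma hom_complex_into: "left_module A N \<Longrightarrow> hom_complex A trivial_module K dK eK N"
  by (rule hom_complex_koszul[OF kos])

text \<open>A resolution of length two makes degree 3 vanish for every coefficient module, and
  comparison carries this to the Koszul resolution. The coefficients stay general because the
  application takes the trivial module.\<close>

lemma cocycles_3_trivial:
  assumes "left_module A N"
  shows "hom_cocycles A K dK N 3 \<subseteq> hom_coboundaries A K dK N 3"
proof -
  let ?D = "{enat D | D. \<exists>(P :: nat \<Rightarrow> (('k, 'n) tens set, ('k, 'n) word_fun) module) d e.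
    projective_resolution A trivial_module P d e \<and> (\<forall>n>D. carrier (P n) = {\<zero>\<^bsub>P n\<^esub>})}"
  have D: "Inf ?D = enat 2" using gd by (simp add: global_dim_def proj_dim_def numeral_eq_enat)
  then have "?D \<noteq> {}" by (metis Inf_enat_def enat.distinct(1))
  then have "Inf ?D \<in> ?D" by (rule Inf_enat_in)
  then have "enat 2 \<in> ?D" by (simp only: D)
  then obtain P :: "nat \<Rightarrow> (('k, 'n) tens set, ('k, 'n) word_fun) module" and d e
    where P: "projective_resolution A trivial_module P d e"
      and z: "\<forall>n>2. carrier (P n) = {\<zero>\<^bsub>P n\<^esub>}" by auto
  interpret P: hom_complex A trivial_module P d e N
    by (intro hom_complex.intro field_algebra_axioms hom_complex_axioms.intro P assms)
  have "P.Z 3 \<subseteq> P.B 3" using z by (intro P.Z_subset_B_zero_module) simp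
  then show ?thesis
    by (rule cohomology_trivial_transfer[OF hom_complex_into[OF assms] P.hom_complex_axioms left_module_trivial])
qed

text \<open>The element 1 \<otimes> k of A \<otimes> K_n.\<close>

definition kten :: "('k, 'n) tens \<Rightarrow> ('k, 'n) word_fun"
  where "kten k = (\<lambda>w. cls R (tens_scale (coef k w) 1))"

lemma kten_in: "k \<in> koszul_space R n \<Longrightarrow> kten k \<in> carrier (K n)"
  unfolding koszul_carrier kten_def by (intro generate.incl koszul_gensI)

text \<open>The Koszul differential has coefficients in the augmentation ideal, so on cochains with
  values in the trivial module it vanishes: the coordinates of \<open>K\<^sub>3\<close> are cocycles but no coboundaries.\<close>

lemma koszul_space_3_zero: "koszul_space R 3 = {0}"
proof -
  interpret T: hom_complex A trivial_module K dK eK trivial_module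
    by (rule hom_complex_into[OF left_module_trivial])
  have "coef k u = 0" if k: "k \<in> koszul_space R 3" for k u
  proof -
    let ?\<phi> = "\<lambda>f\<in>carrier (K 3). augmentation (f u)"
    have \<phi>: "?\<phi> \<in> lhom A (K 3) trivial_module"
    proof (rule lhom_restrictI[OF left_module_koszul])
      fix f assume f: "f \<in> carrier (K 3)"
      obtain s where s: "f = (\<lambda>w. cls R (s w))" using koszul_memE[OF f] by blast
      show "augmentation ((f \<oplus>\<^bsub>K 3\<^esub> h) u) =
          augmentation (f u) \<oplus>\<^bsub>trivial_module\<^esub> augmentation (h u)"
        if h: "h \<in> carrier (K 3)" for h
      proof -
        obtain t where t: "h = (\<lambda>w. cls R (t w))" using koszul_memE[OF h] by blast
        show ?thesis by (simp add: s t koszul_module_simps quad_algebra_simps lookup_add)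
      qed
      show "augmentation ((a \<odot>\<^bsub>K 3\<^esub> f) u) = a \<odot>\<^bsub>trivial_module\<^esub> augmentation (f u)"
        if a: "a \<in> carrier A" for a
      proof -
        obtain c where "a = cls R c" using a by (rule quad_carrierE)
        then show ?thesis by (simp add: s koszul_module_simps quad_algebra_simps coef_mult_Nil)
      qed
    qed simp
    have "?\<phi> (dK 3 f) = 0" if f: "f \<in> carrier (K (Suc 3))" for f
    proof -
      obtain s where s: "f = (\<lambda>w. cls R (s w))" using koszul_memE[OF f] by blast
      have "dK 3 f = koszul_diff R f" using f by (simp add: dK_def)
      then show ?thesis
        using T.d_closed[OF f] by (simp add: s koszul_diff_cls lookup_sum coef_mult_Nil coef_gen)
    qed
    then have "?\<phi> \<in> T.Z 3" using \<phi> by (simp add: T.Z_iff)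
    then have "?\<phi> \<in> T.B 3" using cocycles_3_trivial[OF left_module_trivial] by blast
    then obtain h where h: "h \<in> lhom A (K 2) trivial_module"
      and e: "?\<phi> = (\<lambda>x\<in>carrier (K 3). h (dK 2 x))" by (auto simp: numeral_3_eq_3 numeral_2_eq_2)
    have l: "ldiv l k \<in> koszul_space R 2" for l
      using koszul_space_ldiv[of 2 k R l] k by simp
    \<comment> \<open>The differential of 1 \<otimes> k is the sum of x^l (1 \<otimes> k_l), with
      k_l the left quotient of k by l, again in the Koszul space. A linear map to the trivial module
      kills each term because x^l acts as zero; partial sums over \<open>F\<close> are kept inside
      the module during the induction.\<close>
    have "(\<lambda>w. cls R (\<Sum>l\<in>F. tens_scale (coef k (l # w)) (gen l))) \<in> carrier (K 2) \<and>
        h (\<lambda>w. cls R (\<Sum>l\<in>F. tens_scale (coef k (l # w)) (gen l))) = 0" if "finite F" for F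
      using that
    proof (induction F rule: finite_induct)
      case empty
      then show ?case
        using koszul_zero_in[of 2] lhom_zero[OF left_module_koszul left_module_trivial h]
        by (simp add: koszul_module_simps)
    next
      case (insert l F)
      let ?f = "\<lambda>w. cls R (\<Sum>l\<in>F. tens_scale (coef k (l # w)) (gen l))"
      let ?g = "cls R (gen l) \<odot>\<^bsub>K 2\<^esub> kten (ldiv l k)"
      have g: "?g \<in> carrier (K 2)"
        by (rule left_module.smult_closed[OF left_module_koszul cls_in_carrier kten_in[OF l]])
      have "h ?g = 0"
        using lhomD(4)[OF h cls_in_carrier kten_in[OF l], of "gen l" l] by (simp add: coef_gen)
      moreover have "(\<lambda>w. cls R (\<Sum>l\<in>insert l F. tens_scale (coef k (l # w)) (gen l))) = ?g \<oplus>\<^bsub>K 2\<^esub> ?f"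
        using insert.hyps
        by (simp add: koszul_module_simps kten_def quad_algebra_simps flip: tens_scale_mult_right)
      ultimately show ?case
        using insert.IH g lhomD(3)[OF h g, of ?f]
          abelian_monoid.a_closed[OF abelian_group.axioms(1)[OF left_moduleD(2)[OF left_module_koszul]] g, of ?f]
        by simp
    qed
    from this[of UNIV] have "h (dK 2 (kten k)) = 0"
      using kten_in[OF k] by (simp add: dK_def koszul_diff_cls kten_def flip: tens_scale_mult_left)
    then show ?thesis
      using fun_cong[OF e, of "kten k"] kten_in[OF k] by (simp add: kten_def)
  qed
  then have "k = 0" if "k \<in> koszul_space R 3" for k using that by (intro poly_mapping_eqI) simp
  then show ?thesis using tens.subspace_0[OF koszul_space_subspace[OF rel]] by blast
qed

sublocale hc: hom_complex A trivial_module K dK eK "regular_module A"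
  by (rule hom_complex_into[OF left_module_reg])

lemma evm_in_Z2: "evm 2 s \<in> hc.Z 2"
  unfolding cocycles_2_eq[OF kos koszul_space_3_zero] by (rule evm_lhom)

lemma koszul_2: "koszul_space R 2 = R"
  by (rule koszul_space_2[OF rel])

text \<open>The multipliers \<open>s m\<close> are the values of the bounding 1-cochain on the basis
  of A \<otimes> E, so one family serves all relations k at once.\<close>

lemma coboundary_2:
  assumes "z \<in> hc.B 2"
  obtains s where "\<forall>k\<in>R. z (kten k) = cls R (\<Sum>m\<in>UNIV. rdiv m k * s m)"
proof -
  obtain h where h: "h \<in> lhom A (K 1) (regular_module A)" "z = (\<lambda>x\<in>carrier (K 2). h (dK 1 x))"
    using assms by (auto simp: numeral_2_eq_2)
  obtain s where s: "h = evm 1 s" using lhom_low_evm[OF _ h(1)] by auto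
  have "z (kten k) = cls R (\<Sum>m\<in>UNIV. rdiv m k * s [m])" if k: "k \<in> R" for k
  proof -
    have kK: "kten k \<in> carrier (K 2)" using k by (intro kten_in) (simp add: koszul_2)
    have k2: "rdiv m k \<in> tens_power 1" for m
      using k rel_subset by (auto simp: tens_power_iff)
    have d: "dK 1 (kten k) = (\<lambda>w. cls R (\<Sum>l\<in>UNIV. tens_scale (coef k (l # w)) (gen l)))"
      using kK by (simp add: dK_def koszul_diff_cls kten_def numeral_2_eq_2 flip: tens_scale_mult_left)
    have "dK 1 (kten k) \<in> carrier (K 1)"
      using hc.d_closed[of "kten k" 1] kK by (simp add: numeral_2_eq_2)
    then have "h (dK 1 (kten k)) = cls R (\<Sum>m\<in>UNIV. (\<Sum>l\<in>UNIV. tens_scale (coef k [l, m]) (gen l)) * s [m])"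
      unfolding s d using evm_cls[of _ 1 s] by (simp add: sum_words_1)
    also have "\<dots> = cls R (\<Sum>m\<in>UNIV. rdiv m k * s [m])"
      using tens_power_1[OF k2] by simp
    finally show ?thesis using kK by (simp add: h(2))
  qed
  then show ?thesis by (intro that[of "\<lambda>m. s [m]"] ballI)
qed

lemma evm_kten:
  assumes "k \<in> R" "length i = 2"
  shows "evm 2 (\<lambda>v. if v = i then s else 0) (kten k) = cls R (tens_scale (coef k i) s)"
proof -
  have "kten k \<in> carrier (K 2)" using assms by (intro kten_in) (simp add: koszul_2)
  then show ?thesis
    using evm_cls[of "\<lambda>w. tens_scale (coef k w) 1" 2 "\<lambda>v. if v = i then s else 0"] assms(2)
    by (simp add: kten_def if_distrib[of "tens_scale _"] cong: if_cong flip: tens_scale_mult_left)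
qed

lemma evm_kten2:
  assumes "k \<in> R" "length i = 2" "length j = 2"
  shows "evm 2 (\<lambda>v. (if v = i then s else 0) + (if v = j then t else 0)) (kten k) =
    cls R (tens_scale (coef k i) s + tens_scale (coef k j) t)"
proof -
  have "kten k \<in> carrier (K 2)" using assms by (intro kten_in) (simp add: koszul_2)
  then show ?thesis
    using evm_cls[of "\<lambda>w. tens_scale (coef k w) 1" 2
        "\<lambda>v. (if v = i then s else 0) + (if v = j then t else 0)"] assms(2,3)
    by (simp add: kten_def distrib_left sum.distrib if_distrib[of "tens_scale _"]
        tens.scale_right_distrib cong: if_cong flip: tens_scale_mult_left)
qed

lemma evm_HZ:
  "evm 2 (\<lambda>v. tens_scale a (s v) + tens_scale c (t v)) =
    (a \<odot>\<^bsub>hc.HZ 2\<^esub> evm 2 s) \<oplus>\<^bsub>hc.HZ 2\<^esub> (c \<odot>\<^bsub>hc.HZ 2\<^esub> evm 2 t)"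
proof -
  have "evm 2 (\<lambda>v. tens_scale a (s v) + tens_scale c (t v)) f =
      ((a \<odot>\<^bsub>A\<^esub> \<one>\<^bsub>A\<^esub>) \<otimes>\<^bsub>A\<^esub> evm 2 s f) \<oplus>\<^bsub>A\<^esub> ((c \<odot>\<^bsub>A\<^esub> \<one>\<^bsub>A\<^esub>) \<otimes>\<^bsub>A\<^esub> evm 2 t f)"
    if f: "f \<in> carrier (K 2)" for f
  proof -
    obtain u where u: "f = (\<lambda>w. cls R (u w))" using koszul_memE[OF f] by blast
    have evmc: "evm 2 s f = cls R (\<Sum>v\<in>W 2. u v * s v)" for s
      using f unfolding u by (rule evm_cls)
    show ?thesis
      unfolding evmc
      by (simp add: quad_algebra_simps distrib_left sum.distrib tens.scale_sum_right
          flip: tens_scale_mult_left tens_scale_mult_right)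
  qed
  then have "(\<lambda>f\<in>carrier (K 2). evm 2 (\<lambda>v. tens_scale a (s v) + tens_scale c (t v)) f) =
      (a \<odot>\<^bsub>hc.HZ 2\<^esub> evm 2 s) \<oplus>\<^bsub>hc.HZ 2\<^esub> (c \<odot>\<^bsub>hc.HZ 2\<^esub> evm 2 t)"
    by (auto intro!: restrict_ext)
  then show ?thesis by (simp add: evm_def cong: restrict_cong)
qed

text \<open>A functional on the two-cocycles, with the coboundaries as kernel, has to vanish on some
  nontrivial combination of any two cocycles. Evaluating such combinations on relations first
  shows that there is only one relation, and then that the \<open>y\<^sub>m\<close> span the generators.\<close>

lemma single_relation:
  assumes "2 \<le> CARD('n)"
  obtains b h where "form_tensor b h" "R = tens_span {b}"
proof -
  obtain D where D: "global_dim A = enat D"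
    and iso: "isomorphic_modules field_ring
      (Ext TYPE(('k, 'n) word_fun) A trivial_module (regular_module A) D) (regular_module field_ring)"
    using gor unfolding gorenstein_def Let_def by blast
  have "D = 2" using D gd by (simp add: numeral_eq_enat)
  note lk = left_module_regular[OF ring_field_ring]
  obtain f where f: "f \<in> lhom field_ring (hc.HZ 2) (regular_module field_ring)"
    and surj: "f ` hc.Z 2 = carrier (regular_module field_ring)"
    and ker: "\<forall>x\<in>hc.Z 2. f x = \<zero>\<^bsub>regular_module field_ring\<^esub> \<longleftrightarrow> x \<in> hc.B 2"
    using iso[unfolded \<open>D = 2\<close> hc.Ext_isomorphic_iff[OF left_module_trivial lk]]
    by (elim bexE conjE) (rule that; assumption)
  have fB: "f (evm 2 s) = 0 \<longleftrightarrow> evm 2 s \<in> hc.B 2" for s using bspec[OF ker evm_in_Z2] by simp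
  have flin: "f (evm 2 (\<lambda>v. tens_scale a (s v) + tens_scale c (t v))) = a * f (evm 2 s) + c * f (evm 2 t)"
    for a c s t
  proof -
    have m: "c \<odot>\<^bsub>hc.HZ 2\<^esub> evm 2 s \<in> carrier (hc.HZ 2)" for c s
      using left_module.smult_closed[OF hc.left_module_HZ, of c "evm 2 s" 2] evm_in_Z2 by simp
    have m': "f (c \<odot>\<^bsub>hc.HZ 2\<^esub> evm 2 s) = c * f (evm 2 s)" for c s
      using lhomD(4)[OF f, of c "evm 2 s"] evm_in_Z2[of s] by simp
    show ?thesis unfolding evm_HZ using lhomD(3)[OF f m m] by (simp only: m' regular_module_simps field_ring_simps)
  qed
  have "R \<noteq> {0}"
  proof
    assume "R = {0}"
    with koszul_2 have "koszul_space R 2 = {0}" by (rule trans)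
    from koszul_zero_space[OF this] have "hc.Z 2 \<subseteq> hc.B 2"
      by (intro hc.Z_subset_B_zero_module) (simp only: koszul_module_simps)
    then have "f ` hc.Z 2 \<subseteq> {0}" using ker by auto
    then have "(UNIV :: 'k set) \<subseteq> {0}" by (simp only: surj regular_module_simps field_ring_simps)
    then have "(1 :: 'k) \<in> {0}" by (rule subsetD[OF _ UNIV_I])
    then show False by simp
  qed
  moreover have "0 \<in> R" by (rule tens.subspace_0[OF rel_subspace])
  ultimately obtain b where b: "b \<in> R" "b \<noteq> 0" by blast
  have nz: "\<exists>i. length i = 2 \<and> coef r i \<noteq> 0" if "r \<in> R" "r \<noteq> 0" for r
  proof -
    obtain i where i: "coef r i \<noteq> 0" using \<open>r \<noteq> 0\<close> poly_mapping_eqI[of r 0] by auto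
    then show ?thesis using subsetD[OF rel_subset that(1)] by (auto simp: tens_power_iff)
  qed
  obtain i where i: "length i = 2" "coef b i \<noteq> 0" using nz[OF b] by blast
  \<comment> \<open>The value of the functional on the cochain reading coordinate \<open>i\<close>.
    It is nonzero, since this cochain takes at b a value with constant term \<open>coef b i\<close>
    and thus is no coboundary.\<close>
  define c0 where "c0 = f (evm 2 (\<lambda>v. if v = i then 1 else 0))"
  have Baug: "augmentation (z (kten k)) = 0" if z: "z \<in> hc.B 2" and k: "k \<in> R" for z k
  proof -
    obtain s where "\<forall>k\<in>R. z (kten k) = cls R (\<Sum>m\<in>UNIV. rdiv m k * s m)" using coboundary_2[OF z] .
    moreover have "coef (rdiv m k) [] = 0" for m using subsetD[OF rel_subset k] by (simp add: tens_power_iff)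
    ultimately show ?thesis using k by (simp add: lookup_sum coef_mult_Nil)
  qed
  have "c0 \<noteq> 0"
  proof
    assume "c0 = 0"
    then have "evm 2 (\<lambda>v. if v = i then 1 else 0) \<in> hc.B 2" using fB by (simp add: c0_def)
    from Baug[OF this b(1)] show False using i b(1) by (simp add: evm_kten)
  qed
  have Rb: "R = tens_span {b}"
  proof (intro equalityI subsetI)
    fix r assume r: "r \<in> R"
    \<comment> \<open>The multiple of b is chosen to cancel coordinate \<open>i\<close>, so that the
      cochain reading that coordinate does not see \<open>r'\<close>.\<close>
    define r' where "r' = r - tens_scale (coef r i / coef b i) b"
    have r': "r' \<in> R" using r b(1) rel_subspace by (simp add: r'_def tens_subspace_memI)
    have ri: "coef r' i = 0" using i by (simp add: r'_def lookup_minus)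
    have "r' = 0"
    proof (rule ccontr)
      assume "r' \<noteq> 0"
      then obtain j where j: "length j = 2" "coef r' j \<noteq> 0" using nz[OF r'] by blast
      define c1 where "c1 = f (evm 2 (\<lambda>v. if v = j then 1 else 0))"
      \<comment> \<open>The combination c1 E_i - c0 E_j of coordinate cochains lies in the kernel of
        the functional and hence is a coboundary; its value at 1 \<otimes> r' is the constant -c0
        times coordinate j of r', which contradicts \<open>Baug\<close>.\<close>
      let ?s = "\<lambda>v. (if v = i then tens_scale c1 1 else 0) + (if v = j then tens_scale (- c0) 1 else 0)"
      let ?t = "\<lambda>v. tens_scale c1 (if v = i then 1 else 0) + tens_scale (- c0) (if v = j then 1 else 0)"
      have "f (evm 2 ?s) = f (evm 2 ?t)" by (rule arg_cong[where f = "\<lambda>s. f (evm 2 s)"]) auto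
      also have "\<dots> = c1 * c0 + - c0 * c1" unfolding c0_def c1_def by (rule flin)
      finally have "f (evm 2 ?s) = c1 * c0 + - c0 * c1" .
      then have "evm 2 ?s \<in> hc.B 2" using fB[of ?s] by simp
      from Baug[OF this r'] show False
        using \<open>c0 \<noteq> 0\<close> j ri by (simp add: evm_kten2[OF r' i(1) j(1)] lookup_add)
    qed
    then have "r = tens_scale (coef r i / coef b i) b" by (simp add: r'_def)
    then show "r \<in> tens_span {b}" by (auto simp: tens.span_singleton)
  next
    fix r assume "r \<in> tens_span {b}"
    then show "r \<in> R" using b(1) rel_subspace by (auto simp: tens.span_singleton tens_subspace_memI)
  qed
  have "\<exists>h. \<forall>j. (\<Sum>m\<in>UNIV. coef b [j, m] * h m) = (if j = l then 1 else 0)" for l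
  proof -
    \<comment> \<open>The same elimination with E_i multiplied by x^l. Constant terms at b force
      \<open>cl = 0\<close>, so c0 x^l E_i is itself a coboundary and x^l lies in the right ideal
      generated by the right quotients of b.\<close>
    define cl where "cl = f (evm 2 (\<lambda>v. if v = i then gen l else 0))"
    let ?s = "\<lambda>v. if v = i then tens_scale c0 (gen l) + tens_scale (- cl) 1 else 0"
    let ?t = "\<lambda>v. tens_scale c0 (if v = i then gen l else 0) + tens_scale (- cl) (if v = i then 1 else 0)"
    have "f (evm 2 ?s) = f (evm 2 ?t)" by (rule arg_cong[where f = "\<lambda>s. f (evm 2 s)"]) auto
    also have "\<dots> = c0 * cl + - cl * c0" unfolding c0_def cl_def by (rule flin)
    finally have "f (evm 2 ?s) = c0 * cl + - cl * c0" .
    then have B: "evm 2 ?s \<in> hc.B 2" using fB[of ?s] by simp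
    have "coef b i * cl = 0"
      using Baug[OF B b(1)] by (simp add: evm_kten[OF b(1) i(1)] lookup_add lookup_minus coef_gen)
    then have cl: "cl = 0" using i by simp
    obtain s where s: "\<forall>k\<in>R. evm 2 ?s (kten k) = cls R (\<Sum>m\<in>UNIV. rdiv m k * s m)"
      using coboundary_2[OF B] .
    have "cls R (tens_scale (coef b i) (tens_scale c0 (gen l) + tens_scale (- cl) 1)) =
        cls R (\<Sum>m\<in>UNIV. rdiv m b * s m)"
      using bspec[OF s b(1)] unfolding evm_kten[OF b(1) i(1)] .
    then have "cls R (tens_scale (coef b i * c0) (gen l)) = cls R (\<Sum>m\<in>UNIV. rdiv m b * s m)"
      by (simp add: cl)
    then have mem: "tens_scale (coef b i * c0) (gen l) - (\<Sum>m\<in>UNIV. rdiv m b * s m) \<in> rel_ideal R"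
      by (simp only: cls_eq_iff)
    \<comment> \<open>The ideal begins in degree two, so coefficients of single letters may be
      compared. Division by \<open>coef b i * c0\<close>, nonzero but not normalised, yields column
      l of the inverse matrix.\<close>
    have "(\<Sum>m\<in>UNIV. coef b [j, m] * (coef (s m) [] / (coef b i * c0))) = (if j = l then 1 else 0)" for j
    proof -
      have b1: "coef b [m] = 0" for m using subsetD[OF rel_subset b(1)] by (simp add: tens_power_iff)
      have "(\<Sum>m\<in>UNIV. coef b [j, m] * coef (s m) []) = coef b i * c0 * (if j = l then 1 else 0)"
        using rel_ideal_low_coef(2)[OF rel_subset mem, of j]
        by (simp add: lookup_minus lookup_sum coef_mult_single coef_gen b1 split: if_splits)
      then show ?thesis using i(2) \<open>c0 \<noteq> 0\<close> by (simp flip: sum_divide_distrib add: field_simps)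
    qed
    then show ?thesis by (intro exI[of _ "\<lambda>m. coef (s m) [] / (coef b i * c0)"] allI)
  qed
  then obtain h where h: "\<forall>l j. (\<Sum>m\<in>UNIV. coef b [j, m] * h l m) = (if j = l then 1 else 0)"
    using choice[of "\<lambda>l h. \<forall>j. (\<Sum>m\<in>UNIV. coef b [j, m] * h m) = (if j = l then 1 else 0)"] by auto
  have "form_tensor b (\<lambda>m l. h l m)"
    using subsetD[OF rel_subset b(1)] h assms
      matrix_right_inverse_left[of "\<lambda>j m. coef b [j, m]" "\<lambda>m l. h l m"]
    by (intro form_tensor.intro) simp_all
  then show ?thesis using Rb by (rule that)
qed

end

section \<open>Bilinear forms and linear substitutions\<close>

definition form_tens :: "('k::field ^ 'n \<Rightarrow> 'k ^ 'n \<Rightarrow> 'k) \<Rightarrow> ('k, 'n::finite) tens"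
  where "form_tens B = (\<Sum>m\<in>UNIV. \<Sum>n\<in>UNIV. tens_scale (B (axis m 1) (axis n 1)) (gen m * gen n))"

lemma form_relations_eq: "form_relations B = tens_span {form_tens B}"
  by (simp add: form_relations_def form_tens_def)

lemma coef_gen_gen: "coef (gen m * gen n) w = (if w = [m, n] then 1 else 0)"
  by (auto simp: gen_def mon_mult coef_mon)

lemma sum_gen_gen:
  fixes t :: "('k::field, 'n::finite) tens"
  assumes "t \<in> tens_power 2"
  shows "t = (\<Sum>m\<in>UNIV. \<Sum>n\<in>UNIV. tens_scale (coef t [m, n]) (gen m * gen n))"
proof (rule poly_mapping_eqI)
  fix w
  show "coef t w = coef (\<Sum>m\<in>UNIV. \<Sum>n\<in>UNIV. tens_scale (coef t [m, n]) (gen m * gen n)) w"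
  proof (cases "length w = 2")
    case True
    then obtain i j where w: "w = [i, j]" by (auto simp: length_Suc_conv numeral_2_eq_2)
    have "(\<Sum>m\<in>UNIV. \<Sum>n\<in>UNIV. coef t [m, n] * (if i = m \<and> j = n then 1 else 0)) =
        (\<Sum>m\<in>UNIV. if i = m then coef t [m, j] else 0)"
      by (intro sum.cong refl) (auto simp: if_distrib[of "\<lambda>x. _ * x"] cong: if_cong)
    then show ?thesis by (simp add: w lookup_sum coef_gen_gen)
  next
    case False
    then have "w \<noteq> [m, n]" for m n by auto
    then show ?thesis using False assms by (simp add: lookup_sum coef_gen_gen tens_power_iff)
  qed
qed

lemma coef_form_tens: "coef (form_tens B) [i, j] = B (axis i 1) (axis j 1)"
proof -
  have "(\<Sum>m\<in>UNIV. \<Sum>n\<in>UNIV. B (axis m 1) (axis n 1) * (if i = m \<and> j = n then 1 else 0)) =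
      (\<Sum>m\<in>UNIV. if i = m then B (axis m 1) (axis j 1) else 0)"
    by (intro sum.cong refl) (auto simp: if_distrib[of "\<lambda>x. _ * x"] cong: if_cong)
  then show ?thesis by (simp add: form_tens_def lookup_sum coef_gen_gen)
qed

lemma form_tens_power:
  fixes B :: "'k::field ^ 'n::finite \<Rightarrow> 'k ^ 'n \<Rightarrow> 'k"
  shows "form_tens B \<in> tens_power 2"
proof -
  have "gen m * gen n \<in> (tens_power 2 :: ('k, 'n) tens set)" for m n
    by (auto simp: tens_power_iff coef_gen_gen)
  then show ?thesis
    unfolding form_tens_def
    by (intro tens_subspace_sum subspace_tens_power tens_subspace_memI(5)[OF subspace_tens_power])
qed

lemma linear_functional_expand:
  assumes "Vector_Spaces.linear (*s) (*) f"
  shows "f x = (\<Sum>i\<in>UNIV. x $ i * f (axis i 1))"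
proof -
  interpret Vector_Spaces.linear "(*s)" "(*)" f by fact
  have "f x = f (\<Sum>i\<in>UNIV. x $ i *s axis i 1)" by (simp add: basis_expansion)
  then show ?thesis by (simp add: sum scale)
qed

lemma bilinear_form_expand:
  assumes "bilinear_form B"
  shows "B x y = (\<Sum>i\<in>UNIV. \<Sum>j\<in>UNIV. x $ i * y $ j * B (axis i 1) (axis j 1))"
proof -
  have "B x y = (\<Sum>i\<in>UNIV. x $ i * B (axis i 1) y)"
    using assms by (intro linear_functional_expand) (simp add: bilinear_form_def)
  also have "\<dots> = (\<Sum>i\<in>UNIV. x $ i * (\<Sum>j\<in>UNIV. y $ j * B (axis i 1) (axis j 1)))"
    using assms linear_functional_expand[of "B (axis _ 1)" y] by (simp add: bilinear_form_def)
  finally show ?thesis by (simp add: sum_distrib_left mult.assoc)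
qed

text \<open>Nondegeneracy in the second argument says that the Gram matrix has trivial kernel; a
  left inverse of a square matrix is two-sided.\<close>

lemma nondegenerate_form_tensor:
  fixes B :: "'k::field ^ 'n \<Rightarrow> 'k ^ 'n \<Rightarrow> 'k"
  assumes "bilinear_form B" "nondegenerate B" "2 \<le> CARD('n::finite)"
  obtains g where "form_tensor (form_tens B) g"
proof -
  let ?M = "(\<chi> i j. B (axis i 1) (axis j 1)) :: 'k ^ 'n ^ 'n"
  have MB: "B x y = (\<Sum>i\<in>UNIV. x $ i * (?M *v y) $ i)" for x y
    unfolding bilinear_form_expand[OF assms(1), of x y]
    by (simp add: matrix_vector_mult_def sum_distrib_left mult_ac)
  have "B x y = 0" if "?M *v y = 0" for x y
    by (subst MB) (simp add: that)
  then have "y = 0" if "?M *v y = 0" for y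
    using assms(2) that unfolding nondegenerate_def by blast
  then have "\<exists>G. G ** ?M = mat 1" by (simp add: matrix_left_invertible_ker)
  then obtain G where G: "G ** ?M = mat 1" ..
  have l: "(\<Sum>m\<in>UNIV. G $ i $ m * B (axis m 1) (axis j 1)) = (if i = j then 1 else 0)" for i j
    using arg_cong[OF G, of "\<lambda>M. M $ i $ j"] by (simp add: matrix_matrix_mult_def mat_def)
  from matrix_right_inverse_left[of "\<lambda>i j. G $ i $ j" "\<lambda>i j. B (axis i 1) (axis j 1)", OF l]
  have "form_tensor (form_tens B) (\<lambda>i j. G $ i $ j)"
    using l assms(3) by (intro form_tensor.intro form_tens_power) (simp_all add: coef_form_tens)
  then show ?thesis by (rule that)
qed

lemma (in form_tensor) form_exists:
  obtains B where "bilinear_form B" "nondegenerate B" "form_tens B = b"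
proof -
  let ?B = "\<lambda>x y :: 'k ^ 'n. \<Sum>i\<in>UNIV. \<Sum>j\<in>UNIV. x $ i * y $ j * coef b [i, j]"
  have e: "?B (axis i 1) (axis j 1) = coef b [i, j]" for i j
  proof -
    have "?B (axis i 1) (axis j 1) = (\<Sum>k\<in>UNIV. if k = i then coef b [i, j] else 0)"
      by (intro sum.cong refl) (simp add: axis_def if_distrib[of "\<lambda>x. x * _"] cong: if_cong)
    then show ?thesis by simp
  qed
  have "bilinear_form ?B"
    unfolding bilinear_form_def
    by (intro conjI allI; unfold_locales)
      (simp_all add: algebra_simps sum.distrib sum_distrib_left)
  moreover have "nondegenerate ?B"
    unfolding nondegenerate_def
  proof (intro conjI allI impI)
    fix y :: "'k ^ 'n" assume y: "\<forall>x. ?B x y = 0"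
    have "(\<Sum>n\<in>UNIV. coef b [m, n] * y $ n) = 0" for m
    proof -
      have "?B (axis m 1) y = (\<Sum>i\<in>UNIV. if i = m then (\<Sum>n\<in>UNIV. coef b [m, n] * y $ n) else 0)"
        by (intro sum.cong refl) (simp add: axis_def mult.commute)
      then show ?thesis using y by simp
    qed
    then have "y $ l = 0" for l by (rule b_inject)
    then show "y = 0" by (simp add: vec_eq_iff)
  next
    fix x :: "'k ^ 'n" assume x: "\<forall>y. ?B x y = 0"
    interpret rv: form_tensor "reversal b" "\<lambda>i j. g j i" by (rule reversed)
    have "(\<Sum>n\<in>UNIV. coef (reversal b) [m, n] * x $ n) = 0" for m
    proof -
      have "?B x (axis m 1) = (\<Sum>i\<in>UNIV. coef b [i, m] * x $ i)"
        by (intro sum.cong refl)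
          (simp add: axis_def if_distrib[of "\<lambda>x. x * _"] if_distrib[of "\<lambda>y. _ * y"] mult.commute cong: if_cong)
      then show ?thesis using x by simp
    qed
    then have "x $ l = 0" for l by (rule rv.b_inject)
    then show "x = 0" by (simp add: vec_eq_iff)
  qed
  moreover have "form_tens ?B = b"
    using sum_gen_gen[OF b2] by (simp only: form_tens_def e)
  ultimately show ?thesis by (rule that)
qed

section \<open>Substitution homomorphisms of tensor algebras and isomorphic forms\<close>

definition tsubst :: "('n \<Rightarrow> ('k::field, 'm) tens) \<Rightarrow> ('k, 'n) tens \<Rightarrow> ('k, 'm) tens"
  where "tsubst \<rho> t = (\<Sum>w\<in>Poly_Mapping.keys t. tens_scale (coef t w) (prod_list (map \<rho> w)))"

lemma tsubst_superset:
  assumes "finite F" "Poly_Mapping.keys t \<subseteq> F"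
  shows "tsubst \<rho> t = (\<Sum>w\<in>F. tens_scale (coef t w) (prod_list (map \<rho> w)))"
  unfolding tsubst_def by (rule sum.mono_neutral_left) (use assms in \<open>auto simp: in_keys_iff\<close>)

lemma tsubst_add [simp]: "tsubst \<rho> (s + t) = tsubst \<rho> s + tsubst \<rho> t"
proof -
  let ?F = "Poly_Mapping.keys s \<union> Poly_Mapping.keys t"
  have "tsubst \<rho> r = (\<Sum>w\<in>?F. tens_scale (coef r w) (prod_list (map \<rho> w)))"
    if "r \<in> {s, t, s + t}" for r
    using that keys_add[of s t] by (intro tsubst_superset) auto
  then show ?thesis by (simp add: lookup_add tens.scale_left_distrib sum.distrib)
qed

lemma tsubst_mon [simp]: "tsubst \<rho> (mon w c) = tens_scale c (prod_list (map \<rho> w))"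
  using tsubst_superset[of "{w}" "mon w c" \<rho>] by simp

lemma tsubst_scale [simp]: "tsubst \<rho> (tens_scale c t) = tens_scale c (tsubst \<rho> t)"
  by (induction t rule: tens_induct) (simp_all add: tens.scale_right_distrib)

lemma tsubst_zero [simp]: "tsubst \<rho> 0 = 0"
  by (simp add: tsubst_def)

lemma tsubst_sum [simp]: "tsubst \<rho> (\<Sum>i\<in>F. f i) = (\<Sum>i\<in>F. tsubst \<rho> (f i))"
  by (induction F rule: infinite_finite_induct) simp_all

lemma tsubst_mult [simp]: "tsubst \<rho> (s * t) = tsubst \<rho> s * tsubst \<rho> t"
proof (induction s rule: tens_induct)
  case (mon w c)
  show ?case
    by (induction t rule: tens_induct)
      (simp_all add: mon_mult distrib_left flip: tens_scale_mult_left tens_scale_mult_right)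
qed (simp add: distrib_right)

lemma tsubst_gen [simp]: "tsubst \<rho> (gen l) = \<rho> l"
  by (simp add: gen_def)

lemma tsubst_one [simp]: "tsubst \<rho> 1 = 1"
  using tsubst_mon[of \<rho> "[]" 1] by simp

lemma tsubst_tsubst: "tsubst \<sigma> (tsubst \<rho> t) = tsubst (\<lambda>l. tsubst \<sigma> (\<rho> l)) t"
proof (induction t rule: tens_induct)
  case (mon w c)
  have "tsubst \<sigma> (prod_list (map \<rho> w)) = prod_list (map (\<lambda>l. tsubst \<sigma> (\<rho> l)) w)"
    by (induction w) simp_all
  then show ?case by simp
qed simp

lemma tsubst_id:
  fixes t :: "('k::field, 'n) tens"
  shows "tsubst gen t = t"
proof (induction t rule: tens_induct)
  case (mon w c)
  have "prod_list (map gen w) = (mon w 1 :: ('k, 'n) tens)" by (induction w) (simp_all add: gen_def mon_mult)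
  then show ?case by simp
qed simp

lemma tsubst_power:
  assumes "\<And>l. \<rho> l \<in> tens_power 1" "t \<in> tens_power n"
  shows "tsubst \<rho> t \<in> tens_power n"
proof -
  have "prod_list (map \<rho> w) \<in> tens_power (length w)" for w
  proof (induction w)
    case Nil
    show ?case using mon_in_tens_power[of "[]" 0 1] by simp
  next
    case (Cons l w)
    then show ?case using tens_power_mult[OF assms(1)] by fastforce
  qed
  then show ?thesis
    unfolding tsubst_def using assms(2)
    by (intro tens_subspace_sum subspace_tens_power tens_subspace_memI(5)[OF subspace_tens_power])
      (auto simp: tens_power_def)
qed

text \<open>Two mutually inverse linear substitutions that respect the ideals in both directions
  descend to inverse maps of the quotients.\<close>

lemma isomorphic_algebras_tsubst:
  fixes R S :: "('k::field, 'n) tens set"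
  assumes \<rho>: "\<And>l. \<rho> l \<in> tens_power 1" and \<sigma>: "\<And>l. \<sigma> l \<in> tens_power 1"
    and \<sigma>\<rho>: "\<And>l. tsubst \<sigma> (\<rho> l) = gen l" and \<rho>\<sigma>: "\<And>l. tsubst \<rho> (\<sigma> l) = gen l"
    and R: "\<And>r. r \<in> R \<Longrightarrow> tsubst \<rho> r \<in> rel_ideal S" and S: "\<And>s. s \<in> S \<Longrightarrow> tsubst \<sigma> s \<in> rel_ideal R"
  shows "isomorphic_algebras (quad_algebra R) (quad_algebra S)"
proof -
  have inv1: "tsubst \<sigma> (tsubst \<rho> t) = t" for t by (simp add: tsubst_tsubst \<sigma>\<rho> tsubst_id)
  have inv2: "tsubst \<rho> (tsubst \<sigma> t) = t" for t by (simp add: tsubst_tsubst \<rho>\<sigma> tsubst_id)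
  have RI: "tsubst \<rho> t \<in> rel_ideal S" if "t \<in> rel_ideal R" for t
    by (rule rel_ideal_minimal[OF R _ _ _ that]) simp_all
  have SI: "tsubst \<sigma> t \<in> rel_ideal R" if "t \<in> rel_ideal S" for t
    by (rule rel_ideal_minimal[OF S _ _ _ that]) simp_all
  have diff: "tsubst \<tau> (s - t) = tsubst \<tau> s - tsubst \<tau> t" for s t and \<tau> :: "'n \<Rightarrow> ('k, 'n) tens"
    using tsubst_add[of \<tau> "s - t" t] by (simp add: algebra_simps)
  \<comment> \<open>The union over all representatives avoids choosing one; it is a single coset
    because the substitution respects the ideals.\<close>
  define h where "h Y = (\<Union>t\<in>Y. cls S (tsubst \<rho> t))" for Y
  have h: "h (cls R t) = cls S (tsubst \<rho> t)" for t
    unfolding h_def by (rule cls_Union[OF cls_nonempty]) (simp add: mem_cls_iff RI flip: diff)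
  have "h \<in> ring_hom (quad_algebra R) (quad_algebra S)"
    by (rule ring_hom_memI) (auto simp: quad_algebra_simps h)
  moreover have "bij_betw h (carrier (quad_algebra R)) (carrier (quad_algebra S))"
    unfolding bij_betw_def
  proof
    show "inj_on h (carrier (quad_algebra R))"
    proof (rule inj_onI)
      fix x y assume "x \<in> carrier (quad_algebra R)" "y \<in> carrier (quad_algebra R)" and e: "h x = h y"
      then obtain s t where st: "x = cls R s" "y = cls R t" by (auto simp: quad_algebra_simps)
      then have "tsubst \<rho> (s - t) \<in> rel_ideal S" using e by (simp add: h cls_eq_iff diff)
      from SI[OF this] show "x = y" by (simp add: inv1 st cls_eq_iff)
    qed
    have "cls S t \<in> h ` carrier (quad_algebra R)" for t
      by (rule image_eqI[of _ _ "cls R (tsubst \<sigma> t)"]) (simp_all add: h inv2)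
    then show "h ` carrier (quad_algebra R) = carrier (quad_algebra S)"
      by (auto simp: quad_algebra_simps h)
  qed
  moreover have "h ` homogeneous_part (quad_algebra R) n = homogeneous_part (quad_algebra S) n" for n
  proof -
    have hp: "homogeneous_part (quad_algebra V) n = cls V ` tens_power n" for V :: "('k, 'n) tens set"
    proof -
      have "a \<in> cls V ` tens_power n" if a: "a \<in> carrier (quad_algebra V)" "t \<in> tens_power n" "t \<in> a" for a t
      proof -
        obtain s where s: "a = cls V s" using a(1) by (rule quad_carrierE)
        then have "a = cls V t" using a(3) by (simp add: mem_cls_iff cls_eq_iff[symmetric])
        then show ?thesis using a(2) by blast
      qed
      then show ?thesis unfolding homogeneous_part_def using cls_self by fastforce
    qed
    have "t \<in> tsubst \<rho> ` tens_power n" if "t \<in> tens_power n" for t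
      by (rule image_eqI[OF _ tsubst_power[of \<sigma>, OF \<sigma> that]]) (simp add: inv2)
    \<comment> \<open>Both substitutions preserve degree and they are inverse to each other, so each
      tensor power is mapped onto itself, not merely into itself.\<close>
    then have "tsubst \<rho> ` tens_power n = tens_power n" using tsubst_power[of \<rho>, OF \<rho>] by blast
    then have "cls S ` tsubst \<rho> ` tens_power n = cls S ` tens_power n" by simp
    then show ?thesis unfolding hp by (simp add: image_image h)
  qed
  ultimately show ?thesis
    unfolding isomorphic_algebras_def ring_iso_def
    by (intro bexI[of _ h]) (auto simp: quad_algebra_simps h)
qed

lemma sum_swap4:
  "(\<Sum>i\<in>U. \<Sum>j\<in>U. \<Sum>m\<in>U. \<Sum>n\<in>U. f i j m n) = (\<Sum>m\<in>U. \<Sum>n\<in>U. \<Sum>i\<in>U. \<Sum>j\<in>U. f i j m n)"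
proof -
  have "(\<Sum>i\<in>U. \<Sum>j\<in>U. \<Sum>m\<in>U. \<Sum>n\<in>U. f i j m n) = (\<Sum>i\<in>U. \<Sum>m\<in>U. \<Sum>j\<in>U. \<Sum>n\<in>U. f i j m n)"
    by (rule sum.cong[OF refl]) (rule sum.swap)
  also have "\<dots> = (\<Sum>m\<in>U. \<Sum>i\<in>U. \<Sum>j\<in>U. \<Sum>n\<in>U. f i j m n)" by (rule sum.swap)
  also have "\<dots> = (\<Sum>m\<in>U. \<Sum>i\<in>U. \<Sum>n\<in>U. \<Sum>j\<in>U. f i j m n)"
    by (rule sum.cong[OF refl], rule sum.cong[OF refl]) (rule sum.swap)
  also have "\<dots> = (\<Sum>m\<in>U. \<Sum>n\<in>U. \<Sum>i\<in>U. \<Sum>j\<in>U. f i j m n)"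
    by (rule sum.cong[OF refl]) (rule sum.swap)
  finally show ?thesis .
qed

text \<open>With N the inverse of L, the components of C are the sums of N_im N_jn B_ij. Hence the
  substitution of x^l by the sum of N_lm x^m carries the relation of B exactly to that of C, and
  substitution by L reverses it.\<close>

lemma same_GL_orbit_isomorphic:
  fixes B C :: "'k::field ^ 'n \<Rightarrow> 'k ^ 'n \<Rightarrow> 'k"
  assumes "bilinear_form B" "same_GL_orbit B C"
  shows "isomorphic_algebras (quad_algebra (form_relations B)) (quad_algebra (form_relations C))"
proof -
  obtain L where L: "invertible L" and C: "C = form_action L B"
    using assms(2) by (auto simp: same_GL_orbit_def)
  define N where "N = matrix_inv L"
  define \<rho> where "\<rho> M = (\<lambda>l. \<Sum>m\<in>UNIV. tens_scale (M $ l $ m) (gen m) :: ('k, 'n) tens)" for M :: "'k ^ 'n ^ 'n"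
  have "L ** N = mat 1 \<and> N ** L = mat 1"
    unfolding N_def matrix_inv_def by (rule someI_ex) (use L in \<open>simp add: invertible_def\<close>)
  then have NL: "N ** L = mat 1" "L ** N = mat 1" by auto
  have \<rho>1: "\<rho> M l \<in> tens_power 1" for M l
    unfolding \<rho>_def by (intro tens_subspace_sum subspace_tens_power tens_subspace_memI(5) gen_in_tens_power)
  have inv: "tsubst (\<rho> M) (\<rho> M' l) = gen l" if "M' ** M = mat 1" for M M' l
  proof -
    have "tsubst (\<rho> M) (\<rho> M' l) = (\<Sum>m\<in>UNIV. tens_scale ((M' ** M) $ l $ m) (gen m))"
      by (simp add: \<rho>_def tens.scale_sum_right tens.scale_sum_left matrix_matrix_mult_def) (rule sum.swap)
    then show ?thesis
      by (simp add: that mat_def if_distrib[of "\<lambda>c. tens_scale c _"] cong: if_cong)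
  qed
  have ax: "(N *v axis m 1) $ i = N $ i $ m" for i m
    by (simp add: matrix_vector_mult_def axis_def if_distrib[of "\<lambda>x. _ * x"] cong: if_cong)
  have Cc: "C (axis m 1) (axis n 1) = (\<Sum>i\<in>UNIV. \<Sum>j\<in>UNIV. N $ i $ m * N $ j $ n * B (axis i 1) (axis j 1))" for m n
    unfolding C form_action_def N_def[symmetric]
    by (subst bilinear_form_expand[OF assms(1)]) (simp add: ax)
  have \<rho>\<rho>: "\<rho> N i * \<rho> N j = (\<Sum>m\<in>UNIV. \<Sum>n\<in>UNIV. tens_scale (N $ i $ m * N $ j $ n) (gen m * gen n))" for i j
    by (simp add: \<rho>_def sum_product mult.commute[of "N $ j $ _"] flip: tens_scale_mult_left tens_scale_mult_right)
  have "tsubst (\<rho> N) (form_tens B) =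
      (\<Sum>i\<in>UNIV. \<Sum>j\<in>UNIV. \<Sum>m\<in>UNIV. \<Sum>n\<in>UNIV.
        tens_scale (N $ i $ m * N $ j $ n * B (axis i 1) (axis j 1)) (gen m * gen n))"
    by (simp add: form_tens_def \<rho>\<rho> tens.scale_sum_right mult.commute)
  also have "\<dots> = (\<Sum>m\<in>UNIV. \<Sum>n\<in>UNIV. \<Sum>i\<in>UNIV. \<Sum>j\<in>UNIV.
        tens_scale (N $ i $ m * N $ j $ n * B (axis i 1) (axis j 1)) (gen m * gen n))"
    by (rule sum_swap4)
  also have "\<dots> = form_tens C"
    by (simp add: form_tens_def Cc tens.scale_sum_left)
  finally have BC: "tsubst (\<rho> N) (form_tens B) = form_tens C" .
  have CB: "tsubst (\<rho> L) (form_tens C) = form_tens B"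
    unfolding BC[symmetric] by (simp add: tsubst_tsubst inv[OF NL(1)] tsubst_id)
  have sp: "tsubst \<tau> r \<in> rel_ideal (tens_span {y})" if "r \<in> tens_span {x}" "tsubst \<tau> x = y"
    for \<tau> and r x y :: "('k, 'n) tens"
    using that by (auto simp: tens.span_singleton intro!: rel_ideal_memI(5) rel_ideal_base)
  show ?thesis
    unfolding form_relations_eq
    by (rule isomorphic_algebras_tsubst[of "\<rho> N" "\<rho> L"])
      (use \<rho>1 inv NL BC CB sp in auto)
qed

theorem theorem2p1:
  assumes "CARD('n::finite) \<ge> 2"
  shows
    "(\<forall>B :: 'k::{alg_closed_field, field_char_0} ^ 'n \<Rightarrow> 'k ^ 'n \<Rightarrow> 'k.
        bilinear_form B \<and> nondegenerate B \<longrightarrow>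
          koszul (form_relations B) \<and>
          global_dim (quad_algebra (form_relations B)) = 2 \<and>
          gorenstein (quad_algebra (form_relations B)))
     \<and>
     (\<forall>R :: ('k, 'n) tens set.
        relation_space R \<and> koszul R \<and> global_dim (quad_algebra R) = 2 \<and>
        gorenstein (quad_algebra R) \<longrightarrow>
          (\<exists>B. bilinear_form B \<and> nondegenerate B \<and>
             quad_algebra R = quad_algebra (form_relations B)))
     \<and>
     (\<forall>B C :: 'k ^ 'n \<Rightarrow> 'k ^ 'n \<Rightarrow> 'k.
        bilinear_form B \<and> nondegenerate B \<and> bilinear_form C \<and> nondegenerate C \<and>
        same_GL_orbit B C \<longrightarrow>
          isomorphic_algebras (quad_algebra (form_relations B))
                              (quad_algebra (form_relations C)))"
proof (intro conjI allI impI; elim conjE)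
  fix B :: "'k ^ 'n \<Rightarrow> 'k ^ 'n \<Rightarrow> 'k"
  assume "bilinear_form B" "nondegenerate B"
  then obtain g where "form_tensor (form_tens B) g"
    using nondegenerate_form_tensor assms by blast
  then interpret form_tensor "form_tens B" g .
  show "koszul (form_relations B)" "global_dim (quad_algebra (form_relations B)) = 2"
    "gorenstein (quad_algebra (form_relations B))"
    unfolding form_relations_eq by (rule koszul_form global_dim_form gorenstein_form)+
next
  fix R :: "('k, 'n) tens set"
  assume R: "relation_space R" "koszul R" "global_dim (quad_algebra R) = 2"
    "gorenstein (quad_algebra R)"
  then interpret gorenstein2 R
    by (intro gorenstein2.intro quadratic.intro gorenstein2_axioms.intro)
  obtain b h where b: "form_tensor b h" and Rb: "R = tens_span {b}"
    by (rule single_relation[OF assms])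
  interpret form: form_tensor b h by (rule b)
  obtain B where "bilinear_form B" "nondegenerate B" "form_tens B = b"
    by (rule form.form_exists)
  then show "\<exists>B. bilinear_form B \<and> nondegenerate B \<and> quad_algebra R = quad_algebra (form_relations B)"
    by (intro exI[of _ B]) (simp add: form_relations_eq Rb)
next
  fix B C :: "'k ^ 'n \<Rightarrow> 'k ^ 'n \<Rightarrow> 'k"
  assume "bilinear_form B" "same_GL_orbit B C"
  then show "isomorphic_algebras (quad_algebra (form_relations B)) (quad_algebra (form_relations C))"
    by (rule same_GL_orbit_isomorphic)
qed

end
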